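(* Let $r_t$, $P_t^0$, $Q_t^0$ satisfy (R0), (S1), (H1)–(H4) and assume (S3), with $p_0,q_0,q,P_t$ as in the context. There exists a Borel set $\mathcal S_p\subseteq(0,1]\times\mathbb R^d\times\mathbb R^d$ such that $\mathcal S_p$ as well as every section $\mathcal S_p^{t,x}=\{y\in\mathbb R^d:(t,x,y)\in\mathcal S_p\}\subseteq\mathbb R^d$ ($t\in(0,1]$, $x\in\mathbb R^d$) are of full measure, and for all $t\in(0,1]$, $x\in\mathbb R^d$ and $f\in B_b(\mathbb R^d)$, $$P_tf(x)=\int_{\mathbb R^d}p(t,x,y)f(y)\,dy,$$ where a Borel function $p$ is given for all $t\in(0,1]$, $x,y\in\mathbb R^d$ by the following formula with absolutely convergent double integral $$p(t,x,y)=p_0(t,x,y)+\int_0^t\int_{\mathbb R^d}\mathbf 1_{\mathcal S_p}(t,x,y)\,p_0(t-s,x,z)q(s,z,y)\,dz\,ds.$$ Further, there exists $c>0$ such that for all $t\in(0,1]$ and $x\in\mathbb R^d$, $$\int_{\mathbb R^d}|p(t,x,y)|\,dy\le c.$$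
   Context: $B_b(\mathbb R^d)$ is the space of bounded Borel functions with the supremum norm $\|\cdot\|_\infty$. A Borel set is of full measure if its complement has Lebesgue measure zero. Assumptions: (R0) $t\mapsto r_t$ is a non-negative, non-decreasing function such that $r_{\lambda t}\le\sqrt\lambda\,r_t$ for all $t\in(0,1]$, $0<\lambda\le1$. (S1) For $t\in(0,1]$, $P_t^0,Q_t^0:B_b(\mathbb R^d)\to B_b(\mathbb R^d)$ are linear operators. (H1) There is $C_1>0$ with $\|P_t^0f\|_\infty\le C_1\|f\|_\infty$ for all $t\in(0,1]$, $f\in B_b(\mathbb R^d)$. (H2) $\lim_{s\to t}\|P_s^0f-P_t^0f\|_\infty=0$ for all $t\in(0,1]$, $f\in B_b(\mathbb R^d)$. (H3) There are $C_3,\varepsilon_0>0$ with $\|Q_t^0f\|_\infty\le C_3t^{-1}r_t^{\varepsilon_0}\|f\|_\infty$ for all $t\in(0,1]$, $f\in B_b(\mathbb R^d)$. (H4) $\lim_{s\to t}\|Q_s^0f-Q_t^0f\|_\infty=0$ for all $t\in(0,1]$, $f\in B_b(\mathbb R^d)$. (S3) There are Borel functions $p_0,q_0:(0,1]\times\mathbb R^d\times\mathbb R^d\to\mathbb R$ such that for all $t\in(0,1]$, $x\in\mathbb R^d$, $f\in B_b(\mathbb R^d)$, $P_t^0f(x)=\int_{\mathbb R^d}p_0(t,x,y)f(y)dy$ and $Q_t^0f(x)=\int_{\mathbb R^d}q_0(t,x,y)f(y)dy$, the integrals being absolutely convergent. Under (R0), (S1), (H1)–(H4) the following are well defined in $B_b(\mathbb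 R^d)$ (Bochner integrals, absolutely convergent series) for $t\in(0,1]$: $$Q_t^nf=\int_{0<s_1<\dots<s_n<t}Q_{t-s_n}^0Q^0_{s_n-s_{n-1}}\cdots Q_{s_2-s_1}^0Q_{s_1}^0f\,ds_1\cdots ds_n,\quad Q_tf=Q_t^0f+\sum_{n=1}^\infty Q_t^nf,\quad P_tf=P_t^0f+\int_0^tP_{t-s}^0Q_sf\,ds.$$ Definition of $q$: for $n\ge1$ let $\mathcal S_n$ be the set of $(t,x,y)\in(0,1]\times\mathbb R^d\times\mathbb R^d$ for which $$\int_{0<s_1<\dots<s_n<t}\int_{(\mathbb R^d)^n}|q_0(t-s_n,x,z_n)q_0(s_n-s_{n-1},z_n,z_{n-1})\cdots q_0(s_2-s_1,z_2,z_1)q_0(s_1,z_1,y)|\,dz_1\cdots dz_n\,ds_1\cdots ds_n<\infty,$$ and inductively $q_n(t,x,y)=\int_0^t\int_{\mathbb R^d}\mathbf 1_{\mathcal S_n}(t,x,y)q_0(t-s,x,z)q_{n-1}(s,z,y)\,dz\,ds$ (equal to $0$ off $\mathcal S_n$). Let $\mathcal S_q=\{(t,x,y):\sum_{n=0}^\infty|q_n(t,x,y)|<\infty\}$ and $q(t,x,y)=\sum_{n=0}^\infty\mathbf 1_{\mathcal S_q}(t,x,y)q_n(t,x,y)$ (equal to $0$ off $\mathcal S_q$). *)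

theory Defs
  imports "HOL-Analysis.Analysis"
begin

section \<open>The space of bounded Borel functions with the supremum norm\<close>

typedef (overloaded) 'a bborel =
    "{f :: 'a::topological_space \<Rightarrow> real. f \<in> borel_measurable borel \<and> bounded (range f)}"
  morphisms apply_bborel Bborel
  by (rule exI[of _ "\<lambda>_. 0"]) (auto intro!: boundedI)

setup_lifting type_definition_bborel

instantiation bborel :: (topological_space) real_vector
begin

lift_definition zero_bborel :: "'a bborel" is "\<lambda>_. 0"
  by (auto intro!: boundedI)

lift_definition plus_bborel :: "'a bborel \<Rightarrow> 'a bborel \<Rightarrow> 'a bborel" is "\<lambda>f g x. f x + g x"
  by (auto intro!: bounded_plus_comp)

lift_definition minus_bborel :: "'a bborel \<Rightarrow> 'a bborel \<Rightarrow> 'a bborel" is "\<lambda>f g x. f x - g x"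
  by (auto intro!: bounded_minus_comp)

lift_definition uminus_bborel :: "'a bborel \<Rightarrow> 'a bborel" is "\<lambda>f x. - f x"
  by (auto intro!: bounded_minus_comp[of "\<lambda>_. 0" UNIV, simplified])

lift_definition scaleR_bborel :: "real \<Rightarrow> 'a bborel \<Rightarrow> 'a bborel" is "\<lambda>c f x. c * f x"
  using bounded_scaleR_comp[where 'b=real and S=UNIV] by auto

instance
  by standard (transfer; simp add: algebra_simps fun_eq_iff)+

end

instantiation bborel :: (topological_space) real_normed_vector
begin

lift_definition norm_bborel :: "'a bborel \<Rightarrow> real" is "\<lambda>f. SUP x. \<bar>f x\<bar>" .

definition dist_bborel :: "'a bborel \<Rightarrow> 'a bborel \<Rightarrow> real"
  where "dist_bborel f g = norm (f - g)"

definition sgn_bborel :: "'a bborel \<Rightarrow> 'a bborel"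
  where "sgn_bborel f = f /\<^sub>R norm f"

definition uniformity_bborel :: "('a bborel \<times> 'a bborel) filter"
  where "uniformity_bborel = (INF e\<in>{0 <..}. principal {(x, y). dist x y < e})"

definition open_bborel :: "'a bborel set \<Rightarrow> bool"
  where "open_bborel S = (\<forall>x\<in>S. \<forall>\<^sub>F (x', y) in uniformity. x' = x \<longrightarrow> y \<in> S)"

lemma abs_apply_bborel_le_norm: "\<bar>apply_bborel f x\<bar> \<le> norm f"
proof (transfer fixing: x)
  fix f :: "'a \<Rightarrow> real"
  assume "f \<in> borel_measurable borel \<and> bounded (range f)"
  then have "bounded (range (\<lambda>x. \<bar>f x\<bar>))"
    using bounded_norm_comp[of f UNIV] by simp
  then show "\<bar>f x\<bar> \<le> (SUP x. \<bar>f x\<bar>)"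
    by (intro cSUP_upper bounded_imp_bdd_above) auto
qed

lemma norm_bborel_le: "(\<And>x. \<bar>apply_bborel f x\<bar> \<le> b) \<Longrightarrow> norm f \<le> b"
  by transfer (auto intro!: cSUP_least)

instance
proof
  fix a :: real
  fix f g :: "'a bborel"
  show "dist f g = norm (f - g)" by (rule dist_bborel_def)
  show "sgn f = f /\<^sub>R norm f" by (rule sgn_bborel_def)
  show "uniformity = (INF e\<in>{0 <..}. principal {(x, y :: 'a bborel). dist x y < e})"
    by (rule uniformity_bborel_def)
  show "\<And>U :: 'a bborel set. open U = (\<forall>x\<in>U. \<forall>\<^sub>F (x', y) in uniformity. x' = x \<longrightarrow> y \<in> U)"
    by (rule open_bborel_def)
  show "norm f = 0 \<longleftrightarrow> f = 0"
  proof
    assume "norm f = 0"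
    then have "apply_bborel f x = 0" for x
      using abs_apply_bborel_le_norm[of f x] by simp
    then show "f = 0"
      by (simp add: apply_bborel_inject[symmetric] zero_bborel.rep_eq fun_eq_iff)
  qed (simp add: norm_bborel.rep_eq zero_bborel.rep_eq)
  show "norm (f + g) \<le> norm f + norm g"
    by (rule norm_bborel_le)
       (use abs_apply_bborel_le_norm[of f] abs_apply_bborel_le_norm[of g] in
         \<open>auto simp: plus_bborel.rep_eq intro: order_trans[OF abs_triangle_ineq] add_mono\<close>)
  have le: "norm (c *\<^sub>R h) \<le> \<bar>c\<bar> * norm h" for c and h :: "'a bborel"
    by (rule norm_bborel_le)
       (auto simp: scaleR_bborel.rep_eq abs_mult intro!: mult_left_mono abs_apply_bborel_le_norm)
  show "norm (a *\<^sub>R f) = \<bar>a\<bar> * norm f"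
  proof (cases "a = 0")
    case True
    then show ?thesis
      by (simp add: norm_bborel.rep_eq zero_bborel.rep_eq)
  next
    case False
    have "norm f \<le> \<bar>inverse a\<bar> * norm (a *\<^sub>R f)"
      using le[of "inverse a" "a *\<^sub>R f"] False by simp
    then have "\<bar>a\<bar> * norm f \<le> norm (a *\<^sub>R f)"
      using False by (simp add: field_simps)
    with le[of a f] show ?thesis by simp
  qed
qed

end

section \<open>Bochner integration without second countability\<close>

text \<open>The library's \<^const>\<open>has_bochner_integral\<close> requires a second countable target space, which
  \<^typ>\<open>'a bborel\<close> is not. As usual for non-separable spaces, Borel measurability of the integrand is
  replaced by strong measurability: it is an almost everywhere limit of simple functions.\<close>

definition has_Bochner_integral ::
    "'m measure \<Rightarrow> ('m \<Rightarrow> 'b::real_normed_vector) \<Rightarrow> 'b \<Rightarrow> bool" where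
  "has_Bochner_integral M f I \<longleftrightarrow>
    (\<exists>s. (\<forall>i. Bochner_Integration.simple_bochner_integrable M (s i)) \<and>
         (AE x in M. (\<lambda>i. s i x) \<longlonglongrightarrow> f x) \<and>
         (\<lambda>i. \<integral>\<^sup>+x. ennreal (norm (f x - s i x)) \<partial>M) \<longlonglongrightarrow> 0 \<and>
         (\<lambda>i. Bochner_Integration.simple_bochner_integral M (s i)) \<longlonglongrightarrow> I)"

lemma has_Bochner_integral_unique:
  assumes "has_Bochner_integral M f x" "has_Bochner_integral M f y"
  shows "x = y"
proof -
  let ?si = "Bochner_Integration.simple_bochner_integrable M"
  let ?I = "Bochner_Integration.simple_bochner_integral M"
  obtain s where s: "\<And>i. ?si (s i)" "AE x in M. (\<lambda>i. s i x) \<longlonglongrightarrow> f x"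
      "(\<lambda>i. \<integral>\<^sup>+x. ennreal (norm (f x - s i x)) \<partial>M) \<longlonglongrightarrow> 0" "(\<lambda>i. ?I (s i)) \<longlonglongrightarrow> x"
    using assms(1) unfolding has_Bochner_integral_def by blast
  obtain t where t: "\<And>i. ?si (t i)"
      "(\<lambda>i. \<integral>\<^sup>+x. ennreal (norm (f x - t i x)) \<partial>M) \<longlonglongrightarrow> 0" "(\<lambda>i. ?I (t i)) \<longlonglongrightarrow> y"
    using assms(2) unfolding has_Bochner_integral_def by blast
  have sf: "simple_function M h" if "?si h" for h :: "'a \<Rightarrow> 'b"
    using that by (auto elim: simple_bochner_integrable.cases)
  let ?m = "\<lambda>h x. lim (\<lambda>i. norm (s i x - h x))"
  have split: "(\<integral>\<^sup>+x. ennreal (norm (s i x - t i x)) \<partial>M) \<le>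
      (\<integral>\<^sup>+x. ennreal (norm (f x - s i x)) \<partial>M) + (\<integral>\<^sup>+x. ennreal (norm (f x - t i x)) \<partial>M)" for i
  proof -
    have meas: "(\<lambda>x. norm (s j x - h x)) \<in> borel_measurable M" if "?si h" for h j
      using simple_function_compose2[OF sf[OF s(1)] sf[OF that], of "\<lambda>a b. norm (a - b)" j]
      by (rule borel_measurable_simple_function)
    have m: "?m h \<in> borel_measurable M" if "?si h" for h
      using meas[OF that] by (intro borel_measurable_lim_metric) auto
    have ae: "AE x in M. norm (f x - h x) = ?m h x" for h
      using s(2) by eventually_elim (auto intro!: limI[symmetric] tendsto_intros)
    have "(\<integral>\<^sup>+x. ennreal (norm (s i x - t i x)) \<partial>M) \<le>
        (\<integral>\<^sup>+x. ennreal (?m (s i) x) + ennreal (?m (t i) x) \<partial>M)"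
      using ae[of "s i"] ae[of "t i"]
    proof (intro nn_integral_mono_AE, eventually_elim)
      case (elim x)
      have "norm (s i x - t i x) \<le> norm (f x - s i x) + norm (f x - t i x)"
        by (metis dual_order.refl norm_diff_triangle_le norm_minus_commute)
      then have "ennreal (norm (s i x - t i x)) \<le>
          ennreal (norm (f x - s i x)) + ennreal (norm (f x - t i x))"
        by (metis ennreal_leI ennreal_plus norm_ge_zero)
      with elim show ?case by simp
    qed
    also have "\<dots> = (\<integral>\<^sup>+x. ennreal (?m (s i) x) \<partial>M) + (\<integral>\<^sup>+x. ennreal (?m (t i) x) \<partial>M)"
      using m[OF s(1)] m[OF t(1)] by (intro nn_integral_add) auto
    also have "(\<integral>\<^sup>+x. ennreal (?m (s i) x) \<partial>M) = (\<integral>\<^sup>+x. ennreal (norm (f x - s i x)) \<partial>M)"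
      using ae[of "s i"] by (intro nn_integral_cong_AE) (auto elim: eventually_mono)
    also have "(\<integral>\<^sup>+x. ennreal (?m (t i) x) \<partial>M) = (\<integral>\<^sup>+x. ennreal (norm (f x - t i x)) \<partial>M)"
      using ae[of "t i"] by (intro nn_integral_cong_AE) (auto elim: eventually_mono)
    finally show ?thesis .
  qed
  have bound: "ennreal (norm (?I (s i) - ?I (t i))) \<le>
      (\<integral>\<^sup>+x. ennreal (norm (f x - s i x)) \<partial>M) + (\<integral>\<^sup>+x. ennreal (norm (f x - t i x)) \<partial>M)" for i
  proof -
    have d: "?si (\<lambda>x. s i x - t i x)"
      by (rule simple_bochner_integrable_compose2[OF _ s(1) t(1)]) simp
    have "ennreal (norm (?I (s i) - ?I (t i))) = norm (?I (\<lambda>x. s i x - t i x))"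
      using s(1) t(1) by (subst simple_bochner_integral_diff) auto
    also have "\<dots> \<le> Bochner_Integration.simple_bochner_integral M (\<lambda>x. norm (s i x - t i x))"
      using simple_bochner_integral_norm_bound[OF d] by (rule ennreal_leI)
    also have "\<dots> = (\<integral>\<^sup>+x. ennreal (norm (s i x - t i x)) \<partial>M)"
      using simple_bochner_integrable_compose2[of "\<lambda>x y. norm (x - y)" M "s i" "t i"] s(1) t(1)
      by (intro simple_bochner_integral_eq_nn_integral) auto
    finally show ?thesis using split[of i] by (rule order_trans)
  qed
  have "(\<lambda>i. ennreal (norm (?I (s i) - ?I (t i)))) \<longlonglongrightarrow> ennreal 0"
  proof (rule tendsto_sandwich)
    show "\<forall>\<^sub>F i in sequentially. 0 \<le> ennreal (norm (?I (s i) - ?I (t i)))"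
      "(\<lambda>_. 0) \<longlonglongrightarrow> ennreal 0"
      by auto
    show "\<forall>\<^sub>F i in sequentially. ennreal (norm (?I (s i) - ?I (t i))) \<le>
        (\<integral>\<^sup>+x. ennreal (norm (f x - s i x)) \<partial>M) + (\<integral>\<^sup>+x. ennreal (norm (f x - t i x)) \<partial>M)"
      by (intro always_eventually allI bound)
    show "(\<lambda>i. (\<integral>\<^sup>+x. ennreal (norm (f x - s i x)) \<partial>M) +
        (\<integral>\<^sup>+x. ennreal (norm (f x - t i x)) \<partial>M)) \<longlonglongrightarrow> ennreal 0"
      using tendsto_add[OF s(3) t(2)] by simp
  qed
  then have "(\<lambda>i. norm (?I (s i) - ?I (t i))) \<longlonglongrightarrow> 0"
    by (simp flip: ennreal_0)
  moreover have "(\<lambda>i. norm (?I (s i) - ?I (t i))) \<longlonglongrightarrow> norm (x - y)"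
    using s(4) t(3) by (intro tendsto_intros)
  ultimately have "norm (x - y) = 0"
    by (metis LIMSEQ_unique)
  then show ?thesis by simp
qed

definition Bochner_integral :: "'m measure \<Rightarrow> ('m \<Rightarrow> 'b::real_normed_vector) \<Rightarrow> 'b" where
  "Bochner_integral M f = (THE I. has_Bochner_integral M f I)"

definition set_Bochner_integral ::
    "'m measure \<Rightarrow> 'm set \<Rightarrow> ('m \<Rightarrow> 'b::real_normed_vector) \<Rightarrow> 'b" where
  "set_Bochner_integral M A f = Bochner_integral M (\<lambda>x. indicator A x *\<^sub>R f x)"

section \<open>Time simplices and the perturbation series\<close>

text \<open>A tuple \<open>(u\<^sub>1, \<dots>, u\<^sub>n)\<close> is a point of \<^term>\<open>PiM {1..n} (\<lambda>_. lborel)\<close>; \<open>with_ends n a b u\<close>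
  adds \<open>u\<^sub>0 = a\<close> and \<open>u\<^sub>n\<^sub>+\<^sub>1 = b\<close>.\<close>

definition with_ends :: "nat \<Rightarrow> 'c \<Rightarrow> 'c \<Rightarrow> (nat \<Rightarrow> 'c) \<Rightarrow> nat \<Rightarrow> 'c" where
  "with_ends n a b u = u(0 := a, Suc n := b)"

definition time_simplex :: "nat \<Rightarrow> real \<Rightarrow> (nat \<Rightarrow> real) set" where
  "time_simplex n t = {s. \<forall>k\<le>n. with_ends n 0 t s k < with_ends n 0 t s (Suc k)}"

text \<open>\<open>op_chain A \<sigma> m f = A (\<sigma>\<^sub>m - \<sigma>\<^sub>m\<^sub>-\<^sub>1) (\<dots> (A (\<sigma>\<^sub>1 - \<sigma>\<^sub>0) f))\<close>\<close>

primrec op_chain :: "(real \<Rightarrow> 'b \<Rightarrow> 'b) \<Rightarrow> (nat \<Rightarrow> real) \<Rightarrow> nat \<Rightarrow> 'b \<Rightarrow> 'b" where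
  "op_chain A \<sigma> 0 f = f"
| "op_chain A \<sigma> (Suc m) f = A (\<sigma> (Suc m) - \<sigma> m) (op_chain A \<sigma> m f)"

definition Q_iter ::
    "(real \<Rightarrow> 'b \<Rightarrow> 'b) \<Rightarrow> nat \<Rightarrow> real \<Rightarrow> 'b \<Rightarrow> 'b::real_normed_vector" where
  "Q_iter Q0 n t f =
     set_Bochner_integral (PiM {1..n} (\<lambda>_. lborel)) (time_simplex n t)
       (\<lambda>s. op_chain Q0 (with_ends n 0 t s) (Suc n) f)"

definition Q_op :: "(real \<Rightarrow> 'b \<Rightarrow> 'b) \<Rightarrow> real \<Rightarrow> 'b \<Rightarrow> 'b::real_normed_vector" where
  "Q_op Q0 t f = Q0 t f + (\<Sum>n. Q_iter Q0 (Suc n) t f)"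

definition P_op ::
    "(real \<Rightarrow> 'b \<Rightarrow> 'b) \<Rightarrow> (real \<Rightarrow> 'b \<Rightarrow> 'b) \<Rightarrow> real \<Rightarrow> 'b \<Rightarrow> 'b::real_normed_vector" where
  "P_op P0 Q0 t f =
     P0 t f + set_Bochner_integral lborel {0<..<t} (\<lambda>s. P0 (t - s) (Q_op Q0 s f))"

section \<open>The kernel \<open>q\<close>\<close>

definition S_iter ::
    "(real \<Rightarrow> 'a \<Rightarrow> 'a \<Rightarrow> real) \<Rightarrow> nat \<Rightarrow> (real \<times> 'a \<times> 'a::euclidean_space) set" where
  "S_iter q0 n = {(t, x, y). t \<in> {0<..1} \<and>
     (\<integral>\<^sup>+s\<in>time_simplex n t.
        (\<integral>\<^sup>+z. ennreal \<bar>\<Prod>k\<le>n. q0 (with_ends n 0 t s (Suc k) - with_ends n 0 t s k)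
                              (with_ends n y x z (Suc k)) (with_ends n y x z k)\<bar>
          \<partial>PiM {1..n} (\<lambda>_. lborel))
        \<partial>PiM {1..n} (\<lambda>_. lborel)) < \<infinity>}"

primrec q_iter ::
    "(real \<Rightarrow> 'a \<Rightarrow> 'a \<Rightarrow> real) \<Rightarrow> nat \<Rightarrow> real \<Rightarrow> 'a \<Rightarrow> 'a::euclidean_space \<Rightarrow> real" where
  "q_iter q0 0 t x y = q0 t x y"
| "q_iter q0 (Suc n) t x y =
     (LINT s:{0<..<t}|lborel. LINT z|lborel.
        indicator (S_iter q0 (Suc n)) (t, x, y) * q0 (t - s) x z * q_iter q0 n s z y)"

definition S_q ::
    "(real \<Rightarrow> 'a \<Rightarrow> 'a \<Rightarrow> real) \<Rightarrow> (real \<times> 'a \<times> 'a::euclidean_space) set" where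
  "S_q q0 = {(t, x, y). t \<in> {0<..1} \<and> summable (\<lambda>n. \<bar>q_iter q0 n t x y\<bar>)}"

definition q_kernel ::
    "(real \<Rightarrow> 'a \<Rightarrow> 'a \<Rightarrow> real) \<Rightarrow> real \<Rightarrow> 'a \<Rightarrow> 'a::euclidean_space \<Rightarrow> real" where
  "q_kernel q0 t x y = (\<Sum>n. indicator (S_q q0) (t, x, y) * q_iter q0 n t x y)"

section \<open>Sets of full measure\<close>

definition full_measure_in :: "'c::euclidean_space set \<Rightarrow> 'c set \<Rightarrow> bool" where
  "full_measure_in \<Omega> S \<longleftrightarrow> S \<in> sets borel \<and> S \<subseteq> \<Omega> \<and> emeasure lborel (\<Omega> - S) = 0"

end

theory Submission
  imports Defs
begin

text \<open>
  The proof separates a size estimate, which only sees absolute values, from the identification of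
  operators with kernels.

  \<^emph>\<open>Size.\<close> Applying the operators to \<open>f = sgn (k t x \<cdot>)\<close> turns their norm bounds into bounds on the
  kernels (\<open>nn_integral_abs_kernel_le\<close>): \<open>\<integral>|p0 t x y| dy \<le> C1\<close>, and, because \<open>r t \<le> sqrt t * r 1\<close>,
  \<open>\<integral>|q0 t x y| dy \<le> K t\<^bsup>b-1\<^esup>\<close> with \<open>b = \<epsilon>0/2 > 0\<close>. The convolution powers of \<open>K t\<^bsup>b-1\<^esup>\<close> are Beta
  integrals: the \<open>n\<close>-th one is \<open>c\<^sub>n t\<^bsup>(n+1)b-1\<^esup>\<close> with \<open>c\<^sub>n\<^sub>+\<^sub>1 = K B(b, (n+1)b) c\<^sub>n\<close>. Since
  \<open>B(b, (n+1)b) \<rightarrow> 0\<close>, the ratio test gives \<open>\<Sum> c\<^sub>n < \<infinity>\<close> (\<open>summable_conv_power_const\<close>). By Tonelli's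
  theorem \<open>\<integral> \<Sum>\<^sub>n |q\<^sub>n t x y| dy \<le> (\<Sum> c\<^sub>n) t\<^bsup>b-1\<^esup>\<close>. So for fixed \<open>t\<close> and \<open>x\<close> the sets on which the iterated
  integrals and the series defining \<open>q\<close> fail to converge absolutely are null sets in \<open>y\<close>. One more
  convolution, with \<open>|p0|\<close>, costs the integrable factor \<open>s\<^bsup>b-1\<^esup>\<close>; it produces the set \<open>Sp\<close>, the full
  measure of its sections and the uniform bound on \<open>\<integral>|p t x y| dy\<close>.

  \<^emph>\<open>Identification.\<close> Evaluation at a point \<open>x\<close> is a bounded linear functional on bounded Borel functions,
  and such functionals commute with Bochner integrals (\<open>bounded_linear_Bochner_integral\<close>). So
  \<open>Q\<^sup>n\<^sub>t f x\<close> and \<open>P\<^sub>t f x\<close> are ordinary Lebesgue integrals, to which Fubini's theorem applies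
  (\<open>convolution_kernel\<close>). Existence of the Bochner integrals is the delicate point: the space is
  complete but not separable, so Borel measurability of the integrand does not suffice. Strong
  measurability comes from the joint continuity of \<open>(u, g) \<mapsto> Q0 u g\<close> on \<open>{0<..1} \<times> UNIV\<close>, which lets
  times and functions be replaced simultaneously by simple approximations
  (\<open>strongly_measurable_parametrized\<close>). For the iteration one also needs that \<open>t \<mapsto> Q\<^sup>n\<^sub>t f\<close> and
  \<open>t \<mapsto> Q\<^sub>t f\<close> are continuous in norm. Here \<open>Q\<^sup>n\<^sup>+\<^sup>1\<^sub>t f = \<integral> Q0 (t - s) (Q\<^sup>n\<^sub>s f) ds\<close> over \<open>0 < s < t\<close>, obtained
  by splitting the last point off the time simplex, is rescaled to the fixed interval \<open>0 < u < 1\<close>;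
  then dominated convergence applies (\<open>continuous_on_convolution\<close>).
\<close>

section \<open>Bounded Borel functions as a Banach space\<close>

lemma bounded_linear_apply_bborel: "bounded_linear (\<lambda>f. apply_bborel f x)"
  by (rule bounded_linear_intro[where K = 1])
     (auto simp: plus_bborel.rep_eq scaleR_bborel.rep_eq abs_apply_bborel_le_norm)

lemma apply_bborel_measurable [measurable]: "apply_bborel f \<in> borel_measurable borel"
  using apply_bborel[of f] by simp

text \<open>
  A Cauchy sequence converges uniformly, and a uniform limit of bounded Borel functions is again
  bounded and Borel.
\<close>
lemma Cauchy_bborel_convergent:
  fixes X :: "nat \<Rightarrow> 'a::topological_space bborel"
  assumes X: "Cauchy X"
  shows "convergent X"
proof -
  have close: "\<exists>M. \<forall>m\<ge>M. \<forall>n\<ge>M. \<forall>x. \<bar>apply_bborel (X m) x - apply_bborel (X n) x\<bar> < e"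
    if e: "e > 0" for e
  proof -
    obtain M where M: "\<And>m n. m \<ge> M \<Longrightarrow> n \<ge> M \<Longrightarrow> norm (X m - X n) < e"
      using CauchyD[OF X e] by blast
    have "\<bar>apply_bborel (X m) x - apply_bborel (X n) x\<bar> < e" if "m \<ge> M" "n \<ge> M" for m n x
      using abs_apply_bborel_le_norm[of "X m - X n" x] M[OF that]
      by (simp add: minus_bborel.rep_eq)
    then show ?thesis by blast
  qed
  have "Cauchy (\<lambda>n. apply_bborel (X n) x)" for x
    by (rule bounded_linear.Cauchy[OF bounded_linear_apply_bborel X])
  then have "convergent (\<lambda>n. apply_bborel (X n) x)" for x
    by (rule real_Cauchy_convergent)
  then obtain F where F: "\<And>x. (\<lambda>n. apply_bborel (X n) x) \<longlonglongrightarrow> F x"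
    unfolding convergent_def by metis
  have unif: "\<exists>M. \<forall>m\<ge>M. \<forall>x. \<bar>apply_bborel (X m) x - F x\<bar> \<le> e" if e: "e > 0" for e
  proof -
    obtain M where M: "\<And>m n x. m \<ge> M \<Longrightarrow> n \<ge> M \<Longrightarrow>
        \<bar>apply_bborel (X m) x - apply_bborel (X n) x\<bar> < e"
      using close[OF e] by blast
    have "\<bar>apply_bborel (X m) x - F x\<bar> \<le> e" if "m \<ge> M" for m x
    proof (rule LIMSEQ_le_const2)
      show "(\<lambda>n. \<bar>apply_bborel (X m) x - apply_bborel (X n) x\<bar>) \<longlonglongrightarrow> \<bar>apply_bborel (X m) x - F x\<bar>"
        by (intro tendsto_intros F)
      show "\<exists>N. \<forall>n\<ge>N. \<bar>apply_bborel (X m) x - apply_bborel (X n) x\<bar> \<le> e"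
        using M[OF that] less_imp_le by blast
    qed
    then show ?thesis by blast
  qed
  have "F \<in> borel_measurable borel"
    by (rule borel_measurable_LIMSEQ_real[OF F]) auto
  moreover have "bounded (range F)"
  proof -
    obtain M where M: "\<And>x. \<bar>apply_bborel (X M) x - F x\<bar> \<le> 1"
      using unif[of 1] by force
    have "\<bar>F x\<bar> \<le> norm (X M) + 1" for x
      using abs_apply_bborel_le_norm[of "X M" x] M[of x] by linarith
    then show ?thesis
      by (intro boundedI[where B = "norm (X M) + 1"]) auto
  qed
  ultimately have ap: "apply_bborel (Bborel F) = F"
    by (simp add: Bborel_inverse)
  have "X \<longlonglongrightarrow> Bborel F"
  proof (rule LIMSEQ_I)
    fix e :: real assume "0 < e"
    then obtain M where M: "\<And>m x. m \<ge> M \<Longrightarrow> \<bar>apply_bborel (X m) x - F x\<bar> \<le> e / 2"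
      using unif[of "e / 2"] by auto
    have "norm (X m - Bborel F) < e" if "m \<ge> M" for m
    proof -
      have "norm (X m - Bborel F) \<le> e / 2"
        using M[OF that] by (intro norm_bborel_le) (simp add: minus_bborel.rep_eq ap)
      then show ?thesis
        using \<open>0 < e\<close> by linarith
    qed
    then show "\<exists>no. \<forall>n\<ge>no. norm (X n - Bborel F) < e"
      by blast
  qed
  then show "convergent X"
    unfolding convergent_def by blast
qed

instance bborel :: (topological_space) banach
  by standard (rule Cauchy_bborel_convergent)

section \<open>Strong measurability and existence of Bochner integrals\<close>

text \<open>
  Convergence is required at every point, not just almost everywhere. The measures used here are not
  complete, and with everywhere convergence \<open>L \<circ> F\<close> stays Borel measurable for continuous \<open>L\<close>.
\<close>
definition strongly_measurable :: "'m measure \<Rightarrow> ('m \<Rightarrow> 'b::real_normed_vector) \<Rightarrow> bool" where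
  "strongly_measurable M F \<longleftrightarrow>
    (\<exists>s. (\<forall>i. simple_function M (s i)) \<and> (\<forall>x\<in>space M. (\<lambda>i. s i x) \<longlonglongrightarrow> F x))"

lemma strongly_measurable_const: "strongly_measurable M (\<lambda>_. c)"
  unfolding strongly_measurable_def by (intro exI[of _ "\<lambda>_ _. c"]) auto

lemma strongly_measurable_cong:
  "(\<And>x. x \<in> space M \<Longrightarrow> F x = G x) \<Longrightarrow> strongly_measurable M F \<longleftrightarrow> strongly_measurable M G"
  unfolding strongly_measurable_def by simp

lemma strongly_measurable_diff:
  "strongly_measurable M F \<Longrightarrow> strongly_measurable M G \<Longrightarrow> strongly_measurable M (\<lambda>x. F x - G x)"
  unfolding strongly_measurable_def
proof (elim exE conjE)
  fix s s'
  assume s: "\<forall>i. simple_function M (s i)" "\<forall>x\<in>space M. (\<lambda>i. s i x) \<longlonglongrightarrow> F x"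
    and s': "\<forall>i. simple_function M (s' i)" "\<forall>x\<in>space M. (\<lambda>i. s' i x) \<longlonglongrightarrow> G x"
  have "simple_function M (\<lambda>x. s i x - s' i x)" for i
    using s(1) s'(1) by (intro simple_function_compose2[where h = "\<lambda>a b. a - b"]) auto
  then show "\<exists>s. (\<forall>i. simple_function M (s i)) \<and> (\<forall>x\<in>space M. (\<lambda>i. s i x) \<longlonglongrightarrow> F x - G x)"
    using s(2) s'(2) by (intro exI[of _ "\<lambda>i x. s i x - s' i x"]) (auto intro: tendsto_diff)
qed

lemma strongly_measurable_compose_continuous:
  fixes L :: "'b::real_normed_vector \<Rightarrow> 'c::metric_space"
  assumes "strongly_measurable M F" "continuous_on UNIV L"
  shows "(\<lambda>x. L (F x)) \<in> borel_measurable M"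
proof -
  obtain s where s: "\<And>i. simple_function M (s i)" "\<And>x. x \<in> space M \<Longrightarrow> (\<lambda>i. s i x) \<longlonglongrightarrow> F x"
    using assms(1) unfolding strongly_measurable_def by blast
  show ?thesis
  proof (rule borel_measurable_LIMSEQ_metric)
    show "(\<lambda>x. L (s i x)) \<in> borel_measurable M" for i
      by (rule borel_measurable_simple_function[OF simple_function_compose1[OF s(1)]])
    show "(\<lambda>i. L (s i x)) \<longlonglongrightarrow> L (F x)" if "x \<in> space M" for x
      by (rule continuous_on_tendsto_compose[OF assms(2) s(2)[OF that]]) auto
  qed
qed

lemma strongly_measurable_norm:
  "strongly_measurable M F \<Longrightarrow> (\<lambda>x. norm (F x)) \<in> borel_measurable M"
  by (rule strongly_measurable_compose_continuous) (auto intro: continuous_intros)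

text \<open>
  Truncation makes the approximating simple functions dominated by the limit, which is what dominated
  convergence needs. The approximation \<open>s i x\<close> is discarded where its norm exceeds \<open>2 * norm (F x)\<close>;
  the factor 2 ensures that at points with \<open>F x \<noteq> 0\<close> this happens only finitely often.
\<close>
lemma strongly_measurable_imp_dominated_simple:
  assumes "strongly_measurable M F"
  obtains s where "\<And>i. simple_function M (s i)" "\<And>x. x \<in> space M \<Longrightarrow> (\<lambda>i. s i x) \<longlonglongrightarrow> F x"
    "\<And>i x. x \<in> space M \<Longrightarrow> norm (s i x) \<le> 2 * norm (F x)"
proof -
  obtain s where s: "\<And>i. simple_function M (s i)" "\<And>x. x \<in> space M \<Longrightarrow> (\<lambda>i. s i x) \<longlonglongrightarrow> F x"
    using assms unfolding strongly_measurable_def by blast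
  define s' where "s' = (\<lambda>i x. if norm (s i x) \<le> 2 * norm (F x) then s i x else 0)"
  have [measurable]: "(\<lambda>x. norm (F x)) \<in> borel_measurable M"
    by (rule strongly_measurable_norm[OF assms])
  have [measurable]: "(\<lambda>x. norm (s i x)) \<in> borel_measurable M" for i
    by (rule borel_measurable_simple_function[OF simple_function_compose1[OF s(1)]])
  show thesis
  proof
    show "simple_function M (s' i)" for i
      unfolding s'_def by (intro simple_function_If s(1) simple_function_const) measurable
    show "norm (s' i x) \<le> 2 * norm (F x)" for i x
      by (simp add: s'_def)
    fix x assume x: "x \<in> space M"
    have n: "(\<lambda>i. norm (s i x)) \<longlonglongrightarrow> norm (F x)"
      by (intro tendsto_intros s(2) x)
    show "(\<lambda>i. s' i x) \<longlonglongrightarrow> F x"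
    proof (cases "F x = 0")
      case True
      then have "s' i x = 0" for i
        by (auto simp: s'_def)
      then show ?thesis
        using True by simp
    next
      case False
      then have "\<forall>\<^sub>F i in sequentially. norm (s i x) < 2 * norm (F x)"
        by (intro order_tendstoD(2)[OF n]) simp
      then have "\<forall>\<^sub>F i in sequentially. s' i x = s i x"
        by eventually_elim (simp add: s'_def)
      then show ?thesis
        using s(2)[OF x] by (simp add: tendsto_cong)
    qed
  qed
qed

lemma Bochner_integral_eqI: "has_Bochner_integral M F I \<Longrightarrow> Bochner_integral M F = I"
  unfolding Bochner_integral_def by (rule the_equality) (auto intro: has_Bochner_integral_unique)

text \<open>
  The integrals of dominated simple approximations form a Cauchy sequence, so by completeness they
  converge to the Bochner integral. Both sides of the last equation are limits of the same sequence:
  \<open>L\<close> commutes with the integral of simple functions, and dominated convergence handles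
  the right-hand side.
\<close>
lemma
  fixes F :: "'m \<Rightarrow> 'b::banach"
  assumes F: "strongly_measurable M F" and fin: "(\<integral>\<^sup>+x. ennreal (norm (F x)) \<partial>M) < \<infinity>"
  shows integrable_bounded_linear_strongly_measurable:
      "\<And>L. bounded_linear (L :: 'b \<Rightarrow> real) \<Longrightarrow> integrable M (\<lambda>x. L (F x))"
    and bounded_linear_Bochner_integral:
      "\<And>L. bounded_linear (L :: 'b \<Rightarrow> real) \<Longrightarrow>
        L (Bochner_integral M F) = (LINT x|M. L (F x))"
proof -
  let ?I = "Bochner_Integration.simple_bochner_integral M"
  let ?si = "Bochner_Integration.simple_bochner_integrable M"
  obtain s where s: "\<And>i. simple_function M (s i)" "\<And>x. x \<in> space M \<Longrightarrow> (\<lambda>i. s i x) \<longlonglongrightarrow> F x"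
    "\<And>i x. x \<in> space M \<Longrightarrow> norm (s i x) \<le> 2 * norm (F x)"
    using strongly_measurable_imp_dominated_simple[OF F] by metis
  have nF [measurable]: "(\<lambda>x. norm (F x)) \<in> borel_measurable M"
    by (rule strongly_measurable_norm[OF F])
  have ns: "(\<lambda>x. norm (s i x)) \<in> borel_measurable M" for i
    by (rule borel_measurable_simple_function[OF simple_function_compose1[OF s(1)]])
  have fin2: "(\<integral>\<^sup>+x. ennreal (2 * norm (F x)) \<partial>M) < \<infinity>"
    using fin by (simp add: ennreal_mult nn_integral_cmult ennreal_mult_less_top)
  have si: "?si (s i)" for i
  proof (rule simple_bochner_integrableI_bounded[OF s(1)])
    have "(\<integral>\<^sup>+x. ennreal (norm (s i x)) \<partial>M) \<le> (\<integral>\<^sup>+x. ennreal (2 * norm (F x)) \<partial>M)"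
      by (intro nn_integral_mono ennreal_leI s(3))
    then show "(\<integral>\<^sup>+x. ennreal (norm (s i x)) \<partial>M) < \<infinity>"
      using fin2 by (rule order_le_less_trans)
  qed
  have sm: "strongly_measurable M (\<lambda>x. F x - s i x)" for i
    unfolding strongly_measurable_def
    using s(1,2) by (intro exI[of _ "\<lambda>j x. s j x - s i x"]) (auto intro!: tendsto_intros)
  have nFs [measurable]: "(\<lambda>x. norm (F x - s i x)) \<in> borel_measurable M" for i
    by (rule strongly_measurable_norm[OF sm])
  have L1: "(\<lambda>i. \<integral>\<^sup>+x. ennreal (norm (F x - s i x)) \<partial>M) \<longlonglongrightarrow> 0"
  proof -
    have "(\<lambda>i. \<integral>\<^sup>+x. ennreal (norm (F x - s i x)) \<partial>M) \<longlonglongrightarrow> (\<integral>\<^sup>+x. 0 \<partial>M)"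
    proof (rule nn_integral_dominated_convergence[where w = "\<lambda>x. ennreal (3 * norm (F x))"])
      show "AE x in M. ennreal (norm (F x - s j x)) \<le> ennreal (3 * norm (F x))" for j
      proof (intro AE_I2 ennreal_leI)
        fix x assume "x \<in> space M"
        then show "norm (F x - s j x) \<le> 3 * norm (F x)"
          using s(3)[of x j] norm_triangle_ineq4[of "F x" "s j x"] by simp
      qed
      show "(\<integral>\<^sup>+x. ennreal (3 * norm (F x)) \<partial>M) < \<infinity>"
        using fin by (simp add: ennreal_mult nn_integral_cmult ennreal_mult_less_top)
      show "AE x in M. (\<lambda>i. ennreal (norm (F x - s i x))) \<longlonglongrightarrow> 0"
      proof (rule AE_I2)
        fix x assume "x \<in> space M"
        then have "(\<lambda>i. norm (F x - s i x)) \<longlonglongrightarrow> norm (F x - F x)"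
          by (intro tendsto_intros s(2))
        then show "(\<lambda>i. ennreal (norm (F x - s i x))) \<longlonglongrightarrow> 0"
          using tendsto_ennrealI by fastforce
      qed
    qed auto
    then show ?thesis by simp
  qed
  have diff: "ennreal (norm (?I (s i) - ?I (s j))) \<le>
      (\<integral>\<^sup>+x. ennreal (norm (F x - s i x)) \<partial>M) + (\<integral>\<^sup>+x. ennreal (norm (F x - s j x)) \<partial>M)" for i j
  proof -
    have d: "?si (\<lambda>x. s i x - s j x)"
      by (rule simple_bochner_integrable_compose2[OF _ si si]) simp
    have "ennreal (norm (?I (s i) - ?I (s j))) = norm (?I (\<lambda>x. s i x - s j x))"
      using si by (subst simple_bochner_integral_diff) auto
    also have "\<dots> \<le> ?I (\<lambda>x. norm (s i x - s j x))"
      using simple_bochner_integral_norm_bound[OF d] by (rule ennreal_leI)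
    also have "\<dots> = (\<integral>\<^sup>+x. ennreal (norm (s i x - s j x)) \<partial>M)"
      using simple_bochner_integrable_compose2[of "\<lambda>x y. norm (x - y)" M "s i" "s j"] si
      by (intro simple_bochner_integral_eq_nn_integral) auto
    also have "\<dots> \<le> (\<integral>\<^sup>+x. ennreal (norm (F x - s i x)) + ennreal (norm (F x - s j x)) \<partial>M)"
    proof (rule nn_integral_mono)
      fix x
      have "norm (s i x - s j x) \<le> norm (F x - s i x) + norm (F x - s j x)"
        by (metis dual_order.refl norm_diff_triangle_le norm_minus_commute)
      then show "ennreal (norm (s i x - s j x)) \<le>
          ennreal (norm (F x - s i x)) + ennreal (norm (F x - s j x))"
        by (metis ennreal_leI ennreal_plus norm_ge_zero)
    qed
    also have "\<dots> = (\<integral>\<^sup>+x. ennreal (norm (F x - s i x)) \<partial>M) + (\<integral>\<^sup>+x. ennreal (norm (F x - s j x)) \<partial>M)"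
      by (intro nn_integral_add) auto
    finally show ?thesis .
  qed
  have "Cauchy (\<lambda>i. ?I (s i))"
  proof (rule CauchyI)
    fix e :: real assume e: "0 < e"
    then have "\<forall>\<^sub>F i in sequentially. (\<integral>\<^sup>+x. ennreal (norm (F x - s i x)) \<partial>M) < ennreal (e / 2)"
      by (intro order_tendstoD(2)[OF L1]) simp
    then obtain N where N: "\<And>i. i \<ge> N \<Longrightarrow> (\<integral>\<^sup>+x. ennreal (norm (F x - s i x)) \<partial>M) < ennreal (e / 2)"
      unfolding eventually_sequentially by blast
    have "norm (?I (s i) - ?I (s j)) < e" if "i \<ge> N" "j \<ge> N" for i j
    proof -
      have "ennreal (norm (?I (s i) - ?I (s j))) < ennreal (e / 2) + ennreal (e / 2)"
        using diff[of i j] add_strict_mono[OF N[OF that(1)] N[OF that(2)]] by (rule order_le_less_trans)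
      also have "\<dots> = ennreal e"
        using e by (simp flip: ennreal_plus)
      finally show ?thesis
        using e by (simp add: ennreal_less_iff)
    qed
    then show "\<exists>N. \<forall>m\<ge>N. \<forall>n\<ge>N. norm (?I (s m) - ?I (s n)) < e" by blast
  qed
  then obtain I where I: "(\<lambda>i. ?I (s i)) \<longlonglongrightarrow> I"
    using Cauchy_convergent convergent_def by blast
  have hB: "has_Bochner_integral M F I"
    unfolding has_Bochner_integral_def using s si L1 I by (intro exI[of _ s]) auto
  then have Ieq: "Bochner_integral M F = I"
    by (rule Bochner_integral_eqI)
  fix L :: "'b \<Rightarrow> real" assume L: "bounded_linear L"
  interpret L: bounded_linear L by fact
  obtain K where K: "0 < K" "\<And>x. norm (L x) \<le> norm x * K"
    using L.pos_bounded by blast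
  have mL: "(\<lambda>x. L (F x)) \<in> borel_measurable M"
    by (rule strongly_measurable_compose_continuous[OF F]) (simp add: L.continuous_on)
  have msL: "(\<lambda>x. L (s i x)) \<in> borel_measurable M" for i
    by (rule borel_measurable_simple_function[OF simple_function_compose1[OF s(1)]])
  have dom: "integrable M (\<lambda>x. 2 * norm (F x) * K)"
    using fin K by (intro integrable_mult_left integrable_mult_right integrableI_bounded) auto
  have lim: "AE x in M. (\<lambda>i. L (s i x)) \<longlonglongrightarrow> L (F x)"
    using s(2) L.tendsto by (intro AE_I2) blast
  have bd: "AE x in M. norm (L (s i x)) \<le> 2 * norm (F x) * K" for i
  proof (rule AE_I2)
    fix x assume "x \<in> space M"
    then have "norm (s i x) * K \<le> 2 * norm (F x) * K"
      using s(3) K(1) by (intro mult_right_mono) auto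
    then show "norm (L (s i x)) \<le> 2 * norm (F x) * K"
      using K(2)[of "s i x"] by simp
  qed
  show "integrable M (\<lambda>x. L (F x))"
    by (rule integrable_dominated_convergence[OF mL msL dom lim bd])
  have "(\<lambda>i. LINT x|M. L (s i x)) \<longlonglongrightarrow> (LINT x|M. L (F x))"
    by (rule integral_dominated_convergence[OF mL msL dom lim bd])
  moreover have "(LINT x|M. L (s i x)) = L (?I (s i))" for i
  proof -
    have "?si (\<lambda>x. L (s i x))"
      using simple_bochner_integrable_compose2[of "\<lambda>a _. L a", OF _ si si] by (simp add: L.zero)
    then have "(LINT x|M. L (s i x)) = ?I (\<lambda>x. L (s i x))"
      by (simp add: simple_bochner_integrable_eq_integral)
    also have "\<dots> = L (?I (s i))"
      by (rule simple_bochner_integral_linear[OF L.linear_axioms si])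
    finally show ?thesis .
  qed
  ultimately have "(\<lambda>i. L (?I (s i))) \<longlonglongrightarrow> (LINT x|M. L (F x))"
    by simp
  moreover have "(\<lambda>i. L (?I (s i))) \<longlonglongrightarrow> L I"
    by (rule L.tendsto[OF I])
  ultimately show "L (Bochner_integral M F) = (LINT x|M. L (F x))"
    unfolding Ieq by (rule LIMSEQ_unique[symmetric])
qed

text \<open>
  The source of all strong measurability below. If \<open>\<phi>\<^sub>i (u x) \<rightarrow> u x\<close> and \<open>s\<^sub>i x \<rightarrow> g x\<close> with simple
  functions on the left, then \<open>T (\<phi>\<^sub>i (u x)) (s\<^sub>i x)\<close> is simple and joint continuity of \<open>T\<close> gives its
  limit.
\<close>
lemma strongly_measurable_parametrized:
  fixes T :: "real \<Rightarrow> 'a::real_normed_vector \<Rightarrow> 'b::real_normed_vector"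
  assumes T: "continuous_on ({0<..1} \<times> UNIV) (\<lambda>(u, g). T u g)"
    and g: "strongly_measurable M g"
    and u [measurable]: "u \<in> borel_measurable M" and A [measurable]: "A \<in> sets M"
    and uA: "\<And>x. x \<in> A \<Longrightarrow> u x \<in> {0<..1}"
  shows "strongly_measurable M (\<lambda>x. indicator A x *\<^sub>R T (u x) (g x))"
proof -
  obtain s where s: "\<And>i. simple_function M (s i)" "\<And>x. x \<in> space M \<Longrightarrow> (\<lambda>i. s i x) \<longlonglongrightarrow> g x"
    using g unfolding strongly_measurable_def by blast
  \<comment> \<open>Rounding up, not down, keeps the approximations of a time in \<open>{0<..1}\<close> away from 0.\<close>
  define \<phi> where "\<phi> = (\<lambda>i v. min 1 (\<lceil>real (Suc i) * v\<rceil> / real (Suc i)))"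
  have \<phi>_pos: "\<phi> i v \<in> {0<..1}" if "v \<in> {0<..1}" for i v
  proof -
    have "0 < real (Suc i) * v"
      using that by simp
    then have "0 < \<lceil>real (Suc i) * v\<rceil>"
      by (simp only: zero_less_ceiling)
    then show ?thesis
      by (simp add: \<phi>_def)
  qed
  have \<phi>_lim: "(\<lambda>i. \<phi> i v) \<longlonglongrightarrow> v" if "v \<in> {0<..1}" for v
  proof (rule tendsto_sandwich)
    have l: "v \<le> \<lceil>real (Suc i) * v\<rceil> / real (Suc i)" for i
      by (simp add: pos_le_divide_eq mult.commute del: of_nat_Suc)
    show "\<forall>\<^sub>F i in sequentially. v \<le> \<phi> i v"
      using l that by (intro always_eventually) (auto simp: \<phi>_def)
    have "\<lceil>real (Suc i) * v\<rceil> / real (Suc i) \<le> v + 1 / real (Suc i)" for i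
    proof -
      have "\<lceil>real (Suc i) * v\<rceil> \<le> real (Suc i) * v + 1" by linarith
      then have "\<lceil>real (Suc i) * v\<rceil> / real (Suc i) \<le> (real (Suc i) * v + 1) / real (Suc i)"
        by (intro divide_right_mono) auto
      then show ?thesis
        by (simp add: add_divide_distrib del: of_nat_Suc)
    qed
    then show "\<forall>\<^sub>F i in sequentially. \<phi> i v \<le> v + 1 / real (Suc i)"
      by (intro always_eventually allI) (auto simp: \<phi>_def intro: min.coboundedI2)
    show "(\<lambda>i. v + 1 / real (Suc i)) \<longlonglongrightarrow> v"
      using tendsto_add[OF tendsto_const LIMSEQ_inverse_real_of_nat, of v] by (simp add: inverse_eq_divide)
  qed auto
  define w where "w = (\<lambda>i x. if x \<in> A then \<phi> i (u x) else 1)"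
  have w: "simple_function M (w i)" for i
  proof (rule simple_function_borel_measurable)
    show "w i \<in> borel_measurable M"
      unfolding w_def \<phi>_def by measurable
    have "w i x \<in> (\<lambda>k. min 1 (real_of_int k / real (Suc i))) ` {0..int (Suc i)}" for x
    proof (cases "x \<in> A")
      case True
      have "0 \<le> \<lceil>real (Suc i) * u x\<rceil>"
        using uA[OF True] ceiling_mono[of 0 "real (Suc i) * u x"] by simp
      moreover have "real (Suc i) * u x \<le> real (Suc i) * 1"
        using uA[OF True] by (intro mult_left_mono) auto
      then have "\<lceil>real (Suc i) * u x\<rceil> \<le> int (Suc i)"
        by (simp add: ceiling_le_iff)
      ultimately show ?thesis
        using True unfolding w_def \<phi>_def by (intro image_eqI[of _ _ "\<lceil>real (Suc i) * u x\<rceil>"]) auto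
    next
      case False
      then show ?thesis
        by (intro image_eqI[of _ _ "int (Suc i)"]) (auto simp: w_def)
    qed
    then show "finite (w i ` space M)"
      by (intro finite_subset[of "w i ` space M"
            "(\<lambda>k. min 1 (real_of_int k / real (Suc i))) ` {0..int (Suc i)}"]) auto
  qed
  show ?thesis
    unfolding strongly_measurable_def
  proof (intro exI[of _ "\<lambda>i x. if x \<in> A then T (w i x) (s i x) else 0"] conjI ballI allI)
    show "simple_function M (\<lambda>x. if x \<in> A then T (w i x) (s i x) else 0)" for i
      by (rule simple_function_If_set[OF simple_function_compose2[OF w s(1)]]) (use A in auto)
    fix x assume x: "x \<in> space M"
    show "(\<lambda>i. if x \<in> A then T (w i x) (s i x) else 0) \<longlonglongrightarrow> indicator A x *\<^sub>R T (u x) (g x)"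
    proof (cases "x \<in> A")
      case True
      have "(\<lambda>i. (w i x, s i x)) \<longlonglongrightarrow> (u x, g x)"
        using True \<phi>_lim[OF uA[OF True]] s(2)[OF x] by (auto simp: w_def intro!: tendsto_Pair)
      then have "(\<lambda>i. (\<lambda>(u, g). T u g) (w i x, s i x)) \<longlonglongrightarrow> (\<lambda>(u, g). T u g) (u x, g x)"
        using True uA \<phi>_pos
        by (intro continuous_on_tendsto_compose[OF T]) (auto simp: w_def simp del: greaterThanAtMost_iff)
      then show ?thesis using True by simp
    qed simp
  qed
qed

section \<open>Bochner integrals of bounded Borel functions\<close>

text \<open>
  If \<open>f\<close> is not integrable, the left-hand side is 0 by convention.
\<close>
lemma abs_integral_le_nn_integral: "ennreal \<bar>LINT x|M. f x\<bar> \<le> (\<integral>\<^sup>+x. ennreal \<bar>f x\<bar> \<partial>M)"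
proof (cases "integrable M f")
  case True
  then show ?thesis using integral_norm_bound_ennreal[of M f] by simp
qed (simp add: not_integrable_integral_eq)

text \<open>
  Because the norm is the supremum of the point evaluations, the triangle inequality for the Bochner
  integral follows from the one for real integrals.
\<close>
lemma norm_Bochner_integral_diff_le:
  fixes F G :: "'m \<Rightarrow> 'a::topological_space bborel"
  assumes F: "strongly_measurable M F" "(\<integral>\<^sup>+x. ennreal (norm (F x)) \<partial>M) < \<infinity>"
    and G: "strongly_measurable M G" "(\<integral>\<^sup>+x. ennreal (norm (G x)) \<partial>M) < \<infinity>"
  shows "ennreal (norm (Bochner_integral M F - Bochner_integral M G)) \<le>
    (\<integral>\<^sup>+x. ennreal (norm (F x - G x)) \<partial>M)"
    (is "_ \<le> ?N")
proof (cases ?N)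
  case (real c)
  have "\<bar>apply_bborel (Bochner_integral M F - Bochner_integral M G) y\<bar> \<le> c" for y
  proof -
    note L = bounded_linear_apply_bborel[of y]
    have "apply_bborel (Bochner_integral M F - Bochner_integral M G) y =
        (LINT x|M. apply_bborel (F x) y) - (LINT x|M. apply_bborel (G x) y)"
      by (simp add: minus_bborel.rep_eq bounded_linear_Bochner_integral[OF F L]
          bounded_linear_Bochner_integral[OF G L])
    also have "\<dots> = (LINT x|M. apply_bborel (F x - G x) y)"
      using integrable_bounded_linear_strongly_measurable[OF F L]
        integrable_bounded_linear_strongly_measurable[OF G L]
      by (simp add: minus_bborel.rep_eq)
    also have "ennreal \<bar>\<dots>\<bar> \<le> (\<integral>\<^sup>+x. ennreal \<bar>apply_bborel (F x - G x) y\<bar> \<partial>M)"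
      by (rule abs_integral_le_nn_integral)
    also have "\<dots> \<le> ?N"
      by (intro nn_integral_mono ennreal_leI abs_apply_bborel_le_norm)
    finally show ?thesis
      using real by simp
  qed
  then show ?thesis
    unfolding real(2) by (intro ennreal_leI norm_bborel_le)
qed simp

lemma Bochner_integral_zero: "Bochner_integral M (\<lambda>_. 0 :: 'a::topological_space bborel) = 0"
proof -
  have "has_Bochner_integral M (\<lambda>_. 0) (0 :: 'a bborel)"
    unfolding has_Bochner_integral_def
    by (intro exI[of _ "\<lambda>_ _. 0"])
       (auto simp: Bochner_Integration.simple_bochner_integrable.simps
          Bochner_Integration.simple_bochner_integral_def image_constant_conv)
  then show ?thesis
    by (rule Bochner_integral_eqI)
qed

lemma norm_Bochner_integral_le:
  fixes F :: "'m \<Rightarrow> 'a::topological_space bborel"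
  assumes "strongly_measurable M F" "(\<integral>\<^sup>+x. ennreal (norm (F x)) \<partial>M) \<le> ennreal C" "0 \<le> C"
  shows "norm (Bochner_integral M F) \<le> C"
proof -
  have "(\<integral>\<^sup>+x. ennreal (norm (F x)) \<partial>M) < \<infinity>"
    using assms(2) by (auto simp: order_le_less_trans)
  then have "ennreal (norm (Bochner_integral M F)) \<le> (\<integral>\<^sup>+x. ennreal (norm (F x)) \<partial>M)"
    using norm_Bochner_integral_diff_le[OF assms(1) _ strongly_measurable_const[of M 0]]
    by (simp add: Bochner_integral_zero)
  then show ?thesis
    using assms(2,3) by (meson ennreal_le_iff order_trans)
qed

lemma Bochner_integral_dominated_convergence:
  fixes F :: "'m \<Rightarrow> 'a::topological_space bborel"
  assumes F: "strongly_measurable M F" and G: "\<And>n::nat. strongly_measurable M (G n)"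
    and w: "integrable M w"
    and le: "\<And>n x. x \<in> space M \<Longrightarrow> norm (G n x) \<le> w x"
    and lim: "\<And>x. x \<in> space M \<Longrightarrow> (\<lambda>n. G n x) \<longlonglongrightarrow> F x"
  shows "(\<lambda>n. Bochner_integral M (G n)) \<longlonglongrightarrow> Bochner_integral M F"
proof -
  have leF: "norm (F x) \<le> w x" if "x \<in> space M" for x
    by (rule LIMSEQ_le_const2[OF tendsto_norm[OF lim[OF that]]]) (use le that in blast)
  have [measurable]: "(\<lambda>x. norm (G n x - F x)) \<in> borel_measurable M" for n
    by (intro strongly_measurable_norm strongly_measurable_diff F G)
  have wfin: "(\<integral>\<^sup>+x. ennreal (w x) \<partial>M) < \<infinity>"
  proof -
    have "(\<integral>\<^sup>+x. ennreal (w x) \<partial>M) \<le> (\<integral>\<^sup>+x. ennreal (norm (w x)) \<partial>M)"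
      by (intro nn_integral_mono ennreal_leI) auto
    then show ?thesis
      using w unfolding integrable_iff_bounded by (auto intro: order_le_less_trans)
  qed
  have fin: "(\<integral>\<^sup>+x. ennreal (norm (H x)) \<partial>M) < \<infinity>"
    if "\<And>x. x \<in> space M \<Longrightarrow> norm (H x) \<le> w x" for H :: "'m \<Rightarrow> 'a bborel"
  proof -
    have "(\<integral>\<^sup>+x. ennreal (norm (H x)) \<partial>M) \<le> (\<integral>\<^sup>+x. ennreal (w x) \<partial>M)"
      using that by (intro nn_integral_mono ennreal_leI) auto
    then show ?thesis
      using wfin by (rule order_le_less_trans)
  qed
  have "(\<lambda>n. \<integral>\<^sup>+x. ennreal (norm (G n x - F x)) \<partial>M) \<longlonglongrightarrow> (\<integral>\<^sup>+x. 0 \<partial>M)"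
  proof (rule nn_integral_dominated_convergence[where w = "\<lambda>x. ennreal (2 * w x)"])
    show "AE x in M. ennreal (norm (G n x - F x)) \<le> ennreal (2 * w x)" for n
    proof (intro AE_I2 ennreal_leI)
      fix x assume "x \<in> space M"
      then show "norm (G n x - F x) \<le> 2 * w x"
        using le[of x n] leF[of x] norm_triangle_ineq4[of "G n x" "F x"] by simp
    qed
    show "(\<integral>\<^sup>+x. ennreal (2 * w x) \<partial>M) < \<infinity>"
      using wfin w by (simp add: ennreal_mult' nn_integral_cmult ennreal_mult_less_top)
    show "AE x in M. (\<lambda>n. ennreal (norm (G n x - F x))) \<longlonglongrightarrow> 0"
    proof (rule AE_I2)
      fix x assume "x \<in> space M"
      then have "(\<lambda>n. norm (G n x - F x)) \<longlonglongrightarrow> norm (F x - F x)"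
        by (intro tendsto_intros lim)
      then show "(\<lambda>n. ennreal (norm (G n x - F x))) \<longlonglongrightarrow> 0"
        using tendsto_ennrealI by fastforce
    qed
  qed (use w in auto)
  then have "(\<lambda>n. \<integral>\<^sup>+x. ennreal (norm (G n x - F x)) \<partial>M) \<longlonglongrightarrow> 0"
    by simp
  then have "(\<lambda>n. ennreal (norm (Bochner_integral M (G n) - Bochner_integral M F))) \<longlonglongrightarrow> 0"
  proof (rule tendsto_sandwich[rotated 3])
    show "\<forall>\<^sub>F n in sequentially. ennreal (norm (Bochner_integral M (G n) - Bochner_integral M F)) \<le>
        (\<integral>\<^sup>+x. ennreal (norm (G n x - F x)) \<partial>M)"
      by (intro always_eventually allI norm_Bochner_integral_diff_le F G fin le leF)
  qed auto
  then have "(\<lambda>n. norm (Bochner_integral M (G n) - Bochner_integral M F)) \<longlonglongrightarrow> 0"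
    by (simp flip: ennreal_0)
  then show ?thesis
    by (rule LIM_zero_cancel[OF tendsto_norm_zero_cancel])
qed

section \<open>Peeling off the last point of a time simplex\<close>

lemma with_ends_0 [simp]: "with_ends n a b u 0 = a"
  and with_ends_last [simp]: "with_ends n a b u (Suc n) = b"
  by (simp_all add: with_ends_def)

text \<open>
  The index shift behind all recursions over \<open>n\<close>: fixing the last free coordinate \<open>u (Suc n) = c\<close>
  turns it into the right end point of a tuple with one free coordinate less.
\<close>
lemma with_ends_upd:
  "k \<le> Suc n \<Longrightarrow> with_ends (Suc n) a b (u(Suc n := c)) k = with_ends n a c u k"
  by (auto simp: with_ends_def)

lemma with_ends_measurable [measurable (raw)]:
  fixes a b :: "'m \<Rightarrow> 'c::euclidean_space"
  assumes a: "a \<in> borel_measurable M" and b: "b \<in> borel_measurable M"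
    and u: "u \<in> measurable M (PiM {1..n} (\<lambda>_. lborel))" and k: "k \<le> Suc n"
  shows "(\<lambda>w. with_ends n (a w) (b w) (u w) k) \<in> borel_measurable M"
proof -
  consider "k = 0" | "k = Suc n" | "k \<in> {1..n}"
    using k by fastforce
  then show ?thesis
  proof cases
    case 3
    then have "(\<lambda>w. u w k) \<in> measurable M lborel"
      using measurable_compose[OF u measurable_component_singleton[of k "{1..n}"]] by simp
    moreover have "with_ends n (a w) (b w) (u w) k = u w k" for w
      using 3 by (auto simp: with_ends_def)
    ultimately show ?thesis by simp
  qed (use a b in simp_all)
qed

lemma time_simplex_Suc:
  "s(Suc n := \<sigma>) \<in> time_simplex (Suc n) t \<longleftrightarrow> \<sigma> < t \<and> s \<in> time_simplex n \<sigma>"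
proof -
  have "(\<forall>k\<le>Suc n. P k) \<longleftrightarrow> P (Suc n) \<and> (\<forall>k\<le>n. P k)" for P
    by (auto simp: le_Suc_eq)
  then show ?thesis
    by (simp add: time_simplex_def with_ends_upd)
qed

lemma time_simplex_0: "time_simplex 0 t = (if 0 < t then UNIV else {})"
  by (auto simp: time_simplex_def)

lemma time_simplex_increment:
  assumes "s \<in> time_simplex n t" "k \<le> n"
  shows "0 < with_ends n 0 t s (Suc k) - with_ends n 0 t s k"
    and "with_ends n 0 t s (Suc k) - with_ends n 0 t s k \<le> t"
proof -
  let ?w = "with_ends n 0 t s"
  have step: "?w j < ?w (Suc j)" if "j \<le> n" for j
    using assms(1) that by (simp add: time_simplex_def)
  show "0 < ?w (Suc k) - ?w k"
    using step[OF assms(2)] by simp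
  have "0 \<le> ?w k"
    using assms(2)
  proof (induction k)
    case (Suc k)
    then show ?case using step[of k] by simp
  qed simp
  moreover have "?w (Suc k) \<le> t"
    using assms(2)
  proof (induction k rule: inc_induct)
    case (step k)
    then show ?case using \<open>\<And>j. j \<le> n \<Longrightarrow> ?w j < ?w (Suc j)\<close>[of "Suc k"] by simp
  qed simp
  ultimately show "?w (Suc k) - ?w k \<le> t" by simp
qed

lemma time_simplex_pos: "s \<in> time_simplex n t \<Longrightarrow> 0 < t"
  using time_simplex_increment[of s n t 0] by linarith

lemma time_simplex_measurable [measurable (raw)]:
  assumes [measurable]: "t \<in> borel_measurable M" "s \<in> measurable M (PiM {1..n} (\<lambda>_. lborel))"
  shows "Measurable.pred M (\<lambda>w. s w \<in> time_simplex n (t w))"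
proof -
  have "Measurable.pred M (\<lambda>w. \<forall>k\<in>{..n}. with_ends n 0 (t w) (s w) k < with_ends n 0 (t w) (s w) (Suc k))"
    by (intro pred_intros_finite borel_measurable_pred_less with_ends_measurable) (use assms in auto)
  then show ?thesis
    by (simp add: time_simplex_def Ball_def)
qed

interpretation lborel_product: product_sigma_finite "\<lambda>_::nat. lborel :: 'c::euclidean_space measure"
  by standard

lemma atLeastAtMost_1_Suc: "{1..Suc n} = insert (Suc n) {1..n}"
  by auto

lemma measurable_PiM_upd [measurable (raw)]:
  assumes "u \<in> measurable M (PiM {1..n} (\<lambda>_. N))" "c \<in> measurable M N"
  shows "(\<lambda>w. (u w)(Suc n := c w)) \<in> measurable M (PiM {1..Suc n} (\<lambda>_. N))"
  unfolding atLeastAtMost_1_Suc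
  by (rule measurable_fun_upd[where J = "{1..n}"]) (use assms in auto)

lemma nn_integral_PiM_Suc:
  fixes g :: "(nat \<Rightarrow> 'c::euclidean_space) \<Rightarrow> ennreal"
  assumes "g \<in> borel_measurable (PiM {1..Suc n} (\<lambda>_. lborel))"
  shows "(\<integral>\<^sup>+s. g s \<partial>PiM {1..Suc n} (\<lambda>_. lborel)) =
    (\<integral>\<^sup>+c. (\<integral>\<^sup>+s. g (s(Suc n := c)) \<partial>PiM {1..n} (\<lambda>_. lborel)) \<partial>lborel)"
  using assms unfolding atLeastAtMost_1_Suc
  by (intro lborel_product.product_nn_integral_insert_rev) auto

text \<open>
  The order of integration matters: the coordinate split off is integrated last, since the domain of
  the others, a smaller simplex, depends on it.
\<close>
lemma integral_PiM_Suc: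
  fixes g :: "(nat \<Rightarrow> 'c::euclidean_space) \<Rightarrow> real"
  assumes g: "integrable (PiM {1..Suc n} (\<lambda>_. lborel)) g"
  shows "(LINT s|PiM {1..Suc n} (\<lambda>_. lborel). g s) =
    (LINT c|lborel. LINT s|PiM {1..n} (\<lambda>_. lborel). g (s(Suc n := c)))"
proof -
  let ?L = "\<lambda>_::nat. lborel :: 'c measure"
  interpret N: sigma_finite_measure "PiM {1..n} ?L"
    by (rule lborel_product.sigma_finite) simp
  have [measurable]: "g \<in> borel_measurable (PiM {1..Suc n} ?L)"
    using g by auto
  have m: "(\<lambda>s. LINT y|PiM {1..n} ?L. g (y(Suc n := s))) \<in> borel_measurable lborel"
    by measurable
  have "(LINT s|PiM {1..Suc n} ?L. g s) =
      (LINT x|PiM {Suc n} ?L. LINT y|PiM {1..n} ?L. g (merge {Suc n} {1..n} (x, y)))"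
    using g unfolding atLeastAtMost_1_Suc insert_is_Un[of "Suc n" "{1..n}"]
    by (intro lborel_product.product_integral_fold) auto
  also have "\<dots> = (LINT x|PiM {Suc n} ?L. LINT y|PiM {1..n} ?L. g (y(Suc n := x (Suc n))))"
  proof (intro Bochner_Integration.integral_cong refl)
    fix x y assume "x \<in> space (PiM {Suc n} ?L)" "y \<in> space (PiM {1..n} ?L)"
    then have "merge {Suc n} {1..n} (x, y) = y(Suc n := x (Suc n))"
      by (auto simp: merge_def fun_eq_iff space_PiM PiE_def extensional_def)
    then show "g (merge {Suc n} {1..n} (x, y)) = g (y(Suc n := x (Suc n)))" by simp
  qed
  also have "\<dots> = (LINT c|lborel. LINT s|PiM {1..n} ?L. g (s(Suc n := c)))"
    using lborel_product.product_integral_singleton[OF m] by simp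
  finally show ?thesis .
qed

lemma nn_integral_time_simplex_Suc:
  fixes g :: "(nat \<Rightarrow> real) \<Rightarrow> ennreal"
  assumes [measurable]: "g \<in> borel_measurable (PiM {1..Suc n} (\<lambda>_. lborel))"
  shows "(\<integral>\<^sup>+s\<in>time_simplex (Suc n) t. g s \<partial>PiM {1..Suc n} (\<lambda>_. lborel)) =
    (\<integral>\<^sup>+\<sigma>\<in>{0<..<t}. (\<integral>\<^sup>+s\<in>time_simplex n \<sigma>. g (s(Suc n := \<sigma>)) \<partial>PiM {1..n} (\<lambda>_. lborel)) \<partial>lborel)"
  (is "?L = ?R")
proof -
  have "?L = (\<integral>\<^sup>+\<sigma>. (\<integral>\<^sup>+s. g (s(Suc n := \<sigma>)) * indicator (time_simplex (Suc n) t) (s(Suc n := \<sigma>))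
      \<partial>PiM {1..n} (\<lambda>_. lborel)) \<partial>lborel)"
    by (rule nn_integral_PiM_Suc) measurable
  also have "\<dots> = ?R"
  proof (rule nn_integral_cong)
    fix \<sigma> :: real
    have "(\<integral>\<^sup>+s. g (s(Suc n := \<sigma>)) * indicator (time_simplex (Suc n) t) (s(Suc n := \<sigma>))
        \<partial>PiM {1..n} (\<lambda>_. lborel)) =
      (\<integral>\<^sup>+s. g (s(Suc n := \<sigma>)) * indicator (time_simplex n \<sigma>) s * indicator {0<..<t} \<sigma>
        \<partial>PiM {1..n} (\<lambda>_. lborel))"
      by (intro nn_integral_cong)
         (auto simp: indicator_def time_simplex_Suc dest: time_simplex_pos)
    also have "\<dots> = (\<integral>\<^sup>+s\<in>time_simplex n \<sigma>. g (s(Suc n := \<sigma>)) \<partial>PiM {1..n} (\<lambda>_. lborel)) *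
        indicator {0<..<t} \<sigma>"
      by (intro nn_integral_multc) measurable
    finally show "(\<integral>\<^sup>+s. g (s(Suc n := \<sigma>)) * indicator (time_simplex (Suc n) t) (s(Suc n := \<sigma>))
        \<partial>PiM {1..n} (\<lambda>_. lborel)) = \<dots>" .
  qed
  finally show ?thesis .
qed

lemma integral_time_simplex_Suc:
  fixes g :: "(nat \<Rightarrow> real) \<Rightarrow> real"
  assumes "integrable (PiM {1..Suc n} (\<lambda>_. lborel)) (\<lambda>s. indicator (time_simplex (Suc n) t) s * g s)"
  shows "(LINT s|PiM {1..Suc n} (\<lambda>_. lborel). indicator (time_simplex (Suc n) t) s * g s) =
    (LINT \<sigma>:{0<..<t}|lborel.
      LINT s|PiM {1..n} (\<lambda>_. lborel). indicator (time_simplex n \<sigma>) s * g (s(Suc n := \<sigma>)))"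
proof -
  have *: "indicator (time_simplex (Suc n) t) (s(Suc n := \<sigma>)) * g (s(Suc n := \<sigma>)) =
      indicator {0<..<t} \<sigma> * (indicator (time_simplex n \<sigma>) s * g (s(Suc n := \<sigma>)))" for s \<sigma>
    by (auto simp: indicator_def time_simplex_Suc dest: time_simplex_pos)
  show ?thesis
    unfolding integral_PiM_Suc[OF assms] set_lebesgue_integral_def * by simp
qed

section \<open>Convolution powers of a singular power of time\<close>

lemma Beta_real_nonneg: "0 < a \<Longrightarrow> 0 < b \<Longrightarrow> 0 \<le> Beta a (b :: real)"
  by (simp add: Beta_def Gamma_real_pos less_imp_le)

text \<open>
  The substitution \<open>s = t u\<close> reduces the convolution of two powers to the Beta integral.
\<close>
lemma nn_integral_powr_convolution:
  fixes a b t :: real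
  assumes a: "0 < a" and b: "0 < b" and t: "0 < t"
  shows "(\<integral>\<^sup>+s\<in>{0<..<t}. ennreal ((t - s) powr (a - 1) * s powr (b - 1)) \<partial>lborel) =
    ennreal (Beta a b * t powr (a + b - 1))"
proof -
  have unit: "(\<integral>\<^sup>+u\<in>{0<..<1}. ennreal ((1 - u) powr (a - 1) * u powr (b - 1)) \<partial>lborel) =
      ennreal (Beta a b)"
  proof -
    have "((\<lambda>u. (1 - u) powr (a - 1) * u powr (b - 1)) has_integral Beta a b) {0<..<1}"
      using has_integral_Beta_real[OF b a] by (simp add: has_integral_Icc_iff_Ioo Beta_commute mult.commute)
    then show ?thesis
      by (intro nn_integral_has_integral_lebesgue') auto
  qed
  have "(\<integral>\<^sup>+s\<in>{0<..<t}. ennreal ((t - s) powr (a - 1) * s powr (b - 1)) \<partial>lborel) =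
      ennreal t * (\<integral>\<^sup>+u. ennreal ((t - t * u) powr (a - 1) * (t * u) powr (b - 1)) * indicator {0<..<t} (t * u) \<partial>lborel)"
    using t by (subst nn_integral_real_affine[where c = t and t = 0]) auto
  also have "\<dots> = ennreal t * (\<integral>\<^sup>+u. ennreal (t powr (a + b - 2)) *
      (ennreal ((1 - u) powr (a - 1) * u powr (b - 1)) * indicator {0<..<1} u) \<partial>lborel)"
  proof (rule arg_cong[where f = "\<lambda>c. ennreal t * c"], rule nn_integral_cong)
    fix u :: real
    show "ennreal ((t - t * u) powr (a - 1) * (t * u) powr (b - 1)) * indicator {0<..<t} (t * u) =
        ennreal (t powr (a + b - 2)) *
        (ennreal ((1 - u) powr (a - 1) * u powr (b - 1)) * indicator {0<..<1} u)"
    proof (cases "u \<in> {0<..<1}")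
      case True
      have "(t - t * u) powr (a - 1) * (t * u) powr (b - 1) =
          (t powr (a - 1) * t powr (b - 1)) * ((1 - u) powr (a - 1) * u powr (b - 1))"
        using True t powr_mult[of t "1 - u" "a - 1"] powr_mult[of t u "b - 1"]
        by (simp add: algebra_simps)
      also have "t powr (a - 1) * t powr (b - 1) = t powr (a + b - 2)"
        by (simp add: powr_add[symmetric])
      finally show ?thesis
        using True t by (simp add: ennreal_mult)
    qed (use t in \<open>auto simp: indicator_def zero_less_mult_iff\<close>)
  qed
  also have "\<dots> = ennreal t * (ennreal (t powr (a + b - 2)) * ennreal (Beta a b))"
    by (subst nn_integral_cmult) (auto simp: unit)
  also have "\<dots> = ennreal (Beta a b * t powr (a + b - 1))"
  proof -
    have "0 \<le> Beta a b"
      using a b by (rule Beta_real_nonneg)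
    moreover have "t * t powr (a + b - 2) = t powr (a + b - 1)"
      using t powr_add[of t 1 "a + b - 2"] by simp
    ultimately show ?thesis
      using t by (simp add: ennreal_mult[symmetric] mult.assoc[symmetric] mult.commute)
  qed
  finally show ?thesis .
qed

text \<open>
  The integrands \<open>(1-u)\<^bsup>a-1\<^esup> u\<^bsup>(n+1)b-1\<^esup>\<close> decrease to 0 on \<open>{0<..<1}\<close> and are dominated by the one with
  \<open>n = 0\<close>.
\<close>
lemma Beta_multiples_tendsto_0:
  fixes a b :: real
  assumes a: "0 < a" and b: "0 < b"
  shows "(\<lambda>n. Beta a (real (Suc n) * b)) \<longlonglongrightarrow> 0"
proof -
  let ?h = "\<lambda>n u. ennreal ((1 - u) powr (a - 1) * u powr (real (Suc n) * b - 1)) * indicator {0<..<1} u"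
  have B: "(\<integral>\<^sup>+u. ?h n u \<partial>lborel) = ennreal (Beta a (real (Suc n) * b))" for n
    using nn_integral_powr_convolution[of a "real (Suc n) * b" 1] a b by (simp del: of_nat_Suc)
  have "(\<lambda>n. \<integral>\<^sup>+u. ?h n u \<partial>lborel) \<longlonglongrightarrow> (\<integral>\<^sup>+(u::real). 0 \<partial>lborel)"
  proof (rule nn_integral_dominated_convergence[where w = "?h 0"])
    show "AE u in lborel. ?h j u \<le> ?h 0 u" for j
    proof (rule AE_I2)
      fix u :: real
      show "?h j u \<le> ?h 0 u"
      proof (cases "u \<in> {0<..<1}")
        case True
        have "1 * b \<le> real (Suc j) * b"
          using b by (intro mult_right_mono) auto
        then have "u powr (real (Suc j) * b - 1) \<le> u powr (real (Suc 0) * b - 1)"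
          using True by (intro powr_mono') auto
        then show ?thesis
          using True by (auto intro!: ennreal_leI mult_left_mono)
      qed auto
    qed
    show "(\<integral>\<^sup>+u. ?h 0 u \<partial>lborel) < \<infinity>"
      unfolding B by simp
    show "AE u in lborel. (\<lambda>n. ?h n u) \<longlonglongrightarrow> 0"
    proof (rule AE_I2)
      fix u :: real
      show "(\<lambda>n. ?h n u) \<longlonglongrightarrow> 0"
      proof (cases "u \<in> {0<..<1}")
        case True
        have "(\<lambda>n. (u powr b) ^ Suc n) \<longlonglongrightarrow> 0"
          using True b by (intro LIMSEQ_Suc LIMSEQ_realpow_zero) (simp_all add: powr01_less_one)
        then have "(\<lambda>n. (1 - u) powr (a - 1) * ((u powr b) ^ Suc n * u powr (-1))) \<longlonglongrightarrow>
            (1 - u) powr (a - 1) * (0 * u powr (-1))"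
          by (intro tendsto_intros)
        moreover have "(u powr b) ^ Suc n * u powr (-1) = u powr (real (Suc n) * b - 1)" for n
          using True by (simp add: powr_realpow[symmetric] powr_powr powr_diff powr_minus_divide mult.commute
              del: of_nat_Suc power_Suc)
        ultimately have "(\<lambda>n. (1 - u) powr (a - 1) * u powr (real (Suc n) * b - 1)) \<longlonglongrightarrow> 0"
          by (simp only: mult_zero_left mult_zero_right)
        then show ?thesis
          using True tendsto_ennrealI[of _ 0] by (fastforce simp del: of_nat_Suc)
      qed simp
    qed
  qed auto
  then have "(\<lambda>n. ennreal (Beta a (real (Suc n) * b))) \<longlonglongrightarrow> ennreal 0"
    unfolding B by simp
  moreover have "0 \<le> Beta a (real (Suc n) * b)" for n
    using a b by (intro Beta_real_nonneg) (auto simp del: of_nat_Suc)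
  ultimately show ?thesis
    by (simp del: ennreal_0 of_nat_Suc)
qed

text \<open>
  The \<open>(n+1)\<close>-fold convolution power of \<open>K t\<^bsup>b-1\<^esup>\<close> is \<open>conv_power_const K b n * t\<^bsup>(n+1)b-1\<^esup>\<close>. In closed
  form the constant is \<open>(K \<Gamma>(b))\<^bsup>n+1\<^esup> / \<Gamma>((n+1)b)\<close>; the recursive form is the one that the ratio test
  and the inductions use.
\<close>
primrec conv_power_const :: "real \<Rightarrow> real \<Rightarrow> nat \<Rightarrow> real" where
  "conv_power_const K b 0 = K"
| "conv_power_const K b (Suc n) = K * Beta b (real (Suc n) * b) * conv_power_const K b n"

lemma conv_power_const_nonneg: "0 \<le> K \<Longrightarrow> 0 < b \<Longrightarrow> 0 \<le> conv_power_const K b n"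
  by (induction n) (auto simp: Beta_real_nonneg simp del: of_nat_Suc)

text \<open>
  The ratio of consecutive constants is \<open>K B(b, (n+1)b)\<close>, which tends to 0. This is what makes the
  perturbation series converge for perturbations of arbitrary size.
\<close>
lemma summable_conv_power_const:
  assumes K: "0 \<le> K" and b: "0 < b"
  shows "summable (conv_power_const K b)"
proof -
  have "(\<lambda>n. K * Beta b (real (Suc n) * b)) \<longlonglongrightarrow> K * 0"
    by (intro tendsto_intros Beta_multiples_tendsto_0 b)
  then have "\<forall>\<^sub>F n in sequentially. K * Beta b (real (Suc n) * b) < 1 / 2"
    by (rule order_tendstoD) simp
  then obtain N where N: "\<And>n. n \<ge> N \<Longrightarrow> K * Beta b (real (Suc n) * b) < 1 / 2"
    unfolding eventually_sequentially by blast
  show ?thesis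
  proof (rule summable_ratio_test[of "1 / 2" N])
    fix n assume "n \<ge> N"
    then have "conv_power_const K b (Suc n) \<le> 1 / 2 * conv_power_const K b n"
      unfolding conv_power_const.simps
      using conv_power_const_nonneg[OF K b] N[of n] by (intro mult_right_mono) auto
    then show "norm (conv_power_const K b (Suc n)) \<le> 1 / 2 * norm (conv_power_const K b n)"
      using conv_power_const_nonneg[OF K b] by (simp del: conv_power_const.simps)
  qed simp
qed

lemma nn_integral_convolution_step:
  assumes K: "0 \<le> K" and D: "0 \<le> D" and b: "0 < b" and b': "0 < b'" and t: "0 < t"
  shows "(\<integral>\<^sup>+s\<in>{0<..<t}. ennreal (K * (t - s) powr (b - 1)) * ennreal (D * s powr (b' - 1)) \<partial>lborel) =
    ennreal (K * Beta b b' * D * t powr (b + b' - 1))"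
proof -
  have "(\<integral>\<^sup>+s\<in>{0<..<t}. ennreal (K * (t - s) powr (b - 1)) * ennreal (D * s powr (b' - 1)) \<partial>lborel) =
      (\<integral>\<^sup>+s. ennreal (K * D) * (ennreal ((t - s) powr (b - 1) * s powr (b' - 1)) * indicator {0<..<t} s) \<partial>lborel)"
    using K D by (intro nn_integral_cong)
      (auto simp: indicator_def ennreal_mult[symmetric] mult_ac)
  also have "\<dots> = ennreal (K * D) * ennreal (Beta b b' * t powr (b + b' - 1))"
    by (subst nn_integral_cmult) (auto simp: nn_integral_powr_convolution b b' t)
  also have "\<dots> = ennreal (K * Beta b b' * D * t powr (b + b' - 1))"
    using K D b b' by (simp add: ennreal_mult[symmetric] Beta_real_nonneg mult_ac)
  finally show ?thesis .
qed

section \<open>Operator families with an integrable singularity at time zero\<close>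

text \<open>
  A bounded strongly continuous family is the case \<open>b = 1\<close>, so that both \<open>P0\<close> and \<open>Q0\<close> are instances.
\<close>
locale singular_operators =
  fixes T :: "real \<Rightarrow> 'a::topological_space bborel \<Rightarrow> 'a bborel" and K b :: real
  assumes K: "0 \<le> K" and b: "0 < b"
    and linear: "t \<in> {0<..1} \<Longrightarrow> linear (T t)"
    and norm_le: "t \<in> {0<..1} \<Longrightarrow> norm (T t f) \<le> K * t powr (b - 1) * norm f"
    and strongly_continuous:
      "t \<in> {0<..1} \<Longrightarrow> ((\<lambda>s. norm (T s f - T t f)) \<longlongrightarrow> 0) (at t within {0<..1})"
begin

lemma bounded_linear: "t \<in> {0<..1} \<Longrightarrow> bounded_linear (T t)"
  using linear norm_le by (intro bounded_linear_intro[where K = "K * t powr (b - 1)"])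
    (auto simp: linear_add linear_scale mult_ac)

lemma bounded_linear_apply:
  "t \<in> {0<..1} \<Longrightarrow> bounded_linear (\<lambda>f. apply_bborel (T t f) x)"
  by (rule bounded_linear_compose[OF bounded_linear_apply_bborel bounded_linear])

lemma continuous_on_time: "continuous_on {0<..1} (\<lambda>t. T t f)"
  unfolding continuous_on_def
  by (rule ballI, rule LIM_zero_cancel[OF tendsto_norm_zero_cancel], rule strongly_continuous)

text \<open>
  Strong continuity in time and boundedness of the norms near each positive time combine in
  \<open>T u g - T t f = T u (g - f) + (T u f - T t f)\<close>.
\<close>
lemma jointly_continuous: "continuous_on ({0<..1} \<times> UNIV) (\<lambda>(t, f). T t f)"
  unfolding continuous_on_sequentially
proof (intro allI ballI impI, elim conjE)
  fix p :: "nat \<Rightarrow> real \<times> 'a bborel" and q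
  assume q: "q \<in> {0<..1} \<times> UNIV" and p: "\<forall>n. p n \<in> {0<..1} \<times> UNIV" and lim: "p \<longlonglongrightarrow> q"
  obtain t f where tf: "q = (t, f)" by fastforce
  define u g where "u n = fst (p n)" and "g n = snd (p n)" for n
  have pn: "p n = (u n, g n)" for n by (simp add: u_def g_def)
  have t: "t \<in> {0<..1}" and u: "u n \<in> {0<..1}" for n
    using q p by (auto simp: tf u_def mem_Times_iff)
  have ul: "u \<longlonglongrightarrow> t" and gl: "g \<longlonglongrightarrow> f"
    using tendsto_fst[OF lim] tendsto_snd[OF lim] by (simp_all add: u_def[abs_def] g_def[abs_def] tf)
  have "(\<lambda>n. T (u n) f) \<longlonglongrightarrow> T t f"
    by (rule continuous_on_tendsto_compose[OF continuous_on_time ul t]) (intro always_eventually allI u)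
  moreover have "(\<lambda>n. T (u n) (g n - f)) \<longlonglongrightarrow> 0"
  proof (rule Lim_null_comparison)
    show "\<forall>\<^sub>F n in sequentially. norm (T (u n) (g n - f)) \<le> K * u n powr (b - 1) * norm (g n - f)"
      by (intro always_eventually allI norm_le u)
    have "(\<lambda>n. K * u n powr (b - 1) * norm (g n - f)) \<longlonglongrightarrow> K * t powr (b - 1) * norm (f - f)"
      using t by (intro tendsto_intros ul gl) auto
    then show "(\<lambda>n. K * u n powr (b - 1) * norm (g n - f)) \<longlonglongrightarrow> 0" by simp
  qed
  ultimately have "(\<lambda>n. T (u n) (g n - f) + T (u n) f) \<longlonglongrightarrow> 0 + T t f"
    by (intro tendsto_add)
  moreover have "T (u n) (g n - f) + T (u n) f = T (u n) (g n)" for n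
    using linear_add[OF linear[OF u[of n]], of "g n - f" f] by simp
  ultimately show "((\<lambda>(t, f). T t f) \<circ> p) \<longlonglongrightarrow> (\<lambda>(t, f). T t f) q"
    by (simp add: tf comp_def pn)
qed

section \<open>Convolution with a continuous curve\<close>

context
  fixes V :: "real \<Rightarrow> 'a bborel" and D b' :: real
  assumes V: "continuous_on {0<..1} V" and D: "0 \<le> D" and b': "0 < b'"
    and V_le: "\<And>t. t \<in> {0<..1} \<Longrightarrow> norm (V t) \<le> D * t powr (b' - 1)"
begin

lemma strongly_measurable_convolution:
  assumes A: "A \<in> sets M" and u: "u \<in> borel_measurable M" and v: "v \<in> borel_measurable M"
    and range: "\<And>x. x \<in> A \<Longrightarrow> u x \<in> {0<..1} \<and> v x \<in> {0<..1}"
  shows "strongly_measurable M (\<lambda>x. indicator A x *\<^sub>R T (u x) (V (v x)))"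
proof -
  have "continuous_on ({0<..1} \<times> UNIV) (\<lambda>(t, g :: 'a bborel). V t)"
    unfolding case_prod_beta
    by (rule continuous_on_compose2[OF V continuous_on_fst[OF continuous_on_id]]) auto
  then have "strongly_measurable M (\<lambda>x. indicator A x *\<^sub>R V (v x))"
    using range by (intro strongly_measurable_parametrized[OF _ strongly_measurable_const v A]) auto
  then have "strongly_measurable M (\<lambda>x. indicator A x *\<^sub>R T (u x) (indicator A x *\<^sub>R V (v x)))"
    using range by (intro strongly_measurable_parametrized[OF jointly_continuous _ u A]) auto
  moreover have "indicator A x *\<^sub>R T (u x) (indicator A x *\<^sub>R V (v x)) = indicator A x *\<^sub>R T (u x) (V (v x))" for x
    by (simp add: indicator_def)
  ultimately show ?thesis by simp
qed

lemma norm_convolution_integrand_le: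
  assumes "u \<in> {0<..1}" "v \<in> {0<..1}"
  shows "norm (T u (V v)) \<le> (K * u powr (b - 1)) * (D * v powr (b' - 1))"
  by (rule order_trans[OF norm_le[OF assms(1)]])
     (use K V_le[OF assms(2)] in \<open>auto intro!: mult_left_mono\<close>)

lemma convolution_integrand:
  assumes t: "t \<in> {0<..1}"
  shows "strongly_measurable lborel (\<lambda>s. indicator {0<..<t} s *\<^sub>R T (t - s) (V s))"
    and "(\<integral>\<^sup>+s. ennreal (norm (indicator {0<..<t} s *\<^sub>R T (t - s) (V s))) \<partial>lborel) \<le>
      ennreal (K * Beta b b' * D * t powr (b + b' - 1))"
proof -
  show "strongly_measurable lborel (\<lambda>s. indicator {0<..<t} s *\<^sub>R T (t - s) (V s))"
    using t by (intro strongly_measurable_convolution) auto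
  have "(\<integral>\<^sup>+s. ennreal (norm (indicator {0<..<t} s *\<^sub>R T (t - s) (V s))) \<partial>lborel) \<le>
      (\<integral>\<^sup>+s\<in>{0<..<t}. ennreal (K * (t - s) powr (b - 1)) * ennreal (D * s powr (b' - 1)) \<partial>lborel)"
  proof (rule nn_integral_mono)
    fix s
    show "ennreal (norm (indicator {0<..<t} s *\<^sub>R T (t - s) (V s))) \<le>
        ennreal (K * (t - s) powr (b - 1)) * ennreal (D * s powr (b' - 1)) * indicator {0<..<t} s"
      using t K D norm_convolution_integrand_le[of "t - s" s]
      by (auto simp: indicator_def ennreal_mult[symmetric] intro!: ennreal_leI)
  qed
  also have "\<dots> = ennreal (K * Beta b b' * D * t powr (b + b' - 1))"
    using t by (intro nn_integral_convolution_step K D b b') auto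
  finally show "(\<integral>\<^sup>+s. ennreal (norm (indicator {0<..<t} s *\<^sub>R T (t - s) (V s))) \<partial>lborel) \<le>
      ennreal (K * Beta b b' * D * t powr (b + b' - 1))" .
qed

lemma apply_convolution:
  assumes t: "t \<in> {0<..1}"
  shows "apply_bborel (set_Bochner_integral lborel {0<..<t} (\<lambda>s. T (t - s) (V s))) x =
    (LINT s:{0<..<t}|lborel. apply_bborel (T (t - s) (V s)) x)"
proof -
  have "(\<integral>\<^sup>+s. ennreal (norm (indicator {0<..<t} s *\<^sub>R T (t - s) (V s))) \<partial>lborel) < \<infinity>"
    using convolution_integrand(2)[OF t] by (auto simp: order_le_less_trans)
  from bounded_linear_Bochner_integral[OF convolution_integrand(1)[OF t] this
      bounded_linear_apply_bborel[of x]]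
  show ?thesis
    by (simp add: set_Bochner_integral_def set_lebesgue_integral_def scaleR_bborel.rep_eq)
qed

text \<open>
  With \<open>s = t u\<close> the domain of integration no longer depends on \<open>t\<close>, and the integrand is jointly
  continuous. Its norm is at most \<open>t\<^bsup>b+b'-1\<^esup>\<close> times the fixed integrable function
  \<open>K D (1-u)\<^bsup>b-1\<^esup> u\<^bsup>b'-1\<^esup>\<close>, where the first factor is bounded along a sequence of times
  with a positive limit.
\<close>
lemma continuous_on_convolution:
  "continuous_on {0<..1} (\<lambda>t. set_Bochner_integral lborel {0<..<t} (\<lambda>s. T (t - s) (V s)))"
proof -
  define G where "G t u = indicator {0<..<1::real} u *\<^sub>R (t *\<^sub>R T (t * (1 - u)) (V (t * u)))" for t u
  have in01: "t * (1 - u) \<in> {0<..1} \<and> t * u \<in> {0<..1}" if "t \<in> {0<..1}" "u \<in> {0<..<1}" for t u :: real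
    using that by (auto simp: mult_le_one)
  have smG: "strongly_measurable lborel (G t)" if t: "t \<in> {0<..1}" for t
  proof -
    have c: "continuous_on ({0<..1} \<times> UNIV) (\<lambda>(_ :: real, g :: 'a bborel). t *\<^sub>R g)"
      unfolding case_prod_beta by (intro continuous_intros)
    have "strongly_measurable lborel (\<lambda>u. indicator {0<..<1} u *\<^sub>R T (t * (1 - u)) (V (t * u)))"
      using in01[OF t] by (intro strongly_measurable_convolution) auto
    from strongly_measurable_parametrized[OF c this, of "\<lambda>_. 1" "{0<..<1}"]
    show ?thesis
      unfolding G_def by (rule strongly_measurable_cong[THEN iffD1, rotated]) (auto simp: indicator_def)
  qed
  have normG: "norm (G t u) \<le> t powr (b + b' - 1) *
      (K * D * (indicator {0<..<1} u * ((1 - u) powr (b - 1) * u powr (b' - 1))))"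
    if t: "t \<in> {0<..1}" for t u
  proof (cases "u \<in> {0<..<1}")
    case True
    have "norm (G t u) \<le> t * ((K * (t * (1 - u)) powr (b - 1)) * (D * (t * u) powr (b' - 1)))"
      using True t norm_convolution_integrand_le[of "t * (1 - u)" "t * u"] in01[OF t True]
      by (auto simp: G_def intro!: mult_left_mono)
    also have "\<dots> = (t * t powr (b - 1) * t powr (b' - 1)) *
        (K * D * ((1 - u) powr (b - 1) * u powr (b' - 1)))"
      using True t by (simp add: powr_mult)
    also have "t * t powr (b - 1) * t powr (b' - 1) = t powr (b + b' - 1)"
      using t powr_add[of t "b - 1" "b' - 1"] powr_add[of t 1 "b + b' - 2"] by (simp add: algebra_simps)
    finally show ?thesis using True by simp
  qed (auto simp: G_def)
  have unit: "integrable lborel (\<lambda>u. indicator {0<..<1} u * ((1 - u) powr (b - 1) * u powr (b' - 1)))"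
  proof (rule integrableI_bounded)
    have "(\<integral>\<^sup>+u. ennreal (norm (indicator {0<..<1} u * ((1 - u) powr (b - 1) * u powr (b' - 1)))) \<partial>lborel) =
        (\<integral>\<^sup>+u\<in>{0<..<1}. ennreal ((1 - u) powr (b - 1) * u powr (b' - 1)) \<partial>lborel)"
      by (intro nn_integral_cong) (auto simp: indicator_def)
    also have "\<dots> < \<infinity>"
      using nn_integral_powr_convolution[OF b b', of 1] by simp
    finally show "(\<integral>\<^sup>+u. ennreal (norm (indicator {0<..<1} u *
        ((1 - u) powr (b - 1) * u powr (b' - 1)))) \<partial>lborel) < \<infinity>" .
  qed measurable
  have finG: "(\<integral>\<^sup>+u. ennreal (norm (G t u)) \<partial>lborel) < \<infinity>" if t: "t \<in> {0<..1}" for t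
  proof -
    let ?h = "\<lambda>u. t powr (b + b' - 1) *
      (K * D * (indicator {0<..<1} u * ((1 - u) powr (b - 1) * u powr (b' - 1))))"
    have "integrable lborel ?h"
      by (intro integrable_mult_right unit)
    then have "(\<integral>\<^sup>+u. ennreal (norm (?h u)) \<partial>lborel) < \<infinity>"
      unfolding integrable_iff_bounded by blast
    moreover have "(\<integral>\<^sup>+u. ennreal (norm (G t u)) \<partial>lborel) \<le> (\<integral>\<^sup>+u. ennreal (norm (?h u)) \<partial>lborel)"
      by (intro nn_integral_mono ennreal_leI order_trans[OF normG[OF t]]) auto
    ultimately show ?thesis
      by (rule order_le_less_trans[rotated])
  qed
  have eq: "set_Bochner_integral lborel {0<..<t} (\<lambda>s. T (t - s) (V s)) = Bochner_integral lborel (G t)"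
    if t: "t \<in> {0<..1}" for t
  proof -
    have "apply_bborel (set_Bochner_integral lborel {0<..<t} (\<lambda>s. T (t - s) (V s))) x =
        apply_bborel (Bochner_integral lborel (G t)) x" for x
    proof -
      have "apply_bborel (set_Bochner_integral lborel {0<..<t} (\<lambda>s. T (t - s) (V s))) x =
          t * (LINT u|lborel. indicator {0<..<t} (t * u) * apply_bborel (T (t - t * u) (V (t * u))) x)"
        using t lborel_integral_real_affine[of t "\<lambda>s. indicator {0<..<t} s * apply_bborel (T (t - s) (V s)) x" 0]
        by (simp add: apply_convolution[OF t] set_lebesgue_integral_def)
      also have "\<dots> = (LINT u|lborel. apply_bborel (G t u) x)"
        unfolding integral_mult_right_zero[symmetric] using t
        by (intro Bochner_Integration.integral_cong refl)
           (auto simp: G_def scaleR_bborel.rep_eq zero_bborel.rep_eq indicator_def algebra_simps zero_less_mult_iff)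
      also have "\<dots> = apply_bborel (Bochner_integral lborel (G t)) x"
        by (rule bounded_linear_Bochner_integral[symmetric, OF smG[OF t] finG[OF t] bounded_linear_apply_bborel])
      finally show ?thesis .
    qed
    then show ?thesis
      by (simp add: apply_bborel_inject[symmetric] fun_eq_iff)
  qed
  have "continuous_on {0<..1} (\<lambda>t. Bochner_integral lborel (G t))"
    unfolding continuous_on_sequentially
  proof (intro allI ballI impI, elim conjE)
    fix \<tau> :: "nat \<Rightarrow> real" and t
    assume t: "t \<in> {0<..1}" and \<tau>: "\<forall>n. \<tau> n \<in> {0<..1}" and lim: "\<tau> \<longlonglongrightarrow> t"
    have "(\<lambda>n. \<tau> n powr (b + b' - 1)) \<longlonglongrightarrow> t powr (b + b' - 1)"
      using t by (intro tendsto_intros lim) auto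
    \<comment> \<open>A convergent sequence is bounded; \<open>b + b' - 1\<close> may be negative, so \<open>\<tau> n \<le> 1\<close> gives no bound.\<close>
    then obtain B where B: "\<And>n. \<bar>\<tau> n powr (b + b' - 1)\<bar> \<le> B"
      using convergent_imp_Bseq[of "\<lambda>n. \<tau> n powr (b + b' - 1)"] unfolding Bseq_def convergent_def by auto
    have "(\<lambda>n. Bochner_integral lborel (G (\<tau> n))) \<longlonglongrightarrow> Bochner_integral lborel (G t)"
    proof (rule Bochner_integral_dominated_convergence)
      show "integrable lborel (\<lambda>u. B *
          (K * D * (indicator {0<..<1} u * ((1 - u) powr (b - 1) * u powr (b' - 1)))))"
        by (intro integrable_mult_right unit)
      show "norm (G (\<tau> n) u) \<le> B *
          (K * D * (indicator {0<..<1} u * ((1 - u) powr (b - 1) * u powr (b' - 1))))" for n u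
        using \<tau> B[of n] K D
        by (intro order_trans[OF normG] mult_right_mono) (auto intro!: mult_nonneg_nonneg)
      show "(\<lambda>n. G (\<tau> n) u) \<longlonglongrightarrow> G t u" for u
      proof (cases "u \<in> {0<..<1}")
        case True
        have "(\<lambda>n. V (\<tau> n * u)) \<longlonglongrightarrow> V (t * u)"
          using in01[OF _ True] \<tau> t
          by (intro continuous_on_tendsto_compose[OF V] tendsto_intros lim) auto
        then have "(\<lambda>n. (\<tau> n * (1 - u), V (\<tau> n * u))) \<longlonglongrightarrow> (t * (1 - u), V (t * u))"
          by (intro tendsto_intros lim)
        from continuous_on_tendsto_compose[OF jointly_continuous this]
        have "(\<lambda>n. T (\<tau> n * (1 - u)) (V (\<tau> n * u))) \<longlonglongrightarrow> T (t * (1 - u)) (V (t * u))"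
          using in01[OF _ True] \<tau> t by auto
        then show ?thesis
          unfolding G_def by (intro tendsto_intros lim)
      qed (simp add: G_def)
    qed (use smG t \<tau> in auto)
    then show "((\<lambda>t. Bochner_integral lborel (G t)) \<circ> \<tau>) \<longlonglongrightarrow> Bochner_integral lborel (G t)"
      by (simp add: comp_def)
  qed
  then show ?thesis
    by (subst continuous_on_cong[OF refl eq])
qed

end

end

section \<open>The perturbation series of operators\<close>

lemma op_chain_cong:
  "(\<And>k. k \<le> m \<Longrightarrow> \<sigma> k = \<tau> k) \<Longrightarrow> op_chain A \<sigma> m f = op_chain A \<tau> m f"
  by (induction m) auto

text \<open>
  The weight is the product of the norm bounds along a chain of operators. Splitting off the last time
  is convolution with one more factor \<open>K t\<^bsup>b-1\<^esup>\<close>.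
\<close>
lemma nn_integral_chain_weight:
  assumes K: "0 \<le> K" and b: "0 < b" and t: "0 < t"
  shows "(\<integral>\<^sup>+s\<in>time_simplex n t.
      ennreal (\<Prod>k\<le>n. K * (with_ends n 0 t s (Suc k) - with_ends n 0 t s k) powr (b - 1))
      \<partial>PiM {1..n} (\<lambda>_. lborel)) =
    ennreal (conv_power_const K b n * t powr (real (Suc n) * b - 1))"
  using t
proof (induction n arbitrary: t)
  case 0
  then show ?case
    by (simp add: time_simplex_0 PiM_empty nn_integral_count_space_finite)
next
  case (Suc n)
  let ?g = "\<lambda>s. ennreal (\<Prod>k\<le>Suc n. K *
    (with_ends (Suc n) 0 t s (Suc k) - with_ends (Suc n) 0 t s k) powr (b - 1))"
  let ?h = "\<lambda>\<sigma> s. ennreal (\<Prod>k\<le>n. K * (with_ends n 0 \<sigma> s (Suc k) - with_ends n 0 \<sigma> s k) powr (b - 1))"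
  have [measurable]: "?g \<in> borel_measurable (PiM {1..Suc n} (\<lambda>_. lborel))"
    by (intro measurable_compose[OF _ measurable_ennreal] borel_measurable_prod borel_measurable_times
        borel_measurable_const powr_real_measurable borel_measurable_diff with_ends_measurable measurable_ident) auto
  have [measurable]: "?h \<sigma> \<in> borel_measurable (PiM {1..n} (\<lambda>_. lborel))" for \<sigma>
    by (intro measurable_compose[OF _ measurable_ennreal] borel_measurable_prod borel_measurable_times
        borel_measurable_const powr_real_measurable borel_measurable_diff with_ends_measurable measurable_ident) auto
  have g: "?g (s(Suc n := \<sigma>)) = ennreal (K * (t - \<sigma>) powr (b - 1)) * ?h \<sigma> s" for s \<sigma>
    using K by (simp add: with_ends_upd prod_nonneg ennreal_mult' mult.commute)
  have "(\<integral>\<^sup>+s\<in>time_simplex (Suc n) t. ?g s \<partial>PiM {1..Suc n} (\<lambda>_. lborel)) =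
      (\<integral>\<^sup>+\<sigma>\<in>{0<..<t}. (\<integral>\<^sup>+s\<in>time_simplex n \<sigma>. ennreal (K * (t - \<sigma>) powr (b - 1)) * ?h \<sigma> s
        \<partial>PiM {1..n} (\<lambda>_. lborel)) \<partial>lborel)"
    by (simp only: nn_integral_time_simplex_Suc[OF \<open>?g \<in> _\<close>] g)
  also have "\<dots> = (\<integral>\<^sup>+\<sigma>\<in>{0<..<t}. ennreal (K * (t - \<sigma>) powr (b - 1)) *
      ennreal (conv_power_const K b n * \<sigma> powr (real (Suc n) * b - 1)) \<partial>lborel)"
  proof (rule nn_integral_cong)
    fix \<sigma>
    show "(\<integral>\<^sup>+s\<in>time_simplex n \<sigma>. ennreal (K * (t - \<sigma>) powr (b - 1)) * ?h \<sigma> s \<partial>PiM {1..n} (\<lambda>_. lborel)) *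
        indicator {0<..<t} \<sigma> = ennreal (K * (t - \<sigma>) powr (b - 1)) *
        ennreal (conv_power_const K b n * \<sigma> powr (real (Suc n) * b - 1)) * indicator {0<..<t} \<sigma>"
    proof (cases "\<sigma> \<in> {0<..<t}")
      case True
      have "(\<lambda>s. ?h \<sigma> s * indicator (time_simplex n \<sigma>) s) \<in> borel_measurable (PiM {1..n} (\<lambda>_. lborel))"
        by measurable
      from nn_integral_cmult[OF this, of "ennreal (K * (t - \<sigma>) powr (b - 1))"] Suc.IH[of \<sigma>] True
      show ?thesis by (simp add: mult.assoc)
    qed simp
  qed
  also have "\<dots> = ennreal (K * Beta b (real (Suc n) * b) * conv_power_const K b n *
      t powr (b + real (Suc n) * b - 1))"
    using b by (intro nn_integral_convolution_step K conv_power_const_nonneg Suc.prems) auto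
  also have "b + real (Suc n) * b - 1 = real (Suc (Suc n)) * b - 1"
    by (simp add: algebra_simps)
  finally show ?case by simp
qed

context singular_operators
begin

abbreviation conv_norm :: "nat \<Rightarrow> real" where
  "conv_norm \<equiv> conv_power_const K b"

lemma conv_norm_nonneg: "0 \<le> conv_norm n"
  by (rule conv_power_const_nonneg[OF K b])

text \<open>
  Each operator of the chain is one application of \<open>strongly_measurable_parametrized\<close>, the time being
  an increment of the simplex point. The indicator stays inside the induction because the increments
  lie in \<open>{0<..1}\<close> only on the simplex.
\<close>
lemma strongly_measurable_op_chain:
  assumes t: "t \<in> {0<..1}" and m: "m \<le> Suc n"
  shows "strongly_measurable (PiM {1..n} (\<lambda>_. lborel))
    (\<lambda>s. indicator (time_simplex n t) s *\<^sub>R op_chain T (with_ends n 0 t s) m f)"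
  using m
proof (induction m)
  let ?M = "PiM {1..n} (\<lambda>_. lborel) :: (nat \<Rightarrow> real) measure"
  define A where "A = {s \<in> space ?M. s \<in> time_simplex n t}"
  have A [measurable]: "A \<in> sets ?M"
    unfolding A_def by measurable
  have ind: "indicator A s = (indicator (time_simplex n t) s :: real)" if "s \<in> space ?M" for s
    using that by (simp add: A_def indicator_def)
  {
    case 0
    have "continuous_on ({0<..1} \<times> UNIV) (\<lambda>(_ :: real, g :: 'a bborel). g)"
      unfolding case_prod_beta by (intro continuous_intros)
    then have "strongly_measurable ?M (\<lambda>s. indicator A s *\<^sub>R f)"
      by (rule strongly_measurable_parametrized[where T = "\<lambda>_ g. g" and g = "\<lambda>_. f" and u = "\<lambda>_. 1"])
         (simp_all only: strongly_measurable_const borel_measurable_const A, simp)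
    then show ?case
      by (rule strongly_measurable_cong[THEN iffD1, rotated]) (simp add: ind)
  next
    case (Suc m)
    have "strongly_measurable ?M (\<lambda>s. indicator A s *\<^sub>R T (with_ends n 0 t s (Suc m) - with_ends n 0 t s m)
        (indicator (time_simplex n t) s *\<^sub>R op_chain T (with_ends n 0 t s) m f))"
    proof (rule strongly_measurable_parametrized[OF jointly_continuous Suc.IH])
      show "m \<le> Suc n" using Suc.prems by simp
      show "(\<lambda>s. with_ends n 0 t s (Suc m) - with_ends n 0 t s m) \<in> borel_measurable ?M"
        using Suc.prems
        by (intro borel_measurable_diff with_ends_measurable measurable_ident borel_measurable_const) auto
      fix s assume "s \<in> A"
      then show "with_ends n 0 t s (Suc m) - with_ends n 0 t s m \<in> {0<..1}"
        using time_simplex_increment[of s n t m] Suc.prems t by (auto simp: A_def)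
    qed (rule A)
    then show ?case
      by (rule strongly_measurable_cong[THEN iffD1, rotated]) (auto simp: A_def indicator_def)
  }
qed

lemma norm_op_chain_le:
  assumes s: "s \<in> time_simplex n t" and t: "t \<in> {0<..1}" and m: "m \<le> Suc n"
  shows "norm (op_chain T (with_ends n 0 t s) m f) \<le>
    (\<Prod>k<m. K * (with_ends n 0 t s (Suc k) - with_ends n 0 t s k) powr (b - 1)) * norm f"
  using m
proof (induction m)
  case (Suc m)
  let ?\<delta> = "with_ends n 0 t s (Suc m) - with_ends n 0 t s m"
  have "?\<delta> \<in> {0<..1}"
    using time_simplex_increment[OF s, of m] Suc.prems t by auto
  then have "norm (op_chain T (with_ends n 0 t s) (Suc m) f) \<le>
      K * ?\<delta> powr (b - 1) * norm (op_chain T (with_ends n 0 t s) m f)"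
    using norm_le by simp
  also have "\<dots> \<le> K * ?\<delta> powr (b - 1) *
      ((\<Prod>k<m. K * (with_ends n 0 t s (Suc k) - with_ends n 0 t s k) powr (b - 1)) * norm f)"
    using K Suc.prems by (intro mult_left_mono Suc.IH) auto
  finally show ?case by (simp add: mult_ac)
qed simp

lemma nn_integral_norm_op_chain_le:
  assumes t: "t \<in> {0<..1}"
  shows "(\<integral>\<^sup>+s. ennreal (norm (indicator (time_simplex n t) s *\<^sub>R
      op_chain T (with_ends n 0 t s) (Suc n) f)) \<partial>PiM {1..n} (\<lambda>_. lborel)) \<le>
    ennreal (conv_norm n * t powr (real (Suc n) * b - 1) * norm f)"
proof -
  let ?w = "\<lambda>s. \<Prod>k\<le>n. K * (with_ends n 0 t s (Suc k) - with_ends n 0 t s k) powr (b - 1)"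
  have "(\<integral>\<^sup>+s. ennreal (norm (indicator (time_simplex n t) s *\<^sub>R
      op_chain T (with_ends n 0 t s) (Suc n) f)) \<partial>PiM {1..n} (\<lambda>_. lborel)) \<le>
    (\<integral>\<^sup>+s. ennreal (?w s) * indicator (time_simplex n t) s * ennreal (norm f) \<partial>PiM {1..n} (\<lambda>_. lborel))"
  proof (rule nn_integral_mono)
    fix s
    show "ennreal (norm (indicator (time_simplex n t) s *\<^sub>R op_chain T (with_ends n 0 t s) (Suc n) f)) \<le>
        ennreal (?w s) * indicator (time_simplex n t) s * ennreal (norm f)"
      using norm_op_chain_le[OF _ t, of s n "Suc n" f] K
      by (auto simp: indicator_def lessThan_Suc_atMost ennreal_mult''[symmetric] simp del: op_chain.simps
          intro!: ennreal_leI)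
  qed
  also have "\<dots> = (\<integral>\<^sup>+s\<in>time_simplex n t. ennreal (?w s) \<partial>PiM {1..n} (\<lambda>_. lborel)) * ennreal (norm f)"
  proof (rule nn_integral_multc)
    have [measurable]: "(\<lambda>s. ennreal (?w s)) \<in> borel_measurable (PiM {1..n} (\<lambda>_. lborel))"
      by (intro measurable_compose[OF _ measurable_ennreal] borel_measurable_prod borel_measurable_times
          borel_measurable_const powr_real_measurable borel_measurable_diff with_ends_measurable measurable_ident) auto
    show "(\<lambda>s. ennreal (?w s) * indicator (time_simplex n t) s) \<in> borel_measurable (PiM {1..n} (\<lambda>_. lborel))"
      by measurable
  qed
  also have "\<dots> = ennreal (conv_norm n * t powr (real (Suc n) * b - 1)) * ennreal (norm f)"
    using t by (subst nn_integral_chain_weight[OF K b]) auto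
  also have "\<dots> = ennreal (conv_norm n * t powr (real (Suc n) * b - 1) * norm f)"
    by (simp add: ennreal_mult'' )
  finally show ?thesis .
qed

lemma
  assumes t: "t \<in> {0<..1}"
  shows norm_Q_iter_le_powr: "norm (Q_iter T n t f) \<le> conv_norm n * t powr (real (Suc n) * b - 1) * norm f"
    and Q_iter_bounded_linear: "\<And>L. bounded_linear (L :: 'a bborel \<Rightarrow> real) \<Longrightarrow>
      integrable (PiM {1..n} (\<lambda>_. lborel))
        (\<lambda>s. indicator (time_simplex n t) s * L (op_chain T (with_ends n 0 t s) (Suc n) f)) \<and>
      L (Q_iter T n t f) = (LINT s|PiM {1..n} (\<lambda>_. lborel).
        indicator (time_simplex n t) s * L (op_chain T (with_ends n 0 t s) (Suc n) f))"
proof -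
  have sm: "strongly_measurable (PiM {1..n} (\<lambda>_. lborel))
      (\<lambda>s. indicator (time_simplex n t) s *\<^sub>R op_chain T (with_ends n 0 t s) (Suc n) f)"
    by (rule strongly_measurable_op_chain[OF t]) simp
  show "norm (Q_iter T n t f) \<le> conv_norm n * t powr (real (Suc n) * b - 1) * norm f"
    unfolding Q_iter_def set_Bochner_integral_def
    by (rule norm_Bochner_integral_le[OF sm nn_integral_norm_op_chain_le[OF t]])
       (simp add: conv_norm_nonneg)
  have fin: "(\<integral>\<^sup>+s. ennreal (norm (indicator (time_simplex n t) s *\<^sub>R
      op_chain T (with_ends n 0 t s) (Suc n) f)) \<partial>PiM {1..n} (\<lambda>_. lborel)) < \<infinity>"
    using nn_integral_norm_op_chain_le[OF t, of n f] by (auto simp: order_le_less_trans)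
  fix L :: "'a bborel \<Rightarrow> real" assume L: "bounded_linear L"
  have scale: "L (c *\<^sub>R g) = c * L g" for c g
    using L by (simp add: bounded_linear.linear linear_scale)
  show "integrable (PiM {1..n} (\<lambda>_. lborel))
        (\<lambda>s. indicator (time_simplex n t) s * L (op_chain T (with_ends n 0 t s) (Suc n) f)) \<and>
      L (Q_iter T n t f) = (LINT s|PiM {1..n} (\<lambda>_. lborel).
        indicator (time_simplex n t) s * L (op_chain T (with_ends n 0 t s) (Suc n) f))"
    using integrable_bounded_linear_strongly_measurable[OF sm fin L]
      bounded_linear_Bochner_integral[OF sm fin L]
    unfolding scale Q_iter_def set_Bochner_integral_def by simp
qed

lemma Q_iter_0: "t \<in> {0<..1} \<Longrightarrow> Q_iter T 0 t f = T t f"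
  using Q_iter_bounded_linear[where n = 0 and f = f and t = t, OF _ bounded_linear_apply_bborel]
  by (simp add: apply_bborel_inject[symmetric] fun_eq_iff time_simplex_0
      PiM_empty lebesgue_integral_count_space_finite)

lemma norm_Q_iter_le:
  assumes t: "t \<in> {0<..1}"
  shows "norm (Q_iter T n t f) \<le> conv_norm n * t powr (b - 1) * norm f"
proof -
  have "1 * b \<le> real (Suc n) * b"
    using b by (intro mult_right_mono) auto
  then have "t powr (real (Suc n) * b - 1) \<le> t powr (b - 1)"
    using t by (intro powr_mono') auto
  then have "conv_norm n * t powr (real (Suc n) * b - 1) * norm f \<le> conv_norm n * t powr (b - 1) * norm f"
    using conv_norm_nonneg by (intro mult_right_mono mult_left_mono) auto
  then show ?thesis
    using norm_Q_iter_le_powr[OF t, of n f] by linarith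
qed

text \<open>
  Both sides are compared at a point \<open>x\<close>, where they are real integrals. After the last time \<open>\<sigma>\<close> is
  split off, the inner integral runs over \<open>apply_bborel (T (t - \<sigma>) \<cdot>) x\<close>, itself a bounded linear
  functional, so the integral can be moved inside it. Continuity of the previous iterate guarantees
  that the Bochner integral on the right exists.
\<close>
lemma Q_iter_Suc_if_continuous:
  assumes cont: "continuous_on {0<..1} (\<lambda>t. Q_iter T n t f)" and t: "t \<in> {0<..1}"
  shows "Q_iter T (Suc n) t f =
    set_Bochner_integral lborel {0<..<t} (\<lambda>s. T (t - s) (Q_iter T n s f))"
proof -
  have "apply_bborel (Q_iter T (Suc n) t f) x =
      apply_bborel (set_Bochner_integral lborel {0<..<t} (\<lambda>s. T (t - s) (Q_iter T n s f))) x" for x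
  proof -
    let ?A = "\<lambda>g. apply_bborel g x"
    note Q = Q_iter_bounded_linear[OF t bounded_linear_apply_bborel[of x], of "Suc n" f]
    have chain: "op_chain T (with_ends (Suc n) 0 t (s(Suc n := \<sigma>))) (Suc (Suc n)) f =
        T (t - \<sigma>) (op_chain T (with_ends n 0 \<sigma> s) (Suc n) f)" for s \<sigma>
      using op_chain_cong[of "Suc n" "with_ends (Suc n) 0 t (s(Suc n := \<sigma>))" "with_ends n 0 \<sigma> s" T f]
      by (simp add: with_ends_upd)
    have "?A (Q_iter T (Suc n) t f) = (LINT \<sigma>:{0<..<t}|lborel. LINT s|PiM {1..n} (\<lambda>_. lborel).
        indicator (time_simplex n \<sigma>) s * ?A (T (t - \<sigma>) (op_chain T (with_ends n 0 \<sigma> s) (Suc n) f)))"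
      using integral_time_simplex_Suc[OF conjunct1[OF Q]] conjunct2[OF Q] by (simp only: chain)
    also have "\<dots> = (LINT \<sigma>:{0<..<t}|lborel. ?A (T (t - \<sigma>) (Q_iter T n \<sigma> f)))"
      unfolding set_lebesgue_integral_def
    proof (intro Bochner_Integration.integral_cong refl)
      fix \<sigma>
      show "indicator {0<..<t} \<sigma> *\<^sub>R (LINT s|PiM {1..n} (\<lambda>_. lborel).
          indicator (time_simplex n \<sigma>) s * ?A (T (t - \<sigma>) (op_chain T (with_ends n 0 \<sigma> s) (Suc n) f))) =
        indicator {0<..<t} \<sigma> *\<^sub>R ?A (T (t - \<sigma>) (Q_iter T n \<sigma> f))"
      proof (cases "\<sigma> \<in> {0<..<t}")
        case True
        then have "\<sigma> \<in> {0<..1}" "t - \<sigma> \<in> {0<..1}"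
          using t by auto
        then show ?thesis
          using Q_iter_bounded_linear[where t = \<sigma> and n = n and f = f, OF _ bounded_linear_apply] by simp
      qed simp
    qed
    also have "\<dots> = ?A (set_Bochner_integral lborel {0<..<t} (\<lambda>s. T (t - s) (Q_iter T n s f)))"
    proof (rule apply_convolution[symmetric, OF cont _ b _ t])
      show "0 \<le> conv_norm n * norm f"
        by (simp add: conv_norm_nonneg)
      show "norm (Q_iter T n s f) \<le> conv_norm n * norm f * s powr (b - 1)" if "s \<in> {0<..1}" for s
        using norm_Q_iter_le[OF that, of n f] by (simp add: mult_ac)
    qed
    finally show ?thesis .
  qed
  then show ?thesis
    by (simp add: apply_bborel_inject[symmetric] fun_eq_iff)
qed

lemma continuous_on_Q_iter: "continuous_on {0<..1} (\<lambda>t. Q_iter T n t f)"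
proof (induction n)
  case 0
  show ?case
    using continuous_on_time by (subst continuous_on_cong[OF refl Q_iter_0])
next
  case (Suc n)
  have "continuous_on {0<..1} (\<lambda>t. set_Bochner_integral lborel {0<..<t} (\<lambda>s. T (t - s) (Q_iter T n s f)))"
  proof (rule continuous_on_convolution[OF Suc.IH _ b])
    show "0 \<le> conv_norm n * norm f"
      by (simp add: conv_norm_nonneg)
    show "norm (Q_iter T n s f) \<le> conv_norm n * norm f * s powr (b - 1)" if "s \<in> {0<..1}" for s
      using norm_Q_iter_le[OF that, of n f] by (simp add: mult_ac)
  qed
  then show ?case
    by (subst continuous_on_cong[OF refl Q_iter_Suc_if_continuous[OF Suc.IH]])
qed

lemma apply_Q_iter_Suc:
  assumes t: "t \<in> {0<..1}"
  shows "apply_bborel (Q_iter T (Suc n) t f) x =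
    (LINT s:{0<..<t}|lborel. apply_bborel (T (t - s) (Q_iter T n s f)) x)"
  unfolding Q_iter_Suc_if_continuous[OF continuous_on_Q_iter t]
proof (rule apply_convolution[OF continuous_on_Q_iter _ b _ t])
  show "0 \<le> conv_norm n * norm f"
    by (simp add: conv_norm_nonneg)
  show "norm (Q_iter T n s f) \<le> conv_norm n * norm f * s powr (b - 1)" if "s \<in> {0<..1}" for s
    using norm_Q_iter_le[OF that, of n f] by (simp add: mult_ac)
qed

lemma
  assumes t: "t \<in> {0<..1}"
  shows summable_norm_Q_iter: "summable (\<lambda>n. norm (Q_iter T n t f))"
    and Q_op_eq_suminf: "Q_op T t f = (\<Sum>n. Q_iter T n t f)"
    and norm_Q_op_le: "norm (Q_op T t f) \<le> suminf conv_norm * t powr (b - 1) * norm f"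
proof -
  have s: "summable (\<lambda>n. conv_norm n * t powr (b - 1) * norm f)"
    by (intro summable_mult2 summable_conv_power_const K b)
  show sn: "summable (\<lambda>n. norm (Q_iter T n t f))"
    by (rule summable_comparison_test'[OF s]) (use norm_Q_iter_le[OF t] in auto)
  then have "summable (\<lambda>n. Q_iter T n t f)"
    by (rule summable_norm_cancel)
  from suminf_split_head[OF this]
  show eq: "Q_op T t f = (\<Sum>n. Q_iter T n t f)"
    by (simp add: Q_op_def Q_iter_0[OF t])
  have "norm (\<Sum>n. Q_iter T n t f) \<le> (\<Sum>n. norm (Q_iter T n t f))"
    by (rule summable_norm[OF sn])
  also have "\<dots> \<le> (\<Sum>n. conv_norm n * t powr (b - 1) * norm f)"
    by (rule suminf_le[OF _ sn s]) (rule norm_Q_iter_le[OF t])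
  also have "\<dots> = suminf conv_norm * t powr (b - 1) * norm f"
    using summable_conv_power_const[OF K b] by (simp add: suminf_mult2[symmetric] summable_mult2)
  finally show "norm (Q_op T t f) \<le> suminf conv_norm * t powr (b - 1) * norm f"
    unfolding eq .
qed

lemma suminf_conv_norm_nonneg: "0 \<le> suminf conv_norm"
  by (intro suminf_nonneg summable_conv_power_const K b conv_norm_nonneg)

lemma apply_Q_op:
  assumes t: "t \<in> {0<..1}"
  shows "apply_bborel (Q_op T t f) x = (\<Sum>n. apply_bborel (Q_iter T n t f) x)"
  unfolding Q_op_eq_suminf[OF t]
  by (rule bounded_linear.suminf[OF bounded_linear_apply_bborel
        summable_norm_cancel[OF summable_norm_Q_iter[OF t]]])

text \<open>
  The bounds on \<open>Q_iter T n t f\<close> may blow up like \<open>t\<^bsup>b-1\<^esup>\<close> at 0. After multiplication by \<open>t\<^bsup>1-b\<^esup>\<close> the series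
  satisfies the Weierstrass test uniformly on all of \<open>{0<..1}\<close>.
\<close>
lemma continuous_on_Q_op: "continuous_on {0<..1} (\<lambda>t. Q_op T t f)"
proof -
  let ?g = "\<lambda>n t. t powr (1 - b) *\<^sub>R Q_iter T n t f"
  have "uniform_limit {0<..1} (\<lambda>n t. \<Sum>i<n. ?g i t) (\<lambda>t. \<Sum>i. ?g i t) sequentially"
  proof (rule Weierstrass_m_test)
    show "norm (?g n t) \<le> conv_norm n * norm f" if t: "t \<in> {0<..1}" for n t
    proof -
      have "norm (?g n t) \<le> t powr (1 - b) * (conv_norm n * t powr (b - 1) * norm f)"
        using norm_Q_iter_le[OF t, of n f] by (auto intro!: mult_left_mono)
      also have "\<dots> = (t powr (1 - b) * t powr (b - 1)) * (conv_norm n * norm f)"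
        by (simp add: mult_ac)
      also have "t powr (1 - b) * t powr (b - 1) = 1"
        using t by (simp add: powr_add[symmetric])
      finally show ?thesis by simp
    qed
    show "summable (\<lambda>n. conv_norm n * norm f)"
      by (intro summable_mult2 summable_conv_power_const K b)
  qed
  then have "continuous_on {0<..1} (\<lambda>t. \<Sum>i. ?g i t)"
    by (rule uniform_limit_theorem[rotated])
       (auto intro!: always_eventually continuous_intros continuous_on_Q_iter)
  then have "continuous_on {0<..1} (\<lambda>t. t powr (b - 1) *\<^sub>R (\<Sum>i. ?g i t))"
    by (intro continuous_intros) auto
  moreover have "t powr (b - 1) *\<^sub>R (\<Sum>i. ?g i t) = Q_op T t f" if t: "t \<in> {0<..1}" for t
  proof -
    have "(\<Sum>i. ?g i t) = t powr (1 - b) *\<^sub>R Q_op T t f"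
      unfolding Q_op_eq_suminf[OF t]
      by (rule bounded_linear.suminf[symmetric, OF bounded_linear_scaleR_right
            summable_norm_cancel[OF summable_norm_Q_iter[OF t]]])
    then show ?thesis
      using t by (simp add: powr_add[symmetric])
  qed
  ultimately show ?thesis
    by (subst (asm) continuous_on_cong[OF refl]) auto
qed

end

section \<open>Iterated kernels\<close>

abbreviation kernel_measurable :: "(real \<Rightarrow> 'a::euclidean_space \<Rightarrow> 'a \<Rightarrow> 'b::topological_space) \<Rightarrow> bool" where
  "kernel_measurable k \<equiv> (\<lambda>(t, x, y). k t x y) \<in> borel_measurable (borel \<Otimes>\<^sub>M borel \<Otimes>\<^sub>M borel)"

lemma kernel_measurable_compose:
  assumes "kernel_measurable k" "f \<in> borel_measurable M" "g \<in> borel_measurable M" "h \<in> borel_measurable M"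
  shows "(\<lambda>w. k (f w) (g w) (h w)) \<in> borel_measurable M"
proof -
  have "(\<lambda>w. (f w, g w, h w)) \<in> measurable M (borel \<Otimes>\<^sub>M borel \<Otimes>\<^sub>M borel)"
    using assms by measurable
  from measurable_compose[OF this assms(1)] show ?thesis by simp
qed

lemma pred_in_greaterThanLessThan [measurable (raw)]:
  fixes f a b :: "'m \<Rightarrow> real"
  assumes [measurable]: "f \<in> borel_measurable M" "a \<in> borel_measurable M" "b \<in> borel_measurable M"
  shows "Measurable.pred M (\<lambda>x. f x \<in> {a x<..<b x})"
  unfolding greaterThanLessThan_iff by measurable

text \<open>
  The iterates of the kernel \<open>|q|\<close>. They take values in \<open>ennreal\<close>, so that they exist without any
  convergence condition; at times in \<open>{0<..1}\<close> they are finite exactly on \<open>S_iter\<close>, and they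
  dominate \<open>q_iter\<close>.
\<close>
primrec abs_iter ::
    "(real \<Rightarrow> 'a \<Rightarrow> 'a \<Rightarrow> real) \<Rightarrow> nat \<Rightarrow> real \<Rightarrow> 'a \<Rightarrow> 'a::euclidean_space \<Rightarrow> ennreal" where
  "abs_iter q 0 t x y = ennreal \<bar>q t x y\<bar>"
| "abs_iter q (Suc n) t x y =
     (\<integral>\<^sup>+s\<in>{0<..<t}. (\<integral>\<^sup>+z. ennreal \<bar>q (t - s) x z\<bar> * abs_iter q n s z y \<partial>lborel) \<partial>lborel)"

lemma kernel_measurable_abs_iter:
  assumes q: "kernel_measurable q"
  shows "kernel_measurable (abs_iter q n)"
proof (induction n)
  case 0
  note [measurable (raw)] = kernel_measurable_compose[OF q]
  show ?case
    unfolding abs_iter.simps case_prod_beta by measurable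
next
  case (Suc n)
  note [measurable (raw)] = kernel_measurable_compose[OF q] kernel_measurable_compose[OF Suc]
  show ?case
    unfolding abs_iter.simps case_prod_beta by measurable
qed

definition kernel_chain ::
    "(real \<Rightarrow> 'a \<Rightarrow> 'a \<Rightarrow> real) \<Rightarrow> nat \<Rightarrow> real \<Rightarrow> 'a \<Rightarrow> 'a::euclidean_space \<Rightarrow>
      (nat \<Rightarrow> real) \<Rightarrow> (nat \<Rightarrow> 'a) \<Rightarrow> ennreal" where
  "kernel_chain q n t x y s z =
    ennreal \<bar>\<Prod>k\<le>n. q (with_ends n 0 t s (Suc k) - with_ends n 0 t s k)
      (with_ends n y x z (Suc k)) (with_ends n y x z k)\<bar>"

lemma kernel_chain_Suc:
  "kernel_chain q (Suc n) t x y (s(Suc n := \<sigma>)) (z(Suc n := \<zeta>)) =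
    ennreal \<bar>q (t - \<sigma>) x \<zeta>\<bar> * kernel_chain q n \<sigma> \<zeta> y s z"
  by (simp add: kernel_chain_def with_ends_upd abs_mult ennreal_mult mult.commute)

lemma kernel_chain_measurable:
  assumes q: "kernel_measurable q"
    and "t \<in> borel_measurable M" "x \<in> borel_measurable M" "y \<in> borel_measurable M"
    and "s \<in> measurable M (PiM {1..n} (\<lambda>_. lborel))" "z \<in> measurable M (PiM {1..n} (\<lambda>_. lborel))"
  shows "(\<lambda>w. kernel_chain q n (t w) (x w) (y w) (s w) (z w)) \<in> borel_measurable M"
  unfolding kernel_chain_def
  by (intro measurable_compose[OF _ measurable_ennreal] borel_measurable_abs borel_measurable_prod
      kernel_measurable_compose[OF q] borel_measurable_diff with_ends_measurable borel_measurable_const)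
     (use assms in auto)

text \<open>
  The integral over the simplex and over all intermediate points agrees with the recursively
  defined iterate: the last time \<open>\<sigma>\<close> and the last point \<open>\<zeta>\<close> are split off, the product loses its
  factor \<open>q (t - \<sigma>) x \<zeta>\<close>, and Tonelli's theorem moves the integral over \<open>\<zeta>\<close> to the front.
\<close>
lemma nn_integral_kernel_chain:
  assumes q: "kernel_measurable q" and t: "0 < t"
  shows "(\<integral>\<^sup>+s\<in>time_simplex n t. (\<integral>\<^sup>+z. kernel_chain q n t x y s z \<partial>PiM {1..n} (\<lambda>_. lborel))
      \<partial>PiM {1..n} (\<lambda>_. lborel)) = abs_iter q n t x y"
  using t
proof (induction n arbitrary: t x)
  case 0
  then show ?case
    by (simp add: time_simplex_0 PiM_empty nn_integral_count_space_finite kernel_chain_def)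
next
  case (Suc n)
  note [measurable (raw)] = kernel_measurable_compose[OF q] kernel_chain_measurable[OF q]
  let ?S = "PiM {1..n} (\<lambda>_. lborel) :: (nat \<Rightarrow> real) measure"
  let ?Z = "PiM {1..n} (\<lambda>_. lborel) :: (nat \<Rightarrow> 'a) measure"
  interpret S: sigma_finite_measure ?S by (rule lborel_product.sigma_finite) simp
  interpret Z: sigma_finite_measure ?Z by (rule lborel_product.sigma_finite) simp
  interpret Z': sigma_finite_measure "PiM {1..Suc n} (\<lambda>_. lborel) :: (nat \<Rightarrow> 'a) measure"
    by (rule lborel_product.sigma_finite) simp
  interpret LS: pair_sigma_finite "lborel :: 'a measure" ?S ..
  have "(\<integral>\<^sup>+s\<in>time_simplex (Suc n) t. (\<integral>\<^sup>+z. kernel_chain q (Suc n) t x y s z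
        \<partial>PiM {1..Suc n} (\<lambda>_. lborel)) \<partial>PiM {1..Suc n} (\<lambda>_. lborel)) =
      (\<integral>\<^sup>+\<sigma>\<in>{0<..<t}. (\<integral>\<^sup>+s\<in>time_simplex n \<sigma>. (\<integral>\<^sup>+z. kernel_chain q (Suc n) t x y (s(Suc n := \<sigma>)) z
        \<partial>PiM {1..Suc n} (\<lambda>_. lborel)) \<partial>?S) \<partial>lborel)"
    by (rule nn_integral_time_simplex_Suc) measurable
  also have "\<dots> = (\<integral>\<^sup>+\<sigma>\<in>{0<..<t}. (\<integral>\<^sup>+\<zeta>. ennreal \<bar>q (t - \<sigma>) x \<zeta>\<bar> * abs_iter q n \<sigma> \<zeta> y \<partial>lborel) \<partial>lborel)"
  proof (rule nn_integral_cong)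
    fix \<sigma> :: real
    have "(\<integral>\<^sup>+s\<in>time_simplex n \<sigma>. (\<integral>\<^sup>+z. kernel_chain q (Suc n) t x y (s(Suc n := \<sigma>)) z
          \<partial>PiM {1..Suc n} (\<lambda>_. lborel)) \<partial>?S) =
        (\<integral>\<^sup>+\<zeta>. ennreal \<bar>q (t - \<sigma>) x \<zeta>\<bar> * abs_iter q n \<sigma> \<zeta> y \<partial>lborel)" if \<sigma>: "0 < \<sigma>"
    proof -
      have "(\<integral>\<^sup>+s\<in>time_simplex n \<sigma>. (\<integral>\<^sup>+z. kernel_chain q (Suc n) t x y (s(Suc n := \<sigma>)) z
            \<partial>PiM {1..Suc n} (\<lambda>_. lborel)) \<partial>?S) =
          (\<integral>\<^sup>+s. (\<integral>\<^sup>+\<zeta>. (\<integral>\<^sup>+z. ennreal \<bar>q (t - \<sigma>) x \<zeta>\<bar> * kernel_chain q n \<sigma> \<zeta> y s z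
            \<partial>?Z) * indicator (time_simplex n \<sigma>) s \<partial>lborel) \<partial>?S)"
      proof (rule nn_integral_cong)
        fix s assume s [measurable]: "s \<in> space ?S"
        have "(\<integral>\<^sup>+z. kernel_chain q (Suc n) t x y (s(Suc n := \<sigma>)) z \<partial>PiM {1..Suc n} (\<lambda>_. lborel)) =
            (\<integral>\<^sup>+\<zeta>. (\<integral>\<^sup>+z. kernel_chain q (Suc n) t x y (s(Suc n := \<sigma>)) (z(Suc n := \<zeta>)) \<partial>?Z) \<partial>lborel)"
          by (rule nn_integral_PiM_Suc) measurable
        also have "\<dots> = (\<integral>\<^sup>+\<zeta>. (\<integral>\<^sup>+z. ennreal \<bar>q (t - \<sigma>) x \<zeta>\<bar> * kernel_chain q n \<sigma> \<zeta> y s z \<partial>?Z) \<partial>lborel)"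
          by (simp only: kernel_chain_Suc)
        also have "\<dots> * indicator (time_simplex n \<sigma>) s =
            (\<integral>\<^sup>+\<zeta>. (\<integral>\<^sup>+z. ennreal \<bar>q (t - \<sigma>) x \<zeta>\<bar> * kernel_chain q n \<sigma> \<zeta> y s z \<partial>?Z) *
              indicator (time_simplex n \<sigma>) s \<partial>lborel)"
          by (rule nn_integral_multc[symmetric]) measurable
        finally show "(\<integral>\<^sup>+z. kernel_chain q (Suc n) t x y (s(Suc n := \<sigma>)) z \<partial>PiM {1..Suc n} (\<lambda>_. lborel)) *
            indicator (time_simplex n \<sigma>) s = \<dots>" .
      qed
      also have "\<dots> = (\<integral>\<^sup>+\<zeta>. (\<integral>\<^sup>+s. (\<integral>\<^sup>+z. ennreal \<bar>q (t - \<sigma>) x \<zeta>\<bar> * kernel_chain q n \<sigma> \<zeta> y s z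
            \<partial>?Z) * indicator (time_simplex n \<sigma>) s \<partial>?S) \<partial>lborel)"
        by (rule LS.Fubini') measurable
      also have "\<dots> = (\<integral>\<^sup>+\<zeta>. ennreal \<bar>q (t - \<sigma>) x \<zeta>\<bar> * abs_iter q n \<sigma> \<zeta> y \<partial>lborel)"
      proof (rule nn_integral_cong)
        fix \<zeta> :: 'a
        have "(\<integral>\<^sup>+s. (\<integral>\<^sup>+z. ennreal \<bar>q (t - \<sigma>) x \<zeta>\<bar> * kernel_chain q n \<sigma> \<zeta> y s z \<partial>?Z) *
              indicator (time_simplex n \<sigma>) s \<partial>?S) =
            (\<integral>\<^sup>+s. ennreal \<bar>q (t - \<sigma>) x \<zeta>\<bar> * ((\<integral>\<^sup>+z. kernel_chain q n \<sigma> \<zeta> y s z \<partial>?Z) *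
              indicator (time_simplex n \<sigma>) s) \<partial>?S)"
        proof (rule nn_integral_cong)
          fix s assume s [measurable]: "s \<in> space ?S"
          have "(\<integral>\<^sup>+z. ennreal \<bar>q (t - \<sigma>) x \<zeta>\<bar> * kernel_chain q n \<sigma> \<zeta> y s z \<partial>?Z) =
              ennreal \<bar>q (t - \<sigma>) x \<zeta>\<bar> * (\<integral>\<^sup>+z. kernel_chain q n \<sigma> \<zeta> y s z \<partial>?Z)"
            by (rule nn_integral_cmult) measurable
          then show "(\<integral>\<^sup>+z. ennreal \<bar>q (t - \<sigma>) x \<zeta>\<bar> * kernel_chain q n \<sigma> \<zeta> y s z \<partial>?Z) *
              indicator (time_simplex n \<sigma>) s =
            ennreal \<bar>q (t - \<sigma>) x \<zeta>\<bar> * ((\<integral>\<^sup>+z. kernel_chain q n \<sigma> \<zeta> y s z \<partial>?Z) *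
              indicator (time_simplex n \<sigma>) s)"
            by (simp only: mult.assoc)
        qed
        also have "\<dots> = ennreal \<bar>q (t - \<sigma>) x \<zeta>\<bar> * (\<integral>\<^sup>+s\<in>time_simplex n \<sigma>.
            (\<integral>\<^sup>+z. kernel_chain q n \<sigma> \<zeta> y s z \<partial>?Z) \<partial>?S)"
          by (rule nn_integral_cmult) measurable
        finally show "(\<integral>\<^sup>+s. (\<integral>\<^sup>+z. ennreal \<bar>q (t - \<sigma>) x \<zeta>\<bar> * kernel_chain q n \<sigma> \<zeta> y s z \<partial>?Z) *
              indicator (time_simplex n \<sigma>) s \<partial>?S) =
            ennreal \<bar>q (t - \<sigma>) x \<zeta>\<bar> * abs_iter q n \<sigma> \<zeta> y"
          unfolding Suc.IH[OF \<sigma>] .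
      qed
      finally show ?thesis .
    qed
    then show "(\<integral>\<^sup>+s\<in>time_simplex n \<sigma>. (\<integral>\<^sup>+z. kernel_chain q (Suc n) t x y (s(Suc n := \<sigma>)) z
          \<partial>PiM {1..Suc n} (\<lambda>_. lborel)) \<partial>?S) * indicator {0<..<t} \<sigma> =
        (\<integral>\<^sup>+\<zeta>. ennreal \<bar>q (t - \<sigma>) x \<zeta>\<bar> * abs_iter q n \<sigma> \<zeta> y \<partial>lborel) * indicator {0<..<t} \<sigma>"
      by (cases "\<sigma> \<in> {0<..<t}") (simp_all only: greaterThanLessThan_iff simp_thms indicator_simps mult_zero_right)
  qed
  finally show ?case by simp
qed

lemma S_iter_iff:
  assumes "kernel_measurable q"
  shows "(t, x, y) \<in> S_iter q n \<longleftrightarrow> t \<in> {0<..1} \<and> abs_iter q n t x y < \<infinity>"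
  using nn_integral_kernel_chain[OF assms, of t n x y]
  unfolding S_iter_def kernel_chain_def by auto

lemma abs_q_iter_le: "ennreal \<bar>q_iter q n t x y\<bar> \<le> abs_iter q n t x y"
proof (induction n arbitrary: t x)
  case (Suc n)
  have "ennreal \<bar>q_iter q (Suc n) t x y\<bar> \<le>
      (\<integral>\<^sup>+s. ennreal \<bar>indicator {0<..<t} s * (LINT z|lborel.
        indicator (S_iter q (Suc n)) (t, x, y) * q (t - s) x z * q_iter q n s z y)\<bar> \<partial>lborel)"
    unfolding q_iter.simps set_lebesgue_integral_def real_scaleR_def by (rule abs_integral_le_nn_integral)
  also have "\<dots> \<le> abs_iter q (Suc n) t x y"
    unfolding abs_iter.simps
  proof (rule nn_integral_mono)
    fix s
    have "ennreal \<bar>LINT z|lborel. indicator (S_iter q (Suc n)) (t, x, y) * q (t - s) x z * q_iter q n s z y\<bar> \<le>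
        (\<integral>\<^sup>+z. ennreal \<bar>indicator (S_iter q (Suc n)) (t, x, y) * q (t - s) x z * q_iter q n s z y\<bar> \<partial>lborel)"
      by (rule abs_integral_le_nn_integral)
    also have "\<dots> \<le> (\<integral>\<^sup>+z. ennreal \<bar>q (t - s) x z\<bar> * abs_iter q n s z y \<partial>lborel)"
    proof (rule nn_integral_mono)
      fix z
      have "ennreal \<bar>indicator (S_iter q (Suc n)) (t, x, y) * q (t - s) x z * q_iter q n s z y\<bar> \<le>
          ennreal \<bar>q (t - s) x z\<bar> * ennreal \<bar>q_iter q n s z y\<bar>"
        by (simp add: indicator_def abs_mult ennreal_mult[symmetric])
      also have "\<dots> \<le> ennreal \<bar>q (t - s) x z\<bar> * abs_iter q n s z y"
        by (intro mult_left_mono Suc.IH) auto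
      finally show "ennreal \<bar>indicator (S_iter q (Suc n)) (t, x, y) * q (t - s) x z * q_iter q n s z y\<bar> \<le>
          ennreal \<bar>q (t - s) x z\<bar> * abs_iter q n s z y" .
    qed
    finally show "ennreal \<bar>indicator {0<..<t} s * (LINT z|lborel.
        indicator (S_iter q (Suc n)) (t, x, y) * q (t - s) x z * q_iter q n s z y)\<bar> \<le>
        (\<integral>\<^sup>+z. ennreal \<bar>q (t - s) x z\<bar> * abs_iter q n s z y \<partial>lborel) * indicator {0<..<t} s"
      by (simp add: indicator_def)
  qed
  finally show ?case .
qed simp

lemma kernel_measurable_q_iter:
  assumes q: "kernel_measurable q"
  shows "kernel_measurable (q_iter q n)"
proof (induction n)
  case 0
  then show ?case using q by simp
next
  case (Suc n)
  note [measurable (raw)] = kernel_measurable_compose[OF q] kernel_measurable_compose[OF Suc]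
    kernel_measurable_compose[OF kernel_measurable_abs_iter[OF q]]
  have ind: "indicator (S_iter q (Suc n)) (t, x, y) =
      (if 0 < t \<and> t \<le> 1 \<and> abs_iter q (Suc n) t x y < \<infinity> then 1 else 0 :: real)" for t x y
    by (simp add: indicator_def S_iter_iff[OF q] del: abs_iter.simps)
  show ?case
    unfolding q_iter.simps set_lebesgue_integral_def case_prod_beta ind real_scaleR_def
    by measurable
qed

text \<open>
  Absolute summability is expressed through the measurable function \<open>\<Sum>\<^sub>n |q_iter q n t x y|\<close> with
  values in \<open>ennreal\<close>.
\<close>
lemma kernel_measurable_q_kernel:
  assumes q: "kernel_measurable q"
  shows "kernel_measurable (q_kernel q)"
proof -
  note [measurable (raw)] = kernel_measurable_compose[OF kernel_measurable_q_iter[OF q]]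
  have ind: "indicator (S_q q) (t, x, y) =
      (if 0 < t \<and> t \<le> 1 \<and> (\<Sum>n. ennreal \<bar>q_iter q n t x y\<bar>) < \<infinity> then 1 else 0 :: real)" for t x y
  proof -
    have "summable (\<lambda>n. \<bar>q_iter q n t x y\<bar>) \<longleftrightarrow> (\<Sum>n. ennreal \<bar>q_iter q n t x y\<bar>) < \<infinity>"
    proof
      assume "summable (\<lambda>n. \<bar>q_iter q n t x y\<bar>)"
      then show "(\<Sum>n. ennreal \<bar>q_iter q n t x y\<bar>) < \<infinity>"
        by (subst suminf_ennreal2) auto
    next
      assume "(\<Sum>n. ennreal \<bar>q_iter q n t x y\<bar>) < \<infinity>"
      then show "summable (\<lambda>n. \<bar>q_iter q n t x y\<bar>)"
        by (intro summable_suminf_not_top) auto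
    qed
    then show ?thesis
      by (simp add: indicator_def S_q_def)
  qed
  show ?thesis
    unfolding q_kernel_def case_prod_beta ind
  proof (rule borel_measurable_suminf)
    have [measurable]: "(\<lambda>w. \<Sum>n. ennreal \<bar>q_iter q n (fst w) (fst (snd w)) (snd (snd w))\<bar>)
        \<in> borel_measurable (borel \<Otimes>\<^sub>M borel \<Otimes>\<^sub>M borel)"
      by (rule borel_measurable_suminf_order) measurable
    show "(\<lambda>w. (if 0 < fst w \<and> fst w \<le> 1 \<and>
        (\<Sum>n. ennreal \<bar>q_iter q n (fst w) (fst (snd w)) (snd (snd w))\<bar>) < \<infinity> then 1 else 0) *
        q_iter q i (fst w) (fst (snd w)) (snd (snd w))) \<in> borel_measurable (borel \<Otimes>\<^sub>M borel \<Otimes>\<^sub>M borel)" for i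
      by measurable
  qed
qed

lemma abs_q_kernel_le: "ennreal \<bar>q_kernel q t x y\<bar> \<le> (\<Sum>n. abs_iter q n t x y)"
proof (cases "(t, x, y) \<in> S_q q")
  case True
  then have s: "summable (\<lambda>n. \<bar>q_iter q n t x y\<bar>)"
    by (simp add: S_q_def)
  have "\<bar>q_kernel q t x y\<bar> \<le> (\<Sum>n. \<bar>q_iter q n t x y\<bar>)"
    using True by (simp add: q_kernel_def summable_rabs[OF s])
  then have "ennreal \<bar>q_kernel q t x y\<bar> \<le> (\<Sum>n. ennreal \<bar>q_iter q n t x y\<bar>)"
    by (subst suminf_ennreal2) (use s in \<open>auto intro: ennreal_leI\<close>)
  also have "\<dots> \<le> (\<Sum>n. abs_iter q n t x y)"
    by (intro suminf_le abs_q_iter_le) auto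
  finally show ?thesis .
qed (simp add: q_kernel_def)

section \<open>Convolution of kernels\<close>

lemma integral_kernel_composition:
  fixes A :: "'w::euclidean_space \<Rightarrow> real" and B :: "'w \<Rightarrow> 'y::euclidean_space \<Rightarrow> real"
  assumes [measurable]: "A \<in> borel_measurable borel"
      "(\<lambda>(w, y). B w y) \<in> borel_measurable (borel \<Otimes>\<^sub>M borel)" "f \<in> borel_measurable borel"
    and f_le: "\<And>y. \<bar>f y\<bar> \<le> C"
    and fin: "(\<integral>\<^sup>+w. ennreal \<bar>A w\<bar> * (\<integral>\<^sup>+y. ennreal \<bar>B w y\<bar> \<partial>lborel) \<partial>lborel) < \<infinity>"
  shows "integrable lborel (\<lambda>w. A w * (LINT y|lborel. B w y * f y))"
    and "integrable lborel (\<lambda>y. (LINT w|lborel. A w * B w y) * f y)"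
    and "(LINT w|lborel. A w * (LINT y|lborel. B w y * f y)) =
      (LINT y|lborel. (LINT w|lborel. A w * B w y) * f y)"
proof -
  have C: "0 \<le> C" using f_le[of undefined] by linarith
  have int: "integrable (lborel \<Otimes>\<^sub>M lborel) (\<lambda>(w, y). A w * B w y * f y)"
  proof (rule integrableI_bounded)
    have "(\<integral>\<^sup>+p. ennreal (norm (case p of (w, y) \<Rightarrow> A w * B w y * f y)) \<partial>(lborel \<Otimes>\<^sub>M lborel)) =
        (\<integral>\<^sup>+w. \<integral>\<^sup>+y. ennreal (norm (A w * B w y * f y)) \<partial>lborel \<partial>lborel)"
      by (subst lborel.nn_integral_fst[symmetric]) (auto intro: measurable_compose[OF _ measurable_ennreal])
    also have "\<dots> \<le> (\<integral>\<^sup>+w. \<integral>\<^sup>+y. ennreal C * (ennreal \<bar>A w\<bar> * ennreal \<bar>B w y\<bar>) \<partial>lborel \<partial>lborel)"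
    proof (intro nn_integral_mono)
      fix w y
      have "norm (A w * B w y * f y) \<le> C * (\<bar>A w\<bar> * \<bar>B w y\<bar>)"
        using mult_left_mono[OF f_le[of y], of "\<bar>A w\<bar> * \<bar>B w y\<bar>"] by (simp add: abs_mult mult_ac)
      then show "ennreal (norm (A w * B w y * f y)) \<le> ennreal C * (ennreal \<bar>A w\<bar> * ennreal \<bar>B w y\<bar>)"
        using C by (simp add: ennreal_mult[symmetric] ennreal_leI)
    qed
    also have "\<dots> = ennreal C * (\<integral>\<^sup>+w. ennreal \<bar>A w\<bar> * (\<integral>\<^sup>+y. ennreal \<bar>B w y\<bar> \<partial>lborel) \<partial>lborel)"
      by (simp add: nn_integral_cmult)
    also have "\<dots> < \<infinity>"
      using fin by (simp add: ennreal_mult_less_top)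
    finally show "(\<integral>\<^sup>+p. ennreal (norm (case p of (w, y) \<Rightarrow> A w * B w y * f y)) \<partial>(lborel \<Otimes>\<^sub>M lborel)) < \<infinity>" .
  qed measurable
  have L: "A w * (LINT y|lborel. B w y * f y) = (LINT y|lborel. A w * B w y * f y)" for w
    by (simp add: mult.assoc)
  show "integrable lborel (\<lambda>w. A w * (LINT y|lborel. B w y * f y))"
    unfolding L using lborel_pair.integrable_fst[OF int] by simp
  show "integrable lborel (\<lambda>y. (LINT w|lborel. A w * B w y) * f y)"
    using lborel_pair.integrable_snd[OF int] by simp
  show "(LINT w|lborel. A w * (LINT y|lborel. B w y * f y)) =
      (LINT y|lborel. (LINT w|lborel. A w * B w y) * f y)"
    unfolding L using lborel_pair.Fubini_integral[OF int] by simp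
qed

text \<open>
  Time and space variable form one point \<open>w = (s, z)\<close> of a product space, so that absolute
  convergence of the double integral is plain integrability on that space.
\<close>
definition conv_integrand ::
    "(real \<Rightarrow> 'a \<Rightarrow> 'a \<Rightarrow> real) \<Rightarrow> (real \<Rightarrow> 'a \<Rightarrow> 'a \<Rightarrow> real) \<Rightarrow> real \<Rightarrow> 'a \<Rightarrow> 'a::euclidean_space \<Rightarrow>
      real \<times> 'a \<Rightarrow> real" where
  "conv_integrand k B t x y w =
    indicator {0<..<t} (fst w) * k (t - fst w) x (snd w) * B (fst w) (snd w) y"

lemma nn_integral_lborel_prod:
  fixes f :: "'u::euclidean_space \<times> 'v::euclidean_space \<Rightarrow> ennreal"
  assumes "f \<in> borel_measurable (borel \<Otimes>\<^sub>M borel)"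
  shows "(\<integral>\<^sup>+w. f w \<partial>lborel) = (\<integral>\<^sup>+s. \<integral>\<^sup>+z. f (s, z) \<partial>lborel \<partial>lborel)"
  using assms by (simp add: lborel_prod[symmetric] lborel.nn_integral_fst)

lemma LINT_conv_integrand:
  assumes "integrable lborel (conv_integrand k B t x y)"
  shows "(LINT s:{0<..<t}|lborel. LINT z|lborel. k (t - s) x z * B s z y) =
    (LINT w|lborel. conv_integrand k B t x y w)"
proof -
  have "integrable (lborel \<Otimes>\<^sub>M lborel) (conv_integrand k B t x y)"
    using assms by (simp add: lborel_prod)
  from lborel_pair.integral_fst'[OF this]
  have "(LINT s|lborel. LINT z|lborel. conv_integrand k B t x y (s, z)) =
      (LINT w|lborel. conv_integrand k B t x y w)"
    by (simp add: lborel_prod)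
  moreover have "conv_integrand k B t x y (s, z) = indicator {0<..<t} s * (k (t - s) x z * B s z y)" for s z
    by (simp add: conv_integrand_def)
  ultimately show ?thesis
    by (simp add: set_lebesgue_integral_def)
qed

text \<open>
  The kernel is assumed Borel on the whole space. Kernels given for times in \<open>{0<..1}\<close> are extended by
  zero.
\<close>
locale kernel_operators = singular_operators T K b
  for T :: "real \<Rightarrow> 'a::euclidean_space bborel \<Rightarrow> 'a bborel" and K b :: real +
  fixes k :: "real \<Rightarrow> 'a \<Rightarrow> 'a \<Rightarrow> real"
  assumes k_measurable: "kernel_measurable k"
    and kernel: "t \<in> {0<..1} \<Longrightarrow> integrable lborel (\<lambda>y. k t x y * apply_bborel f y) \<and>
      apply_bborel (T t f) x = (LINT y|lborel. k t x y * apply_bborel f y)"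
begin

text \<open>
  The bounded Borel function \<open>f = sgn (k t x \<cdot>)\<close> has norm at most 1 and \<open>T t f x = \<integral>|k t x y| dy\<close>.
\<close>
lemma nn_integral_abs_kernel_le:
  assumes t: "t \<in> {0<..1}"
  shows "(\<integral>\<^sup>+y. ennreal \<bar>k t x y\<bar> \<partial>lborel) \<le> ennreal (K * t powr (b - 1))"
proof -
  note [measurable (raw)] = kernel_measurable_compose[OF k_measurable]
  define f where "f = Bborel (\<lambda>y. sgn (k t x y))"
  have f: "apply_bborel f y = sgn (k t x y)" for y
    unfolding f_def by (subst Bborel_inverse) (auto intro!: boundedI[where B = 1] simp: sgn_real_def)
  have "k t x y * sgn (k t x y) = \<bar>k t x y\<bar>" for y
    by (simp add: abs_sgn)
  then have int: "integrable lborel (\<lambda>y. \<bar>k t x y\<bar>)"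
    and eq: "apply_bborel (T t f) x = (LINT y|lborel. \<bar>k t x y\<bar>)"
    using kernel[OF t, of x f] by (simp_all add: f)
  have "norm f \<le> 1"
    by (rule norm_bborel_le) (simp add: f sgn_real_def)
  then have "K * t powr (b - 1) * norm f \<le> K * t powr (b - 1) * 1"
    using K by (intro mult_left_mono) auto
  then have "(LINT y|lborel. \<bar>k t x y\<bar>) \<le> K * t powr (b - 1)"
    using norm_le[OF t, of f] abs_apply_bborel_le_norm[of "T t f" x] eq by simp
  then show ?thesis
    using int by (simp add: nn_integral_eq_integral ennreal_leI)
qed

lemma nn_integral_convolution_le:
  fixes B :: "real \<Rightarrow> 'a \<Rightarrow> 'y::euclidean_space \<Rightarrow> ennreal"
  assumes D: "0 \<le> D" and b': "0 < b'" and t: "t \<in> {0<..1}"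
    and B_le: "\<And>s z. s \<in> {0<..1} \<Longrightarrow> (\<integral>\<^sup>+y. B s z y \<partial>lborel) \<le> ennreal (D * s powr (b' - 1))"
  shows "(\<integral>\<^sup>+s\<in>{0<..<t}. (\<integral>\<^sup>+z. ennreal \<bar>k (t - s) x z\<bar> * (\<integral>\<^sup>+y. B s z y \<partial>lborel) \<partial>lborel) \<partial>lborel) \<le>
    ennreal (K * Beta b b' * D * t powr (b + b' - 1))"
proof -
  note [measurable (raw)] = kernel_measurable_compose[OF k_measurable]
  have "(\<integral>\<^sup>+s\<in>{0<..<t}. (\<integral>\<^sup>+z. ennreal \<bar>k (t - s) x z\<bar> * (\<integral>\<^sup>+y. B s z y \<partial>lborel) \<partial>lborel) \<partial>lborel) \<le>
      (\<integral>\<^sup>+s\<in>{0<..<t}. ennreal (K * (t - s) powr (b - 1)) * ennreal (D * s powr (b' - 1)) \<partial>lborel)"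
  proof (rule nn_integral_mono)
    fix s
    show "(\<integral>\<^sup>+z. ennreal \<bar>k (t - s) x z\<bar> * (\<integral>\<^sup>+y. B s z y \<partial>lborel) \<partial>lborel) * indicator {0<..<t} s \<le>
        ennreal (K * (t - s) powr (b - 1)) * ennreal (D * s powr (b' - 1)) * indicator {0<..<t} s"
    proof (cases "s \<in> {0<..<t}")
      case True
      then have s: "s \<in> {0<..1}" "t - s \<in> {0<..1}"
        using t by auto
      have "(\<integral>\<^sup>+z. ennreal \<bar>k (t - s) x z\<bar> * (\<integral>\<^sup>+y. B s z y \<partial>lborel) \<partial>lborel) \<le>
          (\<integral>\<^sup>+z. ennreal \<bar>k (t - s) x z\<bar> * ennreal (D * s powr (b' - 1)) \<partial>lborel)"
        by (intro nn_integral_mono mult_left_mono B_le s) auto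
      also have "\<dots> = (\<integral>\<^sup>+z. ennreal \<bar>k (t - s) x z\<bar> \<partial>lborel) * ennreal (D * s powr (b' - 1))"
        by (rule nn_integral_multc) measurable
      also have "\<dots> \<le> ennreal (K * (t - s) powr (b - 1)) * ennreal (D * s powr (b' - 1))"
        by (intro mult_right_mono nn_integral_abs_kernel_le s) auto
      finally show ?thesis using True by simp
    qed simp
  qed
  also have "\<dots> = ennreal (K * Beta b b' * D * t powr (b + b' - 1))"
    using t by (intro nn_integral_convolution_step K D b b') auto
  finally show ?thesis .
qed

context
  fixes B :: "real \<Rightarrow> 'a \<Rightarrow> 'a \<Rightarrow> real" and D b' t :: real
  assumes B: "kernel_measurable B" and D: "0 \<le> D" and b': "0 < b'" and t: "t \<in> {0<..1}"
    and B_le: "\<And>s z. s \<in> {0<..1} \<Longrightarrow> (\<integral>\<^sup>+y. ennreal \<bar>B s z y\<bar> \<partial>lborel) \<le> ennreal (D * s powr (b' - 1))"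
begin

lemma nn_integral_conv_integrand_le:
  "(\<integral>\<^sup>+y. (\<integral>\<^sup>+w. ennreal \<bar>conv_integrand k B t x y w\<bar> \<partial>lborel) \<partial>lborel) \<le>
    ennreal (K * Beta b b' * D * t powr (b + b' - 1))"
proof -
  note [measurable (raw)] = kernel_measurable_compose[OF k_measurable] kernel_measurable_compose[OF B]
  have "(\<integral>\<^sup>+y. (\<integral>\<^sup>+w. ennreal \<bar>conv_integrand k B t x y w\<bar> \<partial>lborel) \<partial>lborel) =
      (\<integral>\<^sup>+w. (\<integral>\<^sup>+y. ennreal \<bar>conv_integrand k B t x y w\<bar> \<partial>lborel) \<partial>lborel)"
    by (rule lborel_pair.Fubini'[symmetric])
       (simp add: conv_integrand_def lborel_prod[symmetric] case_prod_beta)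
  also have "\<dots> = (\<integral>\<^sup>+s. \<integral>\<^sup>+z. \<integral>\<^sup>+y. ennreal \<bar>conv_integrand k B t x y (s, z)\<bar> \<partial>lborel \<partial>lborel \<partial>lborel)"
    by (rule nn_integral_lborel_prod) (simp add: conv_integrand_def)
  also have "\<dots> = (\<integral>\<^sup>+s\<in>{0<..<t}. (\<integral>\<^sup>+z. ennreal \<bar>k (t - s) x z\<bar> * (\<integral>\<^sup>+y. ennreal \<bar>B s z y\<bar> \<partial>lborel) \<partial>lborel) \<partial>lborel)"
    by (intro nn_integral_cong)
       (auto simp: conv_integrand_def indicator_def abs_mult ennreal_mult nn_integral_cmult)
  also have "\<dots> \<le> ennreal (K * Beta b b' * D * t powr (b + b' - 1))"
    by (rule nn_integral_convolution_le[OF D b' t B_le])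
  finally show ?thesis .
qed

lemma AE_nn_integral_conv_integrand:
  "AE y in lborel. (\<integral>\<^sup>+w. ennreal \<bar>conv_integrand k B t x y w\<bar> \<partial>lborel) < \<infinity>"
proof -
  note [measurable (raw)] = kernel_measurable_compose[OF k_measurable] kernel_measurable_compose[OF B]
  have [measurable]: "(\<lambda>y. \<integral>\<^sup>+w. ennreal \<bar>conv_integrand k B t x y w\<bar> \<partial>lborel) \<in> borel_measurable lborel"
    unfolding conv_integrand_def lborel_prod[symmetric] by measurable
  have "(\<integral>\<^sup>+y. (\<integral>\<^sup>+w. ennreal \<bar>conv_integrand k B t x y w\<bar> \<partial>lborel) \<partial>lborel) \<noteq> \<infinity>"
    using nn_integral_conv_integrand_le[of x] by (auto simp: top_unique)
  from nn_integral_noteq_infinite[OF _ this] show ?thesis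
    by (simp add: less_top)
qed

text \<open>
  If \<open>V s f\<close> is represented by a kernel \<open>B s\<close>, then the convolution of \<open>T\<close> with \<open>V\<close> is represented by
  the convolution of the kernels. It serves twice: for the step from \<open>q_iter k n\<close> to
  \<open>q_iter k (Suc n)\<close>, and for the convolution of \<open>P0\<close> with the whole perturbation series.
\<close>
lemma convolution_kernel:
  assumes V: "\<And>s z. s \<in> {0<..1} \<Longrightarrow> apply_bborel (V s) z = (LINT y|lborel. B s z y * apply_bborel f y)"
  shows "integrable lborel (\<lambda>y. (LINT w|lborel. conv_integrand k B t x y w) * apply_bborel f y)"
    and "(LINT s:{0<..<t}|lborel. apply_bborel (T (t - s) (V s)) x) =
      (LINT y|lborel. (LINT w|lborel. conv_integrand k B t x y w) * apply_bborel f y)"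
proof -
  note [measurable (raw)] = kernel_measurable_compose[OF k_measurable] kernel_measurable_compose[OF B]
  define A where "A w = indicator {0<..<t} (fst w) * k (t - fst w) x (snd w)" for w
  have A [measurable]: "A \<in> borel_measurable borel"
    unfolding A_def borel_prod[symmetric] by measurable
  have B' [measurable]: "(\<lambda>(w, y). B (fst w) (snd w) y) \<in> borel_measurable (borel \<Otimes>\<^sub>M borel)"
    unfolding borel_prod[symmetric] case_prod_beta by measurable
  have f: "apply_bborel f \<in> borel_measurable borel" by measurable
  have "(\<integral>\<^sup>+w. ennreal \<bar>A w\<bar> * (\<integral>\<^sup>+y. ennreal \<bar>B (fst w) (snd w) y\<bar> \<partial>lborel) \<partial>lborel) =
      (\<integral>\<^sup>+s. \<integral>\<^sup>+z. ennreal \<bar>A (s, z)\<bar> * (\<integral>\<^sup>+y. ennreal \<bar>B s z y\<bar> \<partial>lborel) \<partial>lborel \<partial>lborel)"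
    by (subst nn_integral_lborel_prod) (simp_all add: borel_prod)
  also have "\<dots> = (\<integral>\<^sup>+s\<in>{0<..<t}. (\<integral>\<^sup>+z. ennreal \<bar>k (t - s) x z\<bar> * (\<integral>\<^sup>+y. ennreal \<bar>B s z y\<bar> \<partial>lborel) \<partial>lborel) \<partial>lborel)"
    by (intro nn_integral_cong) (auto simp: A_def indicator_def)
  also have "\<dots> \<le> ennreal (K * Beta b b' * D * t powr (b + b' - 1))"
    by (rule nn_integral_convolution_le[OF D b' t B_le])
  also have "\<dots> < \<infinity>" by simp
  finally have fin: "(\<integral>\<^sup>+w. ennreal \<bar>A w\<bar> * (\<integral>\<^sup>+y. ennreal \<bar>B (fst w) (snd w) y\<bar> \<partial>lborel) \<partial>lborel) < \<infinity>" .
  note comp = integral_kernel_composition[OF A B' f abs_apply_bborel_le_norm fin]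
  have AB: "A w * B (fst w) (snd w) y = conv_integrand k B t x y w" for w y
    by (simp add: A_def conv_integrand_def)
  show "integrable lborel (\<lambda>y. (LINT w|lborel. conv_integrand k B t x y w) * apply_bborel f y)"
    using comp(2) unfolding AB .
  have "(LINT s:{0<..<t}|lborel. apply_bborel (T (t - s) (V s)) x) =
      (LINT s|lborel. LINT z|lborel. A (s, z) * (LINT y|lborel. B s z y * apply_bborel f y))"
    unfolding set_lebesgue_integral_def
  proof (intro Bochner_Integration.integral_cong refl)
    fix s
    show "indicator {0<..<t} s *\<^sub>R apply_bborel (T (t - s) (V s)) x =
        (LINT z|lborel. A (s, z) * (LINT y|lborel. B s z y * apply_bborel f y))"
      using t kernel[of "t - s" x "V s"] V[of s] by (cases "s \<in> {0<..<t}") (auto simp: A_def)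
  qed
  also have "\<dots> = (LINT w|lborel. A w * (LINT y|lborel. B (fst w) (snd w) y * apply_bborel f y))"
    using lborel_pair.integral_fst'[of "\<lambda>w. A w * (LINT y|lborel. B (fst w) (snd w) y * apply_bborel f y)"]
      comp(1) by (simp add: lborel_prod)
  also have "\<dots> = (LINT y|lborel. (LINT w|lborel. conv_integrand k B t x y w) * apply_bborel f y)"
    using comp(3) unfolding AB .
  finally show "(LINT s:{0<..<t}|lborel. apply_bborel (T (t - s) (V s)) x) =
      (LINT y|lborel. (LINT w|lborel. conv_integrand k B t x y w) * apply_bborel f y)" .
qed

end

section \<open>The kernel of the perturbation series\<close>

lemma nn_integral_abs_iter_le:
  "t \<in> {0<..1} \<Longrightarrow>
    (\<integral>\<^sup>+y. abs_iter k n t x y \<partial>lborel) \<le> ennreal (conv_norm n * t powr (real (Suc n) * b - 1))"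
proof (induction n arbitrary: t x)
  case 0
  then show ?case
    using nn_integral_abs_kernel_le by simp
next
  case (Suc n)
  note [measurable (raw)] = kernel_measurable_compose[OF k_measurable]
    kernel_measurable_compose[OF kernel_measurable_abs_iter[OF k_measurable]]
  have "(\<integral>\<^sup>+y. abs_iter k (Suc n) t x y \<partial>lborel) =
      (\<integral>\<^sup>+s. (\<integral>\<^sup>+y. (\<integral>\<^sup>+z. ennreal \<bar>k (t - s) x z\<bar> * abs_iter k n s z y \<partial>lborel) * indicator {0<..<t} s \<partial>lborel) \<partial>lborel)"
    unfolding abs_iter.simps by (rule lborel_pair.Fubini') measurable
  also have "\<dots> = (\<integral>\<^sup>+s\<in>{0<..<t}. (\<integral>\<^sup>+z. ennreal \<bar>k (t - s) x z\<bar> * (\<integral>\<^sup>+y. abs_iter k n s z y \<partial>lborel) \<partial>lborel) \<partial>lborel)"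
  proof (rule nn_integral_cong)
    fix s
    have "(\<integral>\<^sup>+y. (\<integral>\<^sup>+z. ennreal \<bar>k (t - s) x z\<bar> * abs_iter k n s z y \<partial>lborel) \<partial>lborel) =
        (\<integral>\<^sup>+z. (\<integral>\<^sup>+y. ennreal \<bar>k (t - s) x z\<bar> * abs_iter k n s z y \<partial>lborel) \<partial>lborel)"
      by (rule lborel_pair.Fubini') measurable
    then show "(\<integral>\<^sup>+y. (\<integral>\<^sup>+z. ennreal \<bar>k (t - s) x z\<bar> * abs_iter k n s z y \<partial>lborel) * indicator {0<..<t} s \<partial>lborel) =
        (\<integral>\<^sup>+z. ennreal \<bar>k (t - s) x z\<bar> * (\<integral>\<^sup>+y. abs_iter k n s z y \<partial>lborel) \<partial>lborel) * indicator {0<..<t} s"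
      by (simp add: nn_integral_cmult nn_integral_multc)
  qed
  also have "\<dots> \<le> ennreal (K * Beta b (real (Suc n) * b) * conv_norm n * t powr (b + real (Suc n) * b - 1))"
    using b by (intro nn_integral_convolution_le conv_norm_nonneg Suc) auto
  also have "b + real (Suc n) * b - 1 = real (Suc (Suc n)) * b - 1"
    by (simp add: algebra_simps)
  finally show ?case by simp
qed

lemma nn_integral_abs_q_iter_le:
  assumes t: "t \<in> {0<..1}"
  shows "(\<integral>\<^sup>+y. ennreal \<bar>q_iter k n t x y\<bar> \<partial>lborel) \<le> ennreal (conv_norm n * t powr (real (Suc n) * b - 1))"
  by (rule order_trans[OF nn_integral_mono[OF abs_q_iter_le] nn_integral_abs_iter_le[OF t]])

lemma q_iter_Suc_eq_conv_integrand:
  assumes S: "(t, x, y) \<in> S_iter k (Suc n)"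
    and int: "integrable lborel (conv_integrand k (q_iter k n) t x y)"
  shows "q_iter k (Suc n) t x y = (LINT w|lborel. conv_integrand k (q_iter k n) t x y w)"
  using LINT_conv_integrand[OF int] S by simp

lemma AE_S_iter:
  assumes t: "t \<in> {0<..1}"
  shows "AE y in lborel. (t, x, y) \<in> S_iter k n"
proof -
  note [measurable (raw)] = kernel_measurable_compose[OF kernel_measurable_abs_iter[OF k_measurable]]
  have "(\<integral>\<^sup>+y. abs_iter k n t x y \<partial>lborel) \<noteq> \<infinity>"
    using nn_integral_abs_iter_le[OF t, of n x] by (auto simp: top_unique)
  from nn_integral_noteq_infinite[OF _ this]
  have "AE y in lborel. abs_iter k n t x y \<noteq> \<infinity>"
    by simp
  then show ?thesis
    by eventually_elim (simp add: S_iter_iff[OF k_measurable] less_top del: greaterThanAtMost_iff, rule t)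
qed

text \<open>
  For fixed \<open>t\<close> and \<open>x\<close> the indicator of \<open>S_iter\<close> in \<open>q_iter\<close> is 1 for almost every \<open>y\<close>, and the iterated
  integral equals the integral of \<open>conv_integrand\<close> for almost every \<open>y\<close>. Hence
  neither affects the integral against \<open>f\<close>.
\<close>
lemma apply_Q_iter:
  "t \<in> {0<..1} \<Longrightarrow> integrable lborel (\<lambda>y. q_iter k n t x y * apply_bborel f y) \<and>
    apply_bborel (Q_iter T n t f) x = (LINT y|lborel. q_iter k n t x y * apply_bborel f y)"
proof (induction n arbitrary: t x)
  case 0
  then show ?case
    using kernel[of t x f] by (simp add: Q_iter_0)
next
  case (Suc n)
  note q_meas = kernel_measurable_q_iter[OF k_measurable]
  note [measurable (raw)] = kernel_measurable_compose[OF q_meas]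
    kernel_measurable_compose[OF k_measurable]
  note t = Suc.prems
  have pos: "0 < real (Suc n) * b"
    using b by simp
  have AE_fin: "AE y in lborel. (\<integral>\<^sup>+w. ennreal \<bar>conv_integrand k (q_iter k n) t x y w\<bar> \<partial>lborel) < \<infinity>"
    by (rule AE_nn_integral_conv_integrand[OF q_meas conv_norm_nonneg pos t nn_integral_abs_q_iter_le])
  have AE: "AE y in lborel. q_iter k (Suc n) t x y * apply_bborel f y =
      (LINT w|lborel. conv_integrand k (q_iter k n) t x y w) * apply_bborel f y"
    using AE_S_iter[OF t, of x "Suc n"] AE_fin
  proof eventually_elim
    case (elim y)
    have "integrable lborel (conv_integrand k (q_iter k n) t x y)"
    proof (rule integrableI_bounded)
      show "conv_integrand k (q_iter k n) t x y \<in> borel_measurable lborel"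
        unfolding conv_integrand_def[abs_def] lborel_prod[symmetric] by measurable
      show "(\<integral>\<^sup>+w. ennreal (norm (conv_integrand k (q_iter k n) t x y w)) \<partial>lborel) < \<infinity>"
        using elim(2) by simp
    qed
    then show ?case
      using q_iter_Suc_eq_conv_integrand[OF elim(1)] by simp
  qed
  have V: "apply_bborel (Q_iter T n s f) z = (LINT y|lborel. q_iter k n s z y * apply_bborel f y)"
    if "s \<in> {0<..1}" for s z
    using Suc.IH[OF that] by blast
  have conv_int: "integrable lborel (\<lambda>y. (LINT w|lborel. conv_integrand k (q_iter k n) t x y w) * apply_bborel f y)"
    by (rule convolution_kernel(1)[OF q_meas conv_norm_nonneg pos t nn_integral_abs_q_iter_le V])
  have conv_eq: "(LINT s:{0<..<t}|lborel. apply_bborel (T (t - s) (Q_iter T n s f)) x) =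
      (LINT y|lborel. (LINT w|lborel. conv_integrand k (q_iter k n) t x y w) * apply_bborel f y)"
    by (rule convolution_kernel(2)[OF q_meas conv_norm_nonneg pos t nn_integral_abs_q_iter_le V])
  have m1: "(\<lambda>y. q_iter k (Suc n) t x y * apply_bborel f y) \<in> borel_measurable lborel"
    by (simp del: q_iter.simps)
  note m2 = borel_measurable_integrable[OF conv_int]
  have "integrable lborel (\<lambda>y. q_iter k (Suc n) t x y * apply_bborel f y)"
    by (rule integrable_cong_AE_imp[OF conv_int m1]) (use AE in \<open>eventually_elim, simp only:\<close>)
  moreover have "apply_bborel (Q_iter T (Suc n) t f) x =
      (LINT y|lborel. q_iter k (Suc n) t x y * apply_bborel f y)"
    unfolding apply_Q_iter_Suc[OF t] conv_eq by (rule integral_cong_AE[OF m1 m2 AE, symmetric])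
  ultimately show ?case ..
qed

lemma conv_norm_powr_le:
  assumes t: "t \<in> {0<..1}"
  shows "conv_norm n * t powr (real (Suc n) * b - 1) \<le> conv_norm n * t powr (b - 1)"
proof -
  have "1 * b \<le> real (Suc n) * b"
    using b by (intro mult_right_mono) auto
  then show ?thesis
    using t by (intro mult_left_mono conv_norm_nonneg powr_mono') auto
qed

lemma nn_integral_suminf_abs_iter_le:
  assumes t: "t \<in> {0<..1}"
  shows "(\<integral>\<^sup>+y. (\<Sum>n. abs_iter k n t x y) \<partial>lborel) \<le> ennreal (suminf conv_norm * t powr (b - 1))"
proof -
  note [measurable (raw)] = kernel_measurable_compose[OF kernel_measurable_abs_iter[OF k_measurable]]
  have sm: "summable (\<lambda>n. conv_norm n * t powr (b - 1))"
    by (intro summable_mult2 summable_conv_power_const K b)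
  have "(\<integral>\<^sup>+y. (\<Sum>n. abs_iter k n t x y) \<partial>lborel) = (\<Sum>n. \<integral>\<^sup>+y. abs_iter k n t x y \<partial>lborel)"
    by (rule nn_integral_suminf) measurable
  also have "\<dots> \<le> (\<Sum>n. ennreal (conv_norm n * t powr (b - 1)))"
    by (intro suminf_le order_trans[OF nn_integral_abs_iter_le[OF t]] ennreal_leI conv_norm_powr_le t) auto
  also have "\<dots> = ennreal (\<Sum>n. conv_norm n * t powr (b - 1))"
    by (intro suminf_ennreal2 sm mult_nonneg_nonneg conv_norm_nonneg) auto
  also have "(\<Sum>n. conv_norm n * t powr (b - 1)) = suminf conv_norm * t powr (b - 1)"
    using summable_conv_power_const[OF K b] by (rule suminf_mult2[symmetric])
  finally show ?thesis .
qed

lemma nn_integral_abs_q_kernel_le: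
  assumes t: "t \<in> {0<..1}"
  shows "(\<integral>\<^sup>+y. ennreal \<bar>q_kernel k t x y\<bar> \<partial>lborel) \<le> ennreal (suminf conv_norm * t powr (b - 1))"
  by (rule order_trans[OF nn_integral_mono[OF abs_q_kernel_le] nn_integral_suminf_abs_iter_le[OF t]])

lemma AE_S_q:
  assumes t: "t \<in> {0<..1}"
  shows "AE y in lborel. (t, x, y) \<in> S_q k"
proof -
  note [measurable (raw)] = kernel_measurable_compose[OF kernel_measurable_abs_iter[OF k_measurable]]
  have "(\<integral>\<^sup>+y. (\<Sum>n. abs_iter k n t x y) \<partial>lborel) \<noteq> \<infinity>"
    using nn_integral_suminf_abs_iter_le[OF t, of x] by (auto simp: top_unique)
  from nn_integral_noteq_infinite[OF _ this]
  have "AE y in lborel. (\<Sum>n. abs_iter k n t x y) \<noteq> \<infinity>"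
    by simp
  then show ?thesis
  proof eventually_elim
    case (elim y)
    have "(\<Sum>n. ennreal \<bar>q_iter k n t x y\<bar>) \<le> (\<Sum>n. abs_iter k n t x y)"
      by (intro suminf_le abs_q_iter_le) auto
    then have "(\<Sum>n. ennreal \<bar>q_iter k n t x y\<bar>) \<noteq> top"
      using elim by (auto simp: top_unique)
    then have "summable (\<lambda>n. \<bar>q_iter k n t x y\<bar>)"
      by (intro summable_suminf_not_top) auto
    then show ?case
      using t by (simp add: S_q_def)
  qed
qed

text \<open>
  The integrals \<open>\<integral>|q_iter k n t x y * f y| dy\<close> are at most \<open>c\<^sub>n t\<^bsup>b-1\<^esup> * norm f\<close>, hence summable, and the
  series may be integrated term by term.
\<close>
lemma apply_Q_op_kernel:
  assumes t: "t \<in> {0<..1}"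
  shows "apply_bborel (Q_op T t f) x = (LINT y|lborel. q_kernel k t x y * apply_bborel f y)"
proof -
  let ?g = "\<lambda>n y. q_iter k n t x y * apply_bborel f y"
  note [measurable (raw)] = kernel_measurable_compose[OF kernel_measurable_q_iter[OF k_measurable]]
    kernel_measurable_compose[OF kernel_measurable_q_kernel[OF k_measurable]]
  have int: "integrable lborel (?g n)" for n
    using apply_Q_iter[OF t] by blast
  have AE: "AE y in lborel. summable (\<lambda>n. norm (?g n y))"
    using AE_S_q[OF t, of x]
    by eventually_elim (auto simp: S_q_def abs_mult intro: summable_mult2)
  have sm: "summable (\<lambda>n. LINT y|lborel. norm (?g n y))"
  proof (rule summable_comparison_test')
    show "summable (\<lambda>n. conv_norm n * t powr (b - 1) * norm f)"
      by (intro summable_mult2 summable_conv_power_const K b)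
    show "norm (LINT y|lborel. norm (?g n y)) \<le> conv_norm n * t powr (b - 1) * norm f" for n
    proof -
      have "ennreal (LINT y|lborel. norm (?g n y)) = (\<integral>\<^sup>+y. ennreal (norm (?g n y)) \<partial>lborel)"
        by (rule nn_integral_eq_integral[symmetric]) (auto intro: integrable_norm int)
      also have "\<dots> \<le> (\<integral>\<^sup>+y. ennreal \<bar>q_iter k n t x y\<bar> * ennreal (norm f) \<partial>lborel)"
        by (intro nn_integral_mono)
           (auto simp: abs_mult ennreal_mult[symmetric] intro!: ennreal_leI mult_left_mono abs_apply_bborel_le_norm)
      also have "\<dots> = (\<integral>\<^sup>+y. ennreal \<bar>q_iter k n t x y\<bar> \<partial>lborel) * ennreal (norm f)"
        by (rule nn_integral_multc) measurable
      also have "\<dots> \<le> ennreal (conv_norm n * t powr (b - 1)) * ennreal (norm f)"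
        by (intro mult_right_mono
            order_trans[OF nn_integral_abs_q_iter_le[OF t] ennreal_leI[OF conv_norm_powr_le[OF t]]]) simp
      also have "\<dots> = ennreal (conv_norm n * t powr (b - 1) * norm f)"
        by (simp add: ennreal_mult'')
      finally show ?thesis
        using conv_norm_nonneg[of n] by (subst (asm) ennreal_le_iff) (auto intro: integral_nonneg_AE)
    qed
  qed
  have "apply_bborel (Q_op T t f) x = (\<Sum>n. LINT y|lborel. ?g n y)"
    unfolding apply_Q_op[OF t] using apply_Q_iter[OF t] by simp
  also have "\<dots> = (LINT y|lborel. (\<Sum>n. ?g n y))"
    by (rule integral_suminf[symmetric, OF int AE sm])
  also have "\<dots> = (LINT y|lborel. q_kernel k t x y * apply_bborel f y)"
  proof (rule integral_cong_AE)
    show "AE y in lborel. (\<Sum>n. ?g n y) = q_kernel k t x y * apply_bborel f y"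
      using AE_S_q[OF t, of x]
    proof eventually_elim
      case (elim y)
      then have "summable (\<lambda>n. q_iter k n t x y)"
        using summable_rabs_cancel[of "\<lambda>n. q_iter k n t x y"] by (simp add: S_q_def)
      then show ?case
        using elim by (simp add: q_kernel_def suminf_mult2)
    qed
  qed measurable
  finally show ?thesis .
qed

end

section \<open>The kernel of the perturbed operators\<close>

lemma S_iter_cong:
  assumes "\<And>t x y. t \<in> {0<..1} \<Longrightarrow> q t x y = q' t x y"
  shows "S_iter q n = S_iter q' n"
proof -
  have "(\<integral>\<^sup>+s\<in>time_simplex n t. (\<integral>\<^sup>+z. kernel_chain q n t x y s z \<partial>PiM {1..n} (\<lambda>_. lborel))
        \<partial>PiM {1..n} (\<lambda>_. lborel)) =
      (\<integral>\<^sup>+s\<in>time_simplex n t. (\<integral>\<^sup>+z. kernel_chain q' n t x y s z \<partial>PiM {1..n} (\<lambda>_. lborel))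
        \<partial>PiM {1..n} (\<lambda>_. lborel))" if t: "t \<in> {0<..1}" for t x y
  proof (rule nn_integral_cong)
    fix s
    have "kernel_chain q n t x y s z = kernel_chain q' n t x y s z" if s: "s \<in> time_simplex n t" for z
    proof -
      have "with_ends n 0 t s (Suc k) - with_ends n 0 t s k \<in> {0<..1}" if "k \<le> n" for k
        using time_simplex_increment[OF s that] t by auto
      then show ?thesis
        unfolding kernel_chain_def by (intro arg_cong[where f = "\<lambda>c. ennreal \<bar>c\<bar>"] prod.cong refl assms) simp
    qed
    then show "(\<integral>\<^sup>+z. kernel_chain q n t x y s z \<partial>PiM {1..n} (\<lambda>_. lborel)) * indicator (time_simplex n t) s =
        (\<integral>\<^sup>+z. kernel_chain q' n t x y s z \<partial>PiM {1..n} (\<lambda>_. lborel)) * indicator (time_simplex n t) s"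
      by (cases "s \<in> time_simplex n t") simp_all
  qed
  then show ?thesis
    unfolding S_iter_def kernel_chain_def by auto
qed

lemma q_iter_cong:
  assumes "\<And>t x y. t \<in> {0<..1} \<Longrightarrow> q t x y = q' t x y"
  shows "t \<in> {0<..1} \<Longrightarrow> q_iter q n t x y = q_iter q' n t x y"
proof (induction n arbitrary: t x)
  case 0
  then show ?case using assms by simp
next
  case (Suc n)
  have S: "S_iter q m = S_iter q' m" for m
    by (rule S_iter_cong) (rule assms)
  have "q (t - s) x z = q' (t - s) x z" "q_iter q n s z y = q_iter q' n s z y" if "s \<in> {0<..<t}" for s z
    using that Suc.prems by (auto intro!: assms Suc.IH)
  then show ?case
    unfolding q_iter.simps S set_lebesgue_integral_def
    by (intro Bochner_Integration.integral_cong refl) (auto simp: indicator_def)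
qed

text \<open>
  Only times in \<open>{0<..1}\<close> enter the definition of \<open>q_kernel\<close>, since all increments of a point of the
  simplex with end \<open>t \<le> 1\<close> are of this kind. This allows the extension by zero.
\<close>
lemma q_kernel_cong:
  assumes "\<And>t x y. t \<in> {0<..1} \<Longrightarrow> q t x y = q' t x y"
  shows "q_kernel q = q_kernel q'"
proof (intro ext)
  fix t x y
  have eq: "q_iter q n t x y = q_iter q' n t x y" if "t \<in> {0<..1}" for n t x y
    by (rule q_iter_cong[OF assms that])
  have "S_q q = S_q q'"
    using eq by (auto simp: S_q_def)
  then show "q_kernel q t x y = q_kernel q' t x y"
  proof (cases "t \<in> {0<..1}")
    case True
    then show ?thesis
      using eq \<open>S_q q = S_q q'\<close> by (simp add: q_kernel_def)
  next
    case False
    then have "(t, x, y) \<notin> S_q q" "(t, x, y) \<notin> S_q q'"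
      by (auto simp: S_q_def)
    then show ?thesis
      by (simp add: q_kernel_def)
  qed
qed

locale perturbed_operators =
  P: kernel_operators P0 C 1 p + Q: kernel_operators Q0 K b q
  for P0 Q0 :: "real \<Rightarrow> 'a::euclidean_space bborel \<Rightarrow> 'a bborel" and C K b :: real
    and p q :: "real \<Rightarrow> 'a \<Rightarrow> 'a \<Rightarrow> real"
begin

abbreviation total_norm :: real where
  "total_norm \<equiv> suminf Q.conv_norm"

abbreviation perturbation_integrand :: "real \<Rightarrow> 'a \<Rightarrow> 'a \<Rightarrow> real \<times> 'a \<Rightarrow> real" where
  "perturbation_integrand \<equiv> conv_integrand p (q_kernel q)"

lemmas q_kernel_meas = kernel_measurable_q_kernel[OF Q.k_measurable]

definition perturbation_domain :: "(real \<times> 'a \<times> 'a) set" where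
  "perturbation_domain = {(t, x, y). t \<in> {0<..1} \<and>
    (\<integral>\<^sup>+w. ennreal \<bar>perturbation_integrand t x y w\<bar> \<partial>lborel) < \<infinity>}"

definition perturbed_kernel :: "real \<Rightarrow> 'a \<Rightarrow> 'a \<Rightarrow> real" where
  "perturbed_kernel t x y = p t x y +
    indicator perturbation_domain (t, x, y) * (LINT w|lborel. perturbation_integrand t x y w)"

lemma kernel_measurable_perturbation_norm:
  "kernel_measurable (\<lambda>t x y. \<integral>\<^sup>+w. ennreal \<bar>perturbation_integrand t x y w\<bar> \<partial>lborel)"
proof -
  note [measurable (raw)] = kernel_measurable_compose[OF P.k_measurable] kernel_measurable_compose[OF q_kernel_meas]
  show ?thesis
    unfolding conv_integrand_def case_prod_beta lborel_prod[symmetric] by measurable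
qed

lemma kernel_measurable_perturbation:
  "kernel_measurable (\<lambda>t x y. LINT w|lborel. perturbation_integrand t x y w)"
proof -
  note [measurable (raw)] = kernel_measurable_compose[OF P.k_measurable] kernel_measurable_compose[OF q_kernel_meas]
  show ?thesis
    unfolding conv_integrand_def case_prod_beta lborel_prod[symmetric] by measurable
qed

lemma perturbation_domain_iff:
  "(t, x, y) \<in> perturbation_domain \<longleftrightarrow> (0 < t \<and> t \<le> 1) \<and>
    (\<integral>\<^sup>+w. ennreal \<bar>perturbation_integrand t x y w\<bar> \<partial>lborel) < \<infinity>"
  by (simp add: perturbation_domain_def)

lemma perturbation_domain_measurable:
  "perturbation_domain \<in> sets (borel \<Otimes>\<^sub>M borel \<Otimes>\<^sub>M borel)"
proof -
  note [measurable (raw)] = kernel_measurable_compose[OF kernel_measurable_perturbation_norm]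
  have "perturbation_domain = {w \<in> space (borel \<Otimes>\<^sub>M borel \<Otimes>\<^sub>M borel). (0 < fst w \<and> fst w \<le> 1) \<and>
      (\<integral>\<^sup>+v. ennreal \<bar>perturbation_integrand (fst w) (fst (snd w)) (snd (snd w)) v\<bar> \<partial>lborel) < \<infinity>}"
    by (auto simp: perturbation_domain_iff space_pair_measure)
  also have "\<dots> \<in> sets (borel \<Otimes>\<^sub>M borel \<Otimes>\<^sub>M borel)"
    by measurable
  finally show ?thesis .
qed

lemma kernel_measurable_perturbed_kernel: "kernel_measurable perturbed_kernel"
proof -
  note [measurable (raw)] = kernel_measurable_compose[OF kernel_measurable_perturbation]
    kernel_measurable_compose[OF P.k_measurable]
  note [measurable] = perturbation_domain_measurable
  show ?thesis
    unfolding perturbed_kernel_def case_prod_beta by measurable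
qed

lemma AE_perturbation_domain:
  assumes t: "t \<in> {0<..1}"
  shows "AE y in lborel. (t, x, y) \<in> perturbation_domain"
proof -
  have "AE y in lborel. (\<integral>\<^sup>+w. ennreal \<bar>perturbation_integrand t x y w\<bar> \<partial>lborel) < \<infinity>"
    by (rule P.AE_nn_integral_conv_integrand[OF q_kernel_meas Q.suminf_conv_norm_nonneg Q.b t
          Q.nn_integral_abs_q_kernel_le])
  then show ?thesis
    by eventually_elim (use t in \<open>simp add: perturbation_domain_iff\<close>)
qed

lemma full_measure_perturbation_domain_section:
  assumes t: "t \<in> {0<..1}"
  shows "full_measure_in UNIV {y. (t, x, y) \<in> perturbation_domain}"
proof -
  note [measurable] = perturbation_domain_measurable
  have s: "{y. (t, x, y) \<in> perturbation_domain} \<in> sets borel"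
    by measurable
  have "emeasure lborel (UNIV - {y. (t, x, y) \<in> perturbation_domain}) = 0"
    using AE_perturbation_domain[OF t, of x] s
    by (subst (asm) AE_iff_measurable[where N = "UNIV - {y. (t, x, y) \<in> perturbation_domain}"]) auto
  then show ?thesis
    using s by (simp add: full_measure_in_def)
qed

text \<open>
  By Tonelli's theorem it suffices that all sections in \<open>y\<close> have full measure.
\<close>
lemma full_measure_perturbation_domain:
  "full_measure_in ({0<..1} \<times> UNIV \<times> UNIV) perturbation_domain"
proof -
  have m [measurable]: "perturbation_domain \<in> sets borel"
    using perturbation_domain_measurable unfolding borel_prod .
  let ?N = "({0<..1} \<times> UNIV \<times> UNIV) - perturbation_domain"
  have N [measurable]: "?N \<in> sets borel"
    by (intro sets.Diff borel_Times m) auto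
  have N': "?N \<in> sets (borel \<Otimes>\<^sub>M borel \<Otimes>\<^sub>M borel)"
    using N unfolding borel_prod .
  note [measurable] = N'
  have "emeasure lborel ?N = (\<integral>\<^sup>+w. indicator ?N w \<partial>lborel)"
    by (rule nn_integral_indicator[symmetric]) (unfold sets_lborel, rule N)
  also have "\<dots> = (\<integral>\<^sup>+t. \<integral>\<^sup>+v. indicator ?N (t, v) \<partial>lborel \<partial>lborel)"
    by (rule nn_integral_lborel_prod, unfold borel_prod) (rule borel_measurable_indicator[OF N])
  also have "\<dots> = (\<integral>\<^sup>+t. \<integral>\<^sup>+x. \<integral>\<^sup>+y. indicator ?N (t, x, y) \<partial>lborel \<partial>lborel \<partial>lborel)"
    by (intro nn_integral_cong nn_integral_lborel_prod) measurable
  also have "\<dots> = (\<integral>\<^sup>+(t::real). \<integral>\<^sup>+(x::'a). 0 \<partial>lborel \<partial>lborel)"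
  proof (intro nn_integral_cong)
    fix t x
    show "(\<integral>\<^sup>+y. indicator ?N (t, x, y) \<partial>lborel) = 0"
    proof (cases "t \<in> {0<..1}")
      case True
      have "(\<integral>\<^sup>+y. indicator ?N (t, x, y) \<partial>lborel) = (\<integral>\<^sup>+(y::'a). 0 \<partial>lborel)"
        using AE_perturbation_domain[OF True, of x]
        by (intro nn_integral_cong_AE) (auto elim!: eventually_mono simp: indicator_def)
      then show ?thesis by simp
    next
      case False
      then have "indicator ?N (t, x, y) = (0 :: ennreal)" for y
        by (auto simp: indicator_def)
      then show ?thesis by simp
    qed
  qed
  finally have "emeasure lborel ?N = 0" by simp
  moreover have "perturbation_domain \<subseteq> {0<..1} \<times> UNIV \<times> UNIV"
    by (auto simp: perturbation_domain_def)
  ultimately show ?thesis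
    using m by (simp add: full_measure_in_def)
qed

lemma integrable_perturbation_integrand:
  assumes "(t, x, y) \<in> perturbation_domain"
  shows "integrable lborel (perturbation_integrand t x y)"
proof (rule integrableI_bounded)
  note [measurable (raw)] = kernel_measurable_compose[OF P.k_measurable] kernel_measurable_compose[OF q_kernel_meas]
  show "perturbation_integrand t x y \<in> borel_measurable lborel"
    unfolding conv_integrand_def[abs_def] lborel_prod[symmetric] by measurable
  show "(\<integral>\<^sup>+w. ennreal (norm (perturbation_integrand t x y w)) \<partial>lborel) < \<infinity>"
    using assms by (simp add: perturbation_domain_iff)
qed

lemma perturbation_as_iterated_integral:
  shows "set_integrable (lborel \<Otimes>\<^sub>M lborel) ({0<..<t} \<times> UNIV)
      (\<lambda>(s, z). indicator perturbation_domain (t, x, y) * p (t - s) x z * q_kernel q s z y)"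
    and "perturbed_kernel t x y = p t x y + (LINT s:{0<..<t}|lborel. LINT z|lborel.
      indicator perturbation_domain (t, x, y) * p (t - s) x z * q_kernel q s z y)"
proof -
  have eq: "(\<lambda>w. indicator ({0<..<t} \<times> UNIV) w *\<^sub>R (case w of (s, z) \<Rightarrow>
      indicator perturbation_domain (t, x, y) * p (t - s) x z * q_kernel q s z y)) =
    (\<lambda>w. indicator perturbation_domain (t, x, y) * perturbation_integrand t x y w)"
    by (auto simp: fun_eq_iff conv_integrand_def indicator_def)
  show "set_integrable (lborel \<Otimes>\<^sub>M lborel) ({0<..<t} \<times> UNIV)
      (\<lambda>(s, z). indicator perturbation_domain (t, x, y) * p (t - s) x z * q_kernel q s z y)"
    unfolding set_integrable_def eq lborel_prod
    using integrable_perturbation_integrand[of t x y] by (cases "(t, x, y) \<in> perturbation_domain") auto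
  show "perturbed_kernel t x y = p t x y + (LINT s:{0<..<t}|lborel. LINT z|lborel.
      indicator perturbation_domain (t, x, y) * p (t - s) x z * q_kernel q s z y)"
    using LINT_conv_integrand[OF integrable_perturbation_integrand[of t x y]]
    by (cases "(t, x, y) \<in> perturbation_domain") (simp_all add: perturbed_kernel_def)
qed

lemma apply_P_op:
  assumes t: "t \<in> {0<..1}"
  shows "integrable lborel (\<lambda>y. perturbed_kernel t x y * apply_bborel f y)"
    and "apply_bborel (P_op P0 Q0 t f) x = (LINT y|lborel. perturbed_kernel t x y * apply_bborel f y)"
proof -
  let ?h = "\<lambda>y. (LINT w|lborel. perturbation_integrand t x y w) * apply_bborel f y"
  note [measurable (raw)] = kernel_measurable_compose[OF kernel_measurable_perturbed_kernel]
  have V: "apply_bborel (Q_op Q0 s f) z = (LINT y|lborel. q_kernel q s z y * apply_bborel f y)"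
    if "s \<in> {0<..1}" for s z
    by (rule Q.apply_Q_op_kernel[OF that])
  have h: "integrable lborel ?h"
    by (rule P.convolution_kernel(1)[OF q_kernel_meas Q.suminf_conv_norm_nonneg Q.b t
          Q.nn_integral_abs_q_kernel_le V])
  have "apply_bborel (set_Bochner_integral lborel {0<..<t} (\<lambda>s. P0 (t - s) (Q_op Q0 s f))) x =
      (LINT s:{0<..<t}|lborel. apply_bborel (P0 (t - s) (Q_op Q0 s f)) x)"
  proof (rule P.apply_convolution[OF Q.continuous_on_Q_op _ Q.b _ t])
    show "0 \<le> total_norm * norm f"
      by (simp add: Q.suminf_conv_norm_nonneg)
    show "norm (Q_op Q0 s f) \<le> total_norm * norm f * s powr (b - 1)" if "s \<in> {0<..1}" for s
      using Q.norm_Q_op_le[OF that, of f] by (simp add: mult_ac)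
  qed
  also have "\<dots> = (LINT y|lborel. ?h y)"
    by (rule P.convolution_kernel(2)[OF q_kernel_meas Q.suminf_conv_norm_nonneg Q.b t
          Q.nn_integral_abs_q_kernel_le V])
  finally have P_op: "apply_bborel (P_op P0 Q0 t f) x =
      (LINT y|lborel. p t x y * apply_bborel f y + ?h y)"
    using P.kernel[OF t, of x f] h by (simp add: P_op_def plus_bborel.rep_eq)
  have AE: "AE y in lborel. p t x y * apply_bborel f y + ?h y = perturbed_kernel t x y * apply_bborel f y"
    using AE_perturbation_domain[OF t, of x]
    by eventually_elim (simp add: perturbed_kernel_def algebra_simps)
  have sum: "integrable lborel (\<lambda>y. p t x y * apply_bborel f y + ?h y)"
    using P.kernel[OF t, of x f] h by simp
  have m: "(\<lambda>y. perturbed_kernel t x y * apply_bborel f y) \<in> borel_measurable lborel"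
    by measurable
  show "integrable lborel (\<lambda>y. perturbed_kernel t x y * apply_bborel f y)"
    by (rule integrable_cong_AE_imp[OF sum m AE])
  show "apply_bborel (P_op P0 Q0 t f) x = (LINT y|lborel. perturbed_kernel t x y * apply_bborel f y)"
    unfolding P_op by (rule integral_cong_AE[OF borel_measurable_integrable[OF sum] m AE])
qed

text \<open>
  For the family \<open>P0\<close> the exponent is \<open>b = 1\<close>, so the convolution bound has the factor
  \<open>t\<^bsup>1+b-1\<^esup> = t\<^bsup>b\<^esup> \<le> 1\<close> and is uniform in \<open>t\<close>.
\<close>
lemma nn_integral_abs_perturbed_kernel_le:
  assumes t: "t \<in> {0<..1}"
  shows "(\<integral>\<^sup>+y. ennreal \<bar>perturbed_kernel t x y\<bar> \<partial>lborel) \<le> ennreal (C + C * Beta 1 b * total_norm)"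
proof -
  let ?I = "\<lambda>y. \<integral>\<^sup>+w. ennreal \<bar>perturbation_integrand t x y w\<bar> \<partial>lborel"
  note [measurable (raw)] = kernel_measurable_compose[OF kernel_measurable_perturbation_norm]
    kernel_measurable_compose[OF P.k_measurable]
  have c: "0 \<le> C * Beta 1 b * total_norm"
    using P.K Q.b by (intro mult_nonneg_nonneg Beta_real_nonneg Q.suminf_conv_norm_nonneg) auto
  have "(\<integral>\<^sup>+y. ennreal \<bar>perturbed_kernel t x y\<bar> \<partial>lborel) \<le> (\<integral>\<^sup>+y. ennreal \<bar>p t x y\<bar> + ?I y \<partial>lborel)"
  proof (rule nn_integral_mono)
    fix y
    have "\<bar>perturbed_kernel t x y\<bar> \<le> \<bar>p t x y\<bar> + \<bar>LINT w|lborel. perturbation_integrand t x y w\<bar>"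
      by (auto simp: perturbed_kernel_def indicator_def)
    then have "ennreal \<bar>perturbed_kernel t x y\<bar> \<le>
        ennreal \<bar>p t x y\<bar> + ennreal \<bar>LINT w|lborel. perturbation_integrand t x y w\<bar>"
      by (simp flip: ennreal_plus add: ennreal_leI)
    also have "\<dots> \<le> ennreal \<bar>p t x y\<bar> + ?I y"
      by (intro add_left_mono abs_integral_le_nn_integral)
    finally show "ennreal \<bar>perturbed_kernel t x y\<bar> \<le> ennreal \<bar>p t x y\<bar> + ?I y" .
  qed
  also have "\<dots> = (\<integral>\<^sup>+y. ennreal \<bar>p t x y\<bar> \<partial>lborel) + (\<integral>\<^sup>+y. ?I y \<partial>lborel)"
    by (rule nn_integral_add) measurable
  also have "\<dots> \<le> ennreal (C * t powr (1 - 1)) + ennreal (C * Beta 1 b * total_norm * t powr (1 + b - 1))"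
    by (intro add_mono P.nn_integral_abs_kernel_le t P.nn_integral_conv_integrand_le q_kernel_meas
        Q.suminf_conv_norm_nonneg Q.b Q.nn_integral_abs_q_kernel_le)
  also have "\<dots> \<le> ennreal C + ennreal (C * Beta 1 b * total_norm)"
  proof (intro add_mono ennreal_leI)
    have "t powr (1 + b - 1) \<le> 1"
      using t Q.b by (intro powr_le1) auto
    then show "C * Beta 1 b * total_norm * t powr (1 + b - 1) \<le> C * Beta 1 b * total_norm"
      using mult_left_mono[OF _ c] by fastforce
  qed (use t in simp)
  also have "\<dots> = ennreal (C + C * Beta 1 b * total_norm)"
    using P.K c by simp
  finally show ?thesis .
qed

end

lemma kernel_measurable_zero_extension:
  assumes "(\<lambda>(t, x, y). k t x y) \<in> borel_measurable (restrict_space borel ({0<..1} \<times> UNIV \<times> UNIV))"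
  shows "kernel_measurable (\<lambda>t x y. if t \<in> {0<..1} then k t x y :: real else 0)"
proof -
  have "{0<..1::real} \<times> (UNIV :: 'a set) \<times> (UNIV :: 'a set) \<in> sets borel"
    by (intro borel_Times) auto
  then have "(\<lambda>w. indicator ({0<..1} \<times> UNIV \<times> UNIV) w *\<^sub>R (case w of (t, x, y) \<Rightarrow> k t x y)) \<in> borel_measurable borel"
    using assms by (subst (asm) borel_measurable_restrict_space_iff) auto
  also have "(\<lambda>w. indicator ({0<..1} \<times> UNIV \<times> UNIV) w *\<^sub>R (case w of (t, x, y) \<Rightarrow> k t x y)) =
      (\<lambda>(t, x, y). if t \<in> {0<..1} then k t x y else 0)"
    by (auto simp: fun_eq_iff indicator_def)
  finally show ?thesis
    by (simp add: borel_prod)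
qed

theorem proposition3p21:
  fixes r :: "real \<Rightarrow> real"
    and P0 Q0 :: "real \<Rightarrow> (real ^ 'd) bborel \<Rightarrow> (real ^ 'd) bborel"
    and p0 q0 :: "real \<Rightarrow> real ^ 'd \<Rightarrow> real ^ 'd \<Rightarrow> real"
  assumes R0: "\<And>t. t \<in> {0<..1} \<Longrightarrow> 0 \<le> r t"
      "mono_on {0<..1} r"
      "\<And>t l. t \<in> {0<..1} \<Longrightarrow> 0 < l \<Longrightarrow> l \<le> 1 \<Longrightarrow> r (l * t) \<le> sqrt l * r t"
    and S1: "\<And>t. t \<in> {0<..1} \<Longrightarrow> linear (P0 t)"
      "\<And>t. t \<in> {0<..1} \<Longrightarrow> linear (Q0 t)"
    and H1: "\<exists>C1>0. \<forall>t\<in>{0<..1}. \<forall>f. norm (P0 t f) \<le> C1 * norm f"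
    and H2: "\<And>t f. t \<in> {0<..1} \<Longrightarrow>
      ((\<lambda>s. norm (P0 s f - P0 t f)) \<longlongrightarrow> 0) (at t within {0<..1})"
    and H3: "\<exists>C3>0. \<exists>\<epsilon>0>0. \<forall>t\<in>{0<..1}. \<forall>f.
      norm (Q0 t f) \<le> C3 * inverse t * r t powr \<epsilon>0 * norm f"
    and H4: "\<And>t f. t \<in> {0<..1} \<Longrightarrow>
      ((\<lambda>s. norm (Q0 s f - Q0 t f)) \<longlongrightarrow> 0) (at t within {0<..1})"
    and S3_borel:
      "(\<lambda>(t, x, y). p0 t x y) \<in> borel_measurable (restrict_space borel ({0<..1} \<times> UNIV \<times> UNIV))"
      "(\<lambda>(t, x, y). q0 t x y) \<in> borel_measurable (restrict_space borel ({0<..1} \<times> UNIV \<times> UNIV))"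
    and S3_P: "\<And>t x f. t \<in> {0<..1} \<Longrightarrow>
      integrable lborel (\<lambda>y. p0 t x y * apply_bborel f y) \<and>
      apply_bborel (P0 t f) x = (LINT y|lborel. p0 t x y * apply_bborel f y)"
    and S3_Q: "\<And>t x f. t \<in> {0<..1} \<Longrightarrow>
      integrable lborel (\<lambda>y. q0 t x y * apply_bborel f y) \<and>
      apply_bborel (Q0 t f) x = (LINT y|lborel. q0 t x y * apply_bborel f y)"
  shows "\<exists>Sp :: (real \<times> (real ^ 'd) \<times> (real ^ 'd)) set.
    full_measure_in ({0<..1} \<times> UNIV \<times> UNIV) Sp \<and>
    (\<forall>t\<in>{0<..1}. \<forall>x. full_measure_in UNIV {y. (t, x, y) \<in> Sp}) \<and>
    (\<exists>p :: real \<Rightarrow> real ^ 'd \<Rightarrow> real ^ 'd \<Rightarrow> real.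
      (\<lambda>(t, x, y). p t x y) \<in> borel_measurable (restrict_space borel ({0<..1} \<times> UNIV \<times> UNIV)) \<and>
      (\<forall>t\<in>{0<..1}. \<forall>x y.
        set_integrable (lborel \<Otimes>\<^sub>M lborel) ({0<..<t} \<times> UNIV)
          (\<lambda>(s, z). indicator Sp (t, x, y) * p0 (t - s) x z * q_kernel q0 s z y) \<and>
        p t x y = p0 t x y +
          (LINT s:{0<..<t}|lborel. LINT z|lborel.
            indicator Sp (t, x, y) * p0 (t - s) x z * q_kernel q0 s z y)) \<and>
      (\<forall>t\<in>{0<..1}. \<forall>x f.
        integrable lborel (\<lambda>y. p t x y * apply_bborel f y) \<and>
        apply_bborel (P_op P0 Q0 t f) x = (LINT y|lborel. p t x y * apply_bborel f y)) \<and>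
      (\<exists>c>0. \<forall>t\<in>{0<..1}. \<forall>x.
        integrable lborel (\<lambda>y. p t x y) \<and> (LINT y|lborel. \<bar>p t x y\<bar>) \<le> c))"
proof -
  obtain C1 where C1: "0 < C1" "\<And>t f. t \<in> {0<..1} \<Longrightarrow> norm (P0 t f) \<le> C1 * norm f"
    using H1 by blast
  obtain C3 e where C3: "0 < C3" and e: "0 < e"
    and Q_le: "\<And>t f. t \<in> {0<..1} \<Longrightarrow> norm (Q0 t f) \<le> C3 * inverse t * r t powr e * norm f"
    using H3 by blast
  \<comment> \<open>Scaling from time 1 gives \<open>r t \<le> sqrt t * r 1\<close>, so \<open>r t powr e\<close> gains the factor \<open>t powr (e / 2)\<close>.\<close>
  define K where "K = C3 * r 1 powr e"
  have Q_norm: "norm (Q0 t f) \<le> K * t powr (e / 2 - 1) * norm f" if t: "t \<in> {0<..1}" for t f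
  proof -
    have "r t powr e \<le> (sqrt t * r 1) powr e"
      using R0(1)[OF t] R0(3)[of 1 t] t e by (intro powr_mono2) auto
    also have "\<dots> = t powr (e / 2) * r 1 powr e"
      using t R0(1)[of 1] by (simp add: powr_mult powr_half_sqrt[symmetric] powr_powr)
    finally have "C3 * inverse t * r t powr e * norm f \<le>
        C3 * inverse t * (t powr (e / 2) * r 1 powr e) * norm f"
      using C3 t by (intro mult_right_mono mult_left_mono) auto
    also have "\<dots> = K * (inverse t * t powr (e / 2)) * norm f"
      by (simp add: K_def mult_ac)
    also have "inverse t * t powr (e / 2) = t powr (e / 2 - 1)"
      using t powr_diff[of t "e / 2" 1] by (simp add: field_simps)
    finally show ?thesis
      using Q_le[OF t, of f] by linarith
  qed
  define p0' where "p0' = (\<lambda>t x y. if t \<in> {0<..1} then p0 t x y else 0)"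
  define q0' where "q0' = (\<lambda>t x y. if t \<in> {0<..1} then q0 t x y else 0)"
  have "kernel_operators P0 C1 1 p0'"
  proof (intro kernel_operators.intro singular_operators.intro kernel_operators_axioms.intro)
    show "kernel_measurable p0'"
      unfolding p0'_def by (rule kernel_measurable_zero_extension[OF S3_borel(1)])
    fix t :: real and f x
    assume t: "t \<in> {0<..1}"
    show "norm (P0 t f) \<le> C1 * t powr (1 - 1) * norm f"
      using C1(2)[OF t, of f] t by simp
    show "integrable lborel (\<lambda>y. p0' t x y * apply_bborel f y) \<and>
        apply_bborel (P0 t f) x = (LINT y|lborel. p0' t x y * apply_bborel f y)"
      using S3_P[OF t, of x f] t by (simp add: p0'_def)
  qed (use C1(1) S1(1) H2 in \<open>simp_all only: less_imp_le zero_less_one\<close>)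
  moreover have "kernel_operators Q0 K (e / 2) q0'"
  proof (intro kernel_operators.intro singular_operators.intro kernel_operators_axioms.intro)
    show "0 \<le> K" "0 < e / 2"
      using C3 e by (simp_all add: K_def)
    show "kernel_measurable q0'"
      unfolding q0'_def by (rule kernel_measurable_zero_extension[OF S3_borel(2)])
    fix t :: real and f x
    assume t: "t \<in> {0<..1}"
    show "integrable lborel (\<lambda>y. q0' t x y * apply_bborel f y) \<and>
        apply_bborel (Q0 t f) x = (LINT y|lborel. q0' t x y * apply_bborel f y)"
      using S3_Q[OF t, of x f] t by (simp add: q0'_def)
  qed (fact S1(2) Q_norm H4)+
  ultimately interpret perturbed_operators P0 Q0 C1 K "e / 2" p0' q0'
    by (rule perturbed_operators.intro)
  have q_eq: "q_kernel q0' = q_kernel q0"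
    by (rule q_kernel_cong) (simp add: q0'_def)
  let ?c = "C1 + C1 * Beta 1 (e / 2) * total_norm + 1"
  have c: "0 \<le> C1 * Beta 1 (e / 2) * total_norm"
    using C1 e by (intro mult_nonneg_nonneg Beta_real_nonneg Q.suminf_conv_norm_nonneg) auto
  show ?thesis
  proof (intro exI[of _ perturbation_domain] exI[of _ perturbed_kernel] exI[of _ ?c] conjI ballI allI)
    show "full_measure_in ({0<..1} \<times> UNIV \<times> UNIV) perturbation_domain"
      by (rule full_measure_perturbation_domain)
    show "(\<lambda>(t, x, y). perturbed_kernel t x y) \<in>
        borel_measurable (restrict_space borel ({0<..1} \<times> UNIV \<times> UNIV))"
      using kernel_measurable_perturbed_kernel by (intro measurable_restrict_space1) (simp add: borel_prod)
    show "0 < ?c"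
      using C1 c by linarith
    fix t :: real and x :: "real ^ 'd"
    assume t: "t \<in> {0<..1}"
    show "full_measure_in UNIV {y. (t, x, y) \<in> perturbation_domain}"
      by (rule full_measure_perturbation_domain_section[OF t])
    have abs_le: "(\<integral>\<^sup>+y. ennreal \<bar>perturbed_kernel t x y\<bar> \<partial>lborel) \<le> ennreal ?c"
      by (rule order_trans[OF nn_integral_abs_perturbed_kernel_le[OF t]]) (simp add: ennreal_leI)
    note [measurable (raw)] = kernel_measurable_compose[OF kernel_measurable_perturbed_kernel]
    show int: "integrable lborel (\<lambda>y. perturbed_kernel t x y)"
    proof (rule integrableI_bounded)
      show "(\<integral>\<^sup>+y. ennreal (norm (perturbed_kernel t x y)) \<partial>lborel) < \<infinity>"
        using order_le_less_trans[OF abs_le] by simp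
    qed measurable
    have "ennreal (LINT y|lborel. \<bar>perturbed_kernel t x y\<bar>) \<le> ennreal ?c"
      using abs_le int by (subst (asm) nn_integral_eq_integral) auto
    then show "(LINT y|lborel. \<bar>perturbed_kernel t x y\<bar>) \<le> ?c"
      using C1 c by (subst (asm) ennreal_le_iff) auto
    {
      fix f
      show "integrable lborel (\<lambda>y. perturbed_kernel t x y * apply_bborel f y)"
        by (rule apply_P_op(1)[OF t])
      show "apply_bborel (P_op P0 Q0 t f) x = (LINT y|lborel. perturbed_kernel t x y * apply_bborel f y)"
        by (rule apply_P_op(2)[OF t])
    }
    fix y
    have "set_integrable (lborel \<Otimes>\<^sub>M lborel) ({0<..<t} \<times> UNIV)
        (\<lambda>(s, z). indicator perturbation_domain (t, x, y) * p0' (t - s) x z * q_kernel q0 s z y)"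
      using perturbation_as_iterated_integral(1)[of t x y] unfolding q_eq .
    then show "set_integrable (lborel \<Otimes>\<^sub>M lborel) ({0<..<t} \<times> UNIV)
        (\<lambda>(s, z). indicator perturbation_domain (t, x, y) * p0 (t - s) x z * q_kernel q0 s z y)"
      unfolding set_integrable_def
      by (rule Bochner_Integration.integrable_cong[THEN iffD1, rotated 2])
         (use t in \<open>auto simp: p0'_def indicator_def\<close>)
    have "perturbed_kernel t x y = p0 t x y + (LINT s:{0<..<t}|lborel. LINT z|lborel.
        indicator perturbation_domain (t, x, y) * p0' (t - s) x z * q_kernel q0 s z y)"
      using perturbation_as_iterated_integral(2)[of t x y] t unfolding q_eq by (simp add: p0'_def)
    also have "(LINT s:{0<..<t}|lborel. LINT z|lborel.
        indicator perturbation_domain (t, x, y) * p0' (t - s) x z * q_kernel q0 s z y) =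
      (LINT s:{0<..<t}|lborel. LINT z|lborel.
        indicator perturbation_domain (t, x, y) * p0 (t - s) x z * q_kernel q0 s z y)"
      unfolding set_lebesgue_integral_def
      by (intro Bochner_Integration.integral_cong refl)
         (use t in \<open>auto simp: p0'_def indicator_def\<close>)
    finally show "perturbed_kernel t x y = p0 t x y + (LINT s:{0<..<t}|lborel. LINT z|lborel.
        indicator perturbation_domain (t, x, y) * p0 (t - s) x z * q_kernel q0 s z y)" .
  qed
qed

end
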